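(* Let $((X_t,\sigma_t))_{t\in\mathbb Z}$ be the strictly stationary AGARCH$(p,q)$ process with true parameter $\theta_0=(\alpha_0^\circ,\alpha_1^\circ,\dots,\alpha_p^\circ,\beta_1^\circ,\dots,\beta_q^\circ,\gamma^\circ)^T$, such that 1. $\alpha_i^\circ>0$ for some $i\in\{1,\dots,p\}$ and $(\alpha_p^\circ,\beta_q^\circ)\ne(0,0)$; 2. the polynomials $a^\circ(z)=\sum_{i=1}^p\alpha_i^\circ z^i$ and $b^\circ(z)=1-\sum_{j=1}^q\beta_j^\circ z^j$ have no common zeros. Suppose the distribution of $Z_0$ is not concentrated at two points, and let $K\subset(0,\infty)\times[0,\infty)^p\times B\times[-1,1]$ be compact with $\theta_0\in K$, where $B=\{(\beta_1,\dots,\beta_q)^T\in[0,1)^q:\sum_{j=1}^q\beta_j<1\}$. Then the QMLE $\hat\theta_n$ is strongly consistent: $\hat\theta_n\to\theta_0$ a.s.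
   Context: $(Z_t)_{t\in\mathbb Z}$ i.i.d. with $\mathbb EZ_0=0$, $\mathbb EZ_0^2=1$, $\mathcal F_t=\sigma(Z_k:k\le t)$. AGARCH$(p,q)$ with parameter $(\alpha_0,\dots,\alpha_p,\beta_1,\dots,\beta_q,\gamma)$, $\alpha_0>0$, $\alpha_i,\beta_j\ge0$, $|\gamma|\le1$: $X_t=\sigma_tZ_t$, $\sigma_t^2=\alpha_0+\sum_{i=1}^p\alpha_i(|X_{t-i}|-\gamma X_{t-i})^2+\sum_{j=1}^q\beta_j\sigma_{t-j}^2$, $t\in\mathbb Z$, with $\sigma_t\ge0$ $\mathcal F_{t-1}$-measurable; the process in the claim is the unique strictly stationary solution for $\theta_0$. For $\theta=(\alpha_0,\dots,\alpha_p,\beta_1,\dots,\beta_q,\gamma)\in K$ and fixed initial values $\hat h_0(\theta)=\dots=\hat h_{-q+1}(\theta)$ given by the coordinates of a fixed vector in $[0,\infty)^q$, define recursively $\hat h_t(\theta)=\alpha_0+\sum_{i=1}^p\alpha_i(|X_{t-i}|-\gamma X_{t-i})^2+\sum_{j=1}^q\beta_j\hat h_{t-j}(\theta)$, $t\ge1$, using data $X_{-p+1},\dots,X_n$. $\hat L_n(\theta)=-\frac12\sum_{t=1}^n(X_t^2/\hat h_t(\theta)+\log\hat h_t(\theta))$, and the QMLE $\hat\theta_n$ maximizes $\hat L_n$ over $K$. *)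

theory Defs
  imports "HOL-Probability.Probability"
begin

text \<open>Parameters theta = (alpha_0, alpha_1..alpha_p, beta_1..beta_q, gamma) are encoded as
  functions th :: nat => real with th 0 = alpha_0, th i = alpha_i (1 <= i <= p),
  th (p+j) = beta_j (1 <= j <= q), th (p+q+1) = gamma, and th k = 0 for k > p+q+1.
  On this finite-dimensional subspace the product topology of nat => real is the Euclidean one.\<close>

definition alpha0 :: "(nat \<Rightarrow> real) \<Rightarrow> real" where
  "alpha0 th = th 0"
definition alpha :: "(nat \<Rightarrow> real) \<Rightarrow> nat \<Rightarrow> real" where
  "alpha th i = th i"
definition beta :: "nat \<Rightarrow> (nat \<Rightarrow> real) \<Rightarrow> nat \<Rightarrow> real" where
  "beta p th j = th (p + j)"
definition gam :: "nat \<Rightarrow> nat \<Rightarrow> (nat \<Rightarrow> real) \<Rightarrow> real" where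
  "gam p q th = th (p + q + 1)"

definition Bset :: "nat \<Rightarrow> (nat \<Rightarrow> real) set" where
  "Bset q = {b. (\<forall>j\<in>{1..q}. 0 \<le> b j \<and> b j < 1) \<and> (\<Sum>j=1..q. b j) < 1}"

definition param_space :: "nat \<Rightarrow> nat \<Rightarrow> (nat \<Rightarrow> real) set" where
  "param_space p q = {th. (\<forall>k>p+q+1. th k = 0) \<and> alpha0 th > 0
      \<and> (\<forall>i\<in>{1..p}. alpha th i \<ge> 0) \<and> beta p th \<in> Bset q
      \<and> \<bar>gam p q th\<bar> \<le> 1}"

definition natfilt :: "'a measure \<Rightarrow> (int \<Rightarrow> 'a \<Rightarrow> real) \<Rightarrow> int \<Rightarrow> 'a measure" where
  "natfilt M Z t = sigma (space M) (\<Union>k\<in>{..t}. {Z k -` A \<inter> space M | A. A \<in> sets borel})"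

definition strictly_stationary :: "'a measure \<Rightarrow> (int \<Rightarrow> 'a \<Rightarrow> 'b::topological_space) \<Rightarrow> bool" where
  "strictly_stationary M Y \<longleftrightarrow> (\<forall>h::int.
     distr M (PiM UNIV (\<lambda>_. borel)) (\<lambda>\<omega> t. Y (t + h) \<omega>) =
     distr M (PiM UNIV (\<lambda>_. borel)) (\<lambda>\<omega> t. Y t \<omega>))"

text \<open>Quasi-likelihood volatility recursion.  hhat p q c x th k is \<open>\<hat>h_k(theta)\<close> for k >= 1
  computed from the data x (x t = X_t, t >= -p+1) and fixed initial values c s (s = -q+1..0).
  For k = 0 it returns c 0.\<close>
function hhat :: "nat \<Rightarrow> nat \<Rightarrow> (int \<Rightarrow> real) \<Rightarrow> (int \<Rightarrow> real) \<Rightarrow> (nat \<Rightarrow> real) \<Rightarrow> nat \<Rightarrow> real" where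
  "hhat p q c x th k =
     (if k = 0 then c 0
      else alpha0 th
        + (\<Sum>i=1..p. alpha th i * (\<bar>x (int k - int i)\<bar> - gam p q th * x (int k - int i))\<^sup>2)
        + (\<Sum>j=1..q. beta p th j *
             (if k \<le> j then c (int k - int j) else hhat p q c x th (k - j))))"
  by pat_completeness auto
termination
  by (relation "Wellfounded.measure (\<lambda>(p, q, c, x, th, k). k)") auto

definition Lhat :: "nat \<Rightarrow> nat \<Rightarrow> (int \<Rightarrow> real) \<Rightarrow> (int \<Rightarrow> real) \<Rightarrow> nat \<Rightarrow> (nat \<Rightarrow> real) \<Rightarrow> real" where
  "Lhat p q c x n th =
     - (1/2) * (\<Sum>t=1..n. (x (int t))\<^sup>2 / hhat p q c x th t + ln (hhat p q c x th t))"

end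

theory Submission
  imports Defs "HOL-Computational_Algebra.Fundamental_Theorem_Algebra"
begin

text \<open>Stationarity makes the volatility tight, and this forces it to be a function of the past innovations:
  on every block of times where the volatility is bounded, a homogeneous solution of its recursion loses a
  fixed fraction relative to it. By ergodicity such blocks have positive frequency, so homogeneous
  solutions decay exponentially, and this yields a fractional moment of the volatility. Hence the
  stationary filters at all parameters exist, and starting values are forgotten exponentially fast.

  Filters are monotone in the parameters, so a small neighbourhood of a parameter other than the true one is
  controlled by two stationary filters. The likelihood deficit at the parameter has positive mean, since
  \<open>r - 1 - ln r\<close> is nonnegative and vanishes only at \<open>r = 1\<close>, and since equality of the
  filtered volatilities identifies the parameter. The ergodic theorem and compactness conclude.\<close>

section \<open>Ergodicity of the shift on independent sequences\<close>

text \<open>The obstacle is that no moment of the process is given: a priori neither the filter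
  series nor the expected likelihood need exist. The usual source of a logarithmic moment is the top
  Lyapunov exponent of a product of random matrices. Here it is replaced by a scalar comparison: a
  homogeneous solution is measured against the volatility itself, and every bounded block removes
  the share that the constant term contributes. Three choices keep the analysis light. All
  probability is done on the product space of the innovations, where the shift is mixing.
  Consistency needs only a lower bound on the likelihood deficit, so one-sided bounds on ergodic
  sums suffice, and a maximal inequality gives them without pointwise convergence. Finally the
  deficit may have mean plus infinity, since \<open>X_t^2 / h_t\<close> need not be integrable; it
  is truncated from above before averaging, while its lower part is integrable by the fractional
  moment.\<close>

primrec birkhoff_max :: "('a \<Rightarrow> 'a) \<Rightarrow> ('a \<Rightarrow> real) \<Rightarrow> nat \<Rightarrow> 'a \<Rightarrow> real" where
  "birkhoff_max T f 0 = (\<lambda>x. 0)"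
| "birkhoff_max T f (Suc n) = (\<lambda>x. max 0 (f x + birkhoff_max T f n (T x)))"

lemma birkhoff_max_nonneg: "0 \<le> birkhoff_max T f n x"
  by (cases n) auto

lemma birkhoff_max_mono_Suc: "birkhoff_max T f n x \<le> birkhoff_max T f (Suc n) x"
proof (induction n arbitrary: x)
  case (Suc n)
  show ?case using Suc[of "T x"] by simp
qed simp

lemma birkhoff_max_mono: "m \<le> n \<Longrightarrow> birkhoff_max T f m x \<le> birkhoff_max T f n x"
  by (rule lift_Suc_mono_le[of "\<lambda>n. birkhoff_max T f n x"]) (auto intro: birkhoff_max_mono_Suc simp del: birkhoff_max.simps)

lemma birkhoff_sum_le_max: "(\<Sum>i<n. f ((T ^^ i) x)) \<le> birkhoff_max T f n x"
proof (induction n arbitrary: x)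
  case (Suc n)
  have "(\<Sum>i<Suc n. f ((T ^^ i) x)) = f x + (\<Sum>i<n. f ((T ^^ i) (T x)))"
    by (subst sum.lessThan_Suc_shift) (simp add: funpow_swap1)
  then show ?case using Suc[of "T x"] by simp
qed simp

text \<open>Garsia's proof of the maximal inequality; \<open>birkhoff_max T f n\<close> is the
  largest of 0 and the first n partial sums. Where \<open>G (Suc n)\<close> is positive, f equals
  \<open>G (Suc n) x - G n (T x)\<close>; elsewhere this difference is at most 0. Its integral is
  nonnegative because T preserves the integral of \<open>G n\<close>, and \<open>G n\<close> grows
  with n.\<close>

lemma (in prob_space) integral_positive_max_nonneg:
  fixes f :: "'a \<Rightarrow> real"
  assumes T[measurable]: "T \<in> measurable M M" and pres: "distr M M T = M"
    and f: "integrable M f"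
  shows "0 \<le> (\<integral>x. indicator {x \<in> space M. 0 < birkhoff_max T f (Suc n) x} x * f x \<partial>M)"
proof -
  let ?G = "birkhoff_max T f"
  have [measurable]: "f \<in> borel_measurable M" using f by auto
  have Gm[measurable]: "?G n \<in> borel_measurable M" for n by (induction n) auto
  have intT: "integrable M (\<lambda>x. g (T x)) \<and> (\<integral>x. g (T x) \<partial>M) = (\<integral>x. g x \<partial>M)"
    if "integrable M g" for g :: "'a \<Rightarrow> real"
  proof -
    have [measurable]: "g \<in> borel_measurable M" using that by auto
    show ?thesis
      using integrable_distr_eq[OF T, of g] integral_distr[OF T, of g] that pres by auto
  qed
  have Gi: "integrable M (?G n)" for n
  proof (induction n)
    case (Suc n)
    then show ?case using intT[OF Suc] f by auto
  qed auto
  let ?A = "{x \<in> space M. 0 < ?G (Suc n) x}"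
  have "0 \<le> (\<integral>x. ?G (Suc n) x \<partial>M) - (\<integral>x. ?G n (T x) \<partial>M)"
    using intT[OF Gi[of n]] integral_mono[OF Gi Gi, of n "Suc n"] birkhoff_max_mono_Suc[of T f n]
    by (simp del: birkhoff_max.simps)
  also have "\<dots> = (\<integral>x. ?G (Suc n) x - ?G n (T x) \<partial>M)"
    using intT[OF Gi[of n]] Gi[of "Suc n"] by (intro Bochner_Integration.integral_diff[symmetric]) blast+
  also have "\<dots> \<le> (\<integral>x. indicator ?A x * f x \<partial>M)"
  proof (rule integral_mono)
    show "integrable M (\<lambda>x. ?G (Suc n) x - ?G n (T x))"
      using intT[OF Gi[of n]] Gi[of "Suc n"] by (intro Bochner_Integration.integrable_diff) blast+
    show "integrable M (\<lambda>x. indicator ?A x * f x)"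
      using integrable_mult_indicator[OF _ f, of ?A] by (simp del: birkhoff_max.simps)
    show "?G (Suc n) x - ?G n (T x) \<le> indicator ?A x * f x" if "x \<in> space M" for x
      using that birkhoff_max_nonneg[of T f n "T x"] by (auto simp: indicator_def max_def split: if_splits)
  qed
  finally show ?thesis .
qed

text \<open>The set where the running maxima are unbounded is invariant. If it had full measure, the
  maximal inequality would give a nonnegative integral.\<close>
lemma (in prob_space) birkhoff_sums_bounded_above:
  fixes f :: "'a \<Rightarrow> real"
  assumes T[measurable]: "T \<in> measurable M M" and pres: "distr M M T = M"
    and erg: "\<And>A. A \<in> sets M \<Longrightarrow> T -` A \<inter> space M = A \<Longrightarrow> prob A = 0 \<or> prob A = 1"
    and f: "integrable M f" and neg: "(\<integral>x. f x \<partial>M) < 0"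
  shows "AE x in M. \<exists>C. \<forall>n. (\<Sum>i<n. f ((T ^^ i) x)) \<le> C"
proof -
  let ?G = "birkhoff_max T f"
  have [measurable]: "f \<in> borel_measurable M" using f by auto
  have Gm[measurable]: "?G n \<in> borel_measurable M" for n by (induction n) auto
  define A where "A = {x \<in> space M. \<forall>C::nat. \<exists>n. real C < ?G n x}"
  have Am[measurable]: "A \<in> sets M" unfolding A_def by measurable
  have unb: "(\<forall>C::nat. \<exists>n. real C < ?G n (T x)) \<longleftrightarrow> (\<forall>C::nat. \<exists>n. real C < ?G n x)" for x
  proof
    assume L: "\<forall>C::nat. \<exists>n. real C < ?G n (T x)"
    show "\<forall>C::nat. \<exists>n. real C < ?G n x"
    proof
      fix C :: nat
      obtain D :: nat where "real C - f x < real D" using reals_Archimedean2 by blast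
      moreover obtain n where "real D < ?G n (T x)" using L by blast
      ultimately have "real C < ?G (Suc n) x" by auto
      then show "\<exists>n. real C < ?G n x" by blast
    qed
  next
    assume R: "\<forall>C::nat. \<exists>n. real C < ?G n x"
    show "\<forall>C::nat. \<exists>n. real C < ?G n (T x)"
    proof
      fix C :: nat
      obtain D :: nat where D: "real C + \<bar>f x\<bar> < real D" using reals_Archimedean2 by blast
      obtain n where n: "real D < ?G n x" using R by blast
      with D obtain m where m: "n = Suc m" by (cases n) auto
      have "real C < ?G m (T x)" using n D unfolding m by (auto simp: max_def split: if_splits)
      then show "\<exists>n. real C < ?G n (T x)" by blast
    qed
  qed
  have "T -` A \<inter> space M = A"
    unfolding A_def using unb measurable_space[OF T] by auto
  then consider "prob A = 0" | "prob A = 1" using erg[OF Am] by auto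
  then show ?thesis
  proof cases
    case 1
    then have "AE x in M. x \<notin> A" using AE_iff_measurable[OF Am] prob_eq_0 Am by simp
    then show ?thesis
    proof (rule AE_mp, intro AE_I2 impI)
      fix x assume "x \<in> space M" "x \<notin> A"
      then obtain C :: nat where "\<And>n. ?G n x \<le> real C" unfolding A_def by (auto simp: not_less)
      then have "\<forall>n. (\<Sum>i<n. f ((T ^^ i) x)) \<le> real C"
        using birkhoff_sum_le_max[where f=f and T=T and x=x] order_trans by blast
      then show "\<exists>C. \<forall>n. (\<Sum>i<n. f ((T ^^ i) x)) \<le> C" by blast
    qed
  next
    case 2
    then have AE: "AE x in M. x \<in> A" using prob_eq_1 Am by simp
    \<comment> \<open>At almost every point some running maximum is positive, and by monotonicity
      all later ones are, so the indicators are eventually 1.\<close>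
    have "(\<lambda>n. \<integral>x. indicator {x \<in> space M. 0 < ?G (Suc n) x} x * f x \<partial>M) \<longlonglongrightarrow> (\<integral>x. f x \<partial>M)"
    proof (rule integral_dominated_convergence[where w="\<lambda>x. \<bar>f x\<bar>"])
      show "AE x in M. (\<lambda>n. indicator {x \<in> space M. 0 < ?G (Suc n) x} x * f x) \<longlonglongrightarrow> f x"
        using AE
      proof (rule AE_mp, intro AE_I2 impI)
        fix x :: 'a assume x: "x \<in> space M" "x \<in> A"
        then obtain N where "real 0 < ?G N x" unfolding A_def by blast
        then have N: "0 < ?G N x" by simp
        have "indicator {x \<in> space M. 0 < ?G (Suc n) x} x * f x = f x" if "n \<ge> N" for n
          using birkhoff_max_mono[of N "Suc n" T f x] N x that by (auto simp del: birkhoff_max.simps)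
        then have "eventually (\<lambda>n. f x = indicator {x \<in> space M. 0 < ?G (Suc n) x} x * f x) sequentially"
          unfolding eventually_sequentially by (metis)
        then show "(\<lambda>n. indicator {x \<in> space M. 0 < ?G (Suc n) x} x * f x) \<longlonglongrightarrow> f x"
          by (rule Lim_transform_eventually[OF tendsto_const])
      qed
    qed (use f in \<open>auto simp: indicator_def\<close>)
    then have "0 \<le> (\<integral>x. f x \<partial>M)"
      using integral_positive_max_nonneg[OF T pres f] by (intro LIMSEQ_le_const) auto
    with neg show ?thesis by simp
  qed
qed

text \<open>The lower half of the ergodic theorem, from the boundedness lemma applied to
  \<open>c - f\<close>. Both the counting of blocks and the averaging of likelihood terms rest on
  it.\<close>

lemma (in prob_space) birkhoff_sums_linear_growth:
  fixes f :: "'a \<Rightarrow> real"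
  assumes "T \<in> measurable M M" "distr M M T = M"
    and "\<And>A. A \<in> sets M \<Longrightarrow> T -` A \<inter> space M = A \<Longrightarrow> prob A = 0 \<or> prob A = 1"
    and f: "integrable M f" and c: "c < (\<integral>x. f x \<partial>M)"
  shows "AE x in M. \<exists>C. \<forall>n. real n * c - C \<le> (\<Sum>i<n. f ((T ^^ i) x))"
proof -
  have "AE x in M. \<exists>C. \<forall>n. (\<Sum>i<n. c - f ((T ^^ i) x)) \<le> C"
    using birkhoff_sums_bounded_above[OF assms(1-3), of "\<lambda>x. c - f x"] f c by (simp add: prob_space)
  then show ?thesis
  proof (rule AE_mp, intro AE_I2 impI)
    fix x assume "\<exists>C. \<forall>n. (\<Sum>i<n. c - f ((T ^^ i) x)) \<le> C"
    then obtain C where "\<And>n. (\<Sum>i<n. c - f ((T ^^ i) x)) \<le> C" by blast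
    then have "\<forall>n. real n * c - C \<le> (\<Sum>i<n. f ((T ^^ i) x))"
      by (simp add: sum_subtractf algebra_simps)
    then show "\<exists>C. \<forall>n. real n * c - C \<le> (\<Sum>i<n. f ((T ^^ i) x))" by blast
  qed
qed

section \<open>The shift on two-sided i.i.d. sequences\<close>

definition tshift :: "int \<Rightarrow> (int \<Rightarrow> 'b) \<Rightarrow> int \<Rightarrow> 'b" where
  "tshift k z = (\<lambda>t. z (t + k))"

lemma tshift_apply [simp]: "tshift k z t = z (t + k)"
  by (simp add: tshift_def)

lemma tshift_tshift [simp]: "tshift k (tshift l z) = tshift (k + l) z"
  by (simp add: tshift_def add.assoc)

lemma tshift_0 [simp]: "tshift 0 z = z"
  by (simp add: tshift_def)

lemma funpow_tshift: "(tshift k ^^ n) z = tshift (int n * k) z"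
  by (induction n) (simp_all add: algebra_simps)

text \<open>A pointwise substitute for measurability with respect to the coordinates in I. It is
  easy to check for recursions and limits, and together with measurability on the whole space it
  yields independence.\<close>

definition depends_on :: "((int \<Rightarrow> 'b) \<Rightarrow> 'c) \<Rightarrow> int set \<Rightarrow> bool" where
  "depends_on f I \<longleftrightarrow> (\<forall>z z'. (\<forall>i\<in>I. z i = z' i) \<longrightarrow> f z = f z')"

locale iid_sequences = D: prob_space D for D :: "real measure" +
  assumes sets_D [measurable_cong]: "sets D = sets borel"
begin

definition P :: "(int \<Rightarrow> real) measure" where
  "P = PiM UNIV (\<lambda>_. D)"

sublocale PP: product_prob_space "\<lambda>_::int. D" UNIV ..

sublocale P: prob_space P
  unfolding P_def by (rule PP.P.prob_space_axioms)

lemma sets_P [measurable_cong]: "sets P = sets (PiM UNIV (\<lambda>_::int. borel))"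
  unfolding P_def by (intro sets_PiM_cong) (auto simp: sets_D)

lemma space_D [simp]: "space D = UNIV"
  using sets_eq_imp_space_eq[OF sets_D] by simp

lemma space_P [simp]: "space P = UNIV"
  unfolding P_def by (auto simp: space_PiM)

lemma measurable_coord [measurable]: "(\<lambda>z. z t) \<in> borel_measurable P"
  by measurable

lemma measurable_tshift [measurable]: "tshift k \<in> measurable P P"
proof -
  have "(\<lambda>z t. z (t + k)) \<in> measurable P (PiM UNIV (\<lambda>_::int. borel))"
    by (rule measurable_PiM_single') auto
  then show ?thesis
    unfolding measurable_cong_sets[OF refl sets_P] tshift_def .
qed

lemma measurable_tshift_nested [measurable (raw)]:
  "f \<in> measurable N P \<Longrightarrow> (\<lambda>x. tshift k (f x)) \<in> measurable N P"
  using measurable_compose[OF _ measurable_tshift] by blast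

lemma distr_coord: "distr P borel (\<lambda>z. z t) = D"
proof -
  have "distr P D (\<lambda>z. z t) = D" unfolding P_def using PP.PiM_component[of t] by simp
  moreover have "distr P borel (\<lambda>z. z t) = distr P D (\<lambda>z. z t)"
    by (rule distr_cong) (auto simp: sets_D)
  ultimately show ?thesis by simp
qed

lemma distr_tshift: "distr P P (tshift k) = P"
proof -
  have "distr (PiM UNIV (\<lambda>_::int. D)) (PiM UNIV (\<lambda>_. D)) (\<lambda>\<omega>. \<lambda>n\<in>UNIV. \<omega> (n + k)) = PiM UNIV (\<lambda>_. D)"
    by (rule distr_PiM_reindex) (auto simp: D.prob_space_axioms inj_def)
  then show ?thesis unfolding P_def tshift_def by (simp only: restrict_UNIV)
qed

lemma AE_tshift:
  assumes "AE z in P. Q z" shows "AE z in P. Q (tshift k z)"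
  by (rule AE_distrD[OF measurable_tshift]) (simp only: distr_tshift assms)

lemma nn_integral_tshift:
  "f \<in> borel_measurable P \<Longrightarrow> (\<integral>\<^sup>+z. f (tshift k z) \<partial>P) = (\<integral>\<^sup>+z. f z \<partial>P)"
  using nn_integral_distr[OF measurable_tshift[of k], of f] by (simp add: distr_tshift)

lemma prob_tshift:
  assumes [measurable]: "Measurable.pred P Q"
  shows "P.prob {z. Q (tshift k z)} = P.prob {z. Q z}"
proof -
  have "{z \<in> space P. Q z} \<in> sets P" by measurable
  then have [measurable]: "{z. Q z} \<in> sets P" by simp
  have "P.prob {z. Q z} = measure (distr P P (tshift k)) {z. Q z}" by (simp add: distr_tshift)
  also have "\<dots> = P.prob {z. Q (tshift k z)}"
    by (subst measure_distr) (auto simp: vimage_def)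
  finally show ?thesis by simp
qed

lemma indep_coords: "P.indep_vars (\<lambda>_. borel) (\<lambda>i z. z i) UNIV"
proof -
  have "distr P (PiM UNIV (\<lambda>_::int. borel)) (\<lambda>x. \<lambda>i\<in>UNIV. x i) = distr P P (\<lambda>x. x)"
    by (rule distr_cong) (auto simp: sets_P)
  then have "distr P (PiM UNIV (\<lambda>_::int. borel)) (\<lambda>x. \<lambda>i\<in>UNIV. x i) = PiM UNIV (\<lambda>i. distr P borel (\<lambda>z. z i))"
    by (simp add: distr_coord flip: P_def)
  then show ?thesis by (subst P.indep_vars_iff_distr_eq_PiM) auto
qed

lemma indep_depends_on:
  assumes [measurable]: "f \<in> measurable P N1" "g \<in> measurable P N2"
    and f: "depends_on f I" and g: "depends_on g J" and IJ: "I \<inter> J = {}"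
  shows "P.indep_var N1 f N2 g"
proof -
  \<comment> \<open>Refills the coordinates outside A with zeros. A function that ignores these
    coordinates does not change under restriction and refilling, so the independence of restricted
    families carries over to it.\<close>
  define e where "e A w i = (if i \<in> A then w i else 0 :: real)" for A :: "int set" and w :: "int \<Rightarrow> real" and i
  have e: "e A \<in> measurable (PiM A (\<lambda>_. borel)) P" for A
  proof -
    have "e A \<in> measurable (PiM A (\<lambda>_. borel)) (PiM UNIV (\<lambda>_. borel))"
    proof (rule measurable_PiM_single')
      show "(\<lambda>w. e A w i) \<in> borel_measurable (PiM A (\<lambda>_. borel))" for i
        by (cases "i \<in> A") (auto simp: e_def)
    qed auto
    then show ?thesis unfolding measurable_cong_sets[OF refl sets_P] .
  qed
  have "P.indep_var N1 ((f \<circ> e I) \<circ> (\<lambda>z. restrict (\<lambda>i. z i) I)) N2 ((g \<circ> e J) \<circ> (\<lambda>z. restrict (\<lambda>i. z i) J))"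
    by (rule P.indep_var_compose[OF P.indep_var_restrict[OF indep_coords IJ]])
       (auto intro!: measurable_comp[OF e])
  moreover have "(f \<circ> e I) \<circ> (\<lambda>z. restrict (\<lambda>i. z i) I) = f"
    using f by (auto simp: depends_on_def e_def fun_eq_iff)
  moreover have "(g \<circ> e J) \<circ> (\<lambda>z. restrict (\<lambda>i. z i) J) = g"
    using g by (auto simp: depends_on_def e_def fun_eq_iff)
  ultimately show ?thesis by simp
qed

lemma nn_integral_mult_indep:
  fixes f g :: "(int \<Rightarrow> real) \<Rightarrow> ennreal"
  assumes [measurable]: "f \<in> borel_measurable P" "g \<in> borel_measurable P"
    and "depends_on f I" "depends_on g J" "I \<inter> J = {}"
  shows "(\<integral>\<^sup>+z. f z * g z \<partial>P) = (\<integral>\<^sup>+z. f z \<partial>P) * (\<integral>\<^sup>+z. g z \<partial>P)"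
proof -
  interpret F: prob_space "distr P borel f" by (rule P.prob_space_distr) simp
  interpret G: prob_space "distr P borel g" by (rule P.prob_space_distr) simp
  have d: "distr P borel f \<Otimes>\<^sub>M distr P borel g = distr P (borel \<Otimes>\<^sub>M borel) (\<lambda>z. (f z, g z))"
    using indep_depends_on[OF assms] unfolding P.indep_var_distribution_eq by simp
  have "(\<integral>\<^sup>+z. f z * g z \<partial>P) = (\<integral>\<^sup>+p. fst p * snd p \<partial>distr P (borel \<Otimes>\<^sub>M borel) (\<lambda>z. (f z, g z)))"
    by (subst nn_integral_distr) auto
  also have "\<dots> = (\<integral>\<^sup>+x. \<integral>\<^sup>+y. x * y \<partial>distr P borel g \<partial>distr P borel f)"
    unfolding d[symmetric] by (subst G.nn_integral_fst[symmetric]) auto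
  also have "\<dots> = (\<integral>\<^sup>+x. x * (\<integral>\<^sup>+y. y \<partial>distr P borel g) \<partial>distr P borel f)"
    by (intro nn_integral_cong nn_integral_cmult) auto
  also have "\<dots> = (\<integral>\<^sup>+x. x \<partial>distr P borel f) * (\<integral>\<^sup>+y. y \<partial>distr P borel g)"
    by (rule nn_integral_multc) auto
  finally show ?thesis by (simp add: nn_integral_distr)
qed

lemma prob_Int_indep:
  assumes A: "{z. A z} \<in> sets P" and B: "{z. B z} \<in> sets P"
    and "depends_on A I" "depends_on B J" "I \<inter> J = {}"
  shows "P.prob {z. A z \<and> B z} = P.prob {z. A z} * P.prob {z. B z}"
proof -
  have [measurable]: "Measurable.pred P A" "Measurable.pred P B" using A B by (simp_all add: pred_def)
  have "(\<integral>\<^sup>+z. indicator {z. A z} z * indicator {z. B z} z \<partial>P) =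
     (\<integral>\<^sup>+z. indicator {z. A z} z \<partial>P) * (\<integral>\<^sup>+z. indicator {z. B z} z \<partial>P)"
    by (rule nn_integral_mult_indep[of _ _ I J])
       (use A B assms(3-5) in \<open>auto simp: depends_on_def indicator_def\<close>)
  also have "(\<lambda>z. indicator {z. A z} z * indicator {z. B z} z :: ennreal) = indicator {z. A z \<and> B z}"
    by (auto simp: fun_eq_iff indicator_def)
  finally have "emeasure P {z. A z \<and> B z} = emeasure P {z. A z} * emeasure P {z. B z}"
    using A B by (simp add: sets.Int[OF A B, simplified Collect_conj_eq[symmetric]])
  then show ?thesis by (simp add: P.emeasure_eq_measure flip: ennreal_mult)
qed

lemma cylinder_depends_on:
  assumes "A \<in> prod_algebra UNIV (\<lambda>_::int. D)"
  obtains m :: int where "depends_on (\<lambda>z. z \<in> A) {-m..m}" "m \<ge> 0"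
proof -
  obtain J E where A: "A = prod_emb UNIV (\<lambda>_. D) J (Pi\<^sub>E J E)" and J: "finite J"
    using assms by (rule prod_algebraE)
  define m where "m = (\<Sum>j\<in>J. \<bar>j\<bar>)"
  have "J \<subseteq> {-m..m}"
  proof
    fix j assume "j \<in> J"
    then have "\<bar>j\<bar> \<le> m" unfolding m_def using J by (intro member_le_sum) auto
    then show "j \<in> {-m..m}" by auto
  qed
  then have "depends_on (\<lambda>z. z \<in> A) {-m..m}"
    unfolding depends_on_def A by (auto simp: prod_emb_def PiE_iff subset_iff)
  then show ?thesis using that[of m] by (simp add: m_def sum_nonneg)
qed

text \<open>Mixing of a pair of events along the multiples of k. General k is needed because
  averages are later taken over blocks; mixing passes to powers of a map, ergodicity alone does
  not.\<close>

definition mixes :: "int \<Rightarrow> (int \<Rightarrow> real) set \<Rightarrow> (int \<Rightarrow> real) set \<Rightarrow> bool" where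
  "mixes k A B \<longleftrightarrow> (\<lambda>n. P.prob (A \<inter> tshift (int n * k) -` B)) \<longlonglongrightarrow> P.prob A * P.prob B"

lemma tshift_vimage_sets [measurable]: "B \<in> sets P \<Longrightarrow> tshift k -` B \<in> sets P"
  using measurable_sets[OF measurable_tshift[of k], of B] by simp

lemma prob_tshift_vimage: "B \<in> sets P \<Longrightarrow> P.prob (tshift k -` B) = P.prob B"
  using prob_tshift[of "\<lambda>z. z \<in> B" k] by (simp add: vimage_def)

text \<open>Two finite windows of coordinates become disjoint after enough shifts, so the product
  formula is exact from some n on.\<close>

lemma mixes_cylinders:
  assumes A: "A \<in> prod_algebra UNIV (\<lambda>_::int. D)" and B: "B \<in> prod_algebra UNIV (\<lambda>_::int. D)" and k: "k \<ge> 1"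
  shows "mixes k A B"
proof -
  have AB: "A \<in> sets P" "B \<in> sets P" using A B unfolding P_def sets_PiM by auto
  obtain a where a: "depends_on (\<lambda>z. z \<in> A) {-a..a}" "a \<ge> 0" using cylinder_depends_on[OF A] by blast
  obtain b where b: "depends_on (\<lambda>z. z \<in> B) {-b..b}" "b \<ge> 0" using cylinder_depends_on[OF B] by blast
  have "P.prob (A \<inter> tshift (int n * k) -` B) = P.prob A * P.prob B" if n: "n > nat (a + b)" for n
  proof -
    have nk: "int n * k > a + b" using n k a b
      by (smt (verit) mult_le_cancel_left1 nat_less_iff of_nat_0_le_iff)
    have "depends_on (\<lambda>z. tshift (int n * k) z \<in> B) {int n * k - b..int n * k + b}"
      unfolding depends_on_def
    proof (intro allI impI)
      fix z z' :: "int \<Rightarrow> real" assume "\<forall>i\<in>{int n * k - b..int n * k + b}. z i = z' i"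
      then have "\<forall>i\<in>{-b..b}. tshift (int n * k) z i = tshift (int n * k) z' i" by auto
      then show "(tshift (int n * k) z \<in> B) = (tshift (int n * k) z' \<in> B)" using b unfolding depends_on_def by blast
    qed
    then have "P.prob {z. z \<in> A \<and> tshift (int n * k) z \<in> B} = P.prob {z. z \<in> A} * P.prob {z. tshift (int n * k) z \<in> B}"
      using a nk AB tshift_vimage_sets[OF AB(2), of "int n * k"]
      by (intro prob_Int_indep) (auto simp: vimage_def)
    then show ?thesis using prob_tshift_vimage[OF AB(2), of "int n * k"] by (simp add: vimage_def Int_def)
  qed
  then have "eventually (\<lambda>n. P.prob A * P.prob B = P.prob (A \<inter> tshift (int n * k) -` B)) sequentially"
    unfolding eventually_at_top_dense by (metis)
  then show ?thesis unfolding mixes_def by (rule Lim_transform_eventually[OF tendsto_const])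
qed

text \<open>Closes mixing under countable disjoint unions. The terms are dominated by the summable
  probabilities of the pieces uniformly in n, so limit and series may be exchanged. The set function
  g is abstract because the union occurs in either argument of \<open>mixes\<close>.\<close>

lemma prob_disjoint_union_tendsto:
  fixes g :: "nat \<Rightarrow> (int \<Rightarrow> real) set \<Rightarrow> real" and A :: "nat \<Rightarrow> (int \<Rightarrow> real) set"
  assumes A: "\<And>i. A i \<in> sets P" "disjoint_family A"
    and lim: "\<And>i. (\<lambda>n. g n (A i)) \<longlonglongrightarrow> P.prob (A i) * p"
    and bd: "\<And>i n. \<bar>g n (A i)\<bar> \<le> P.prob (A i)" and sums: "\<And>n. (\<lambda>i. g n (A i)) sums g n (\<Union>i. A i)"
  shows "(\<lambda>n. g n (\<Union>i. A i)) \<longlonglongrightarrow> P.prob (\<Union>i. A i) * p"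
proof -
  have s: "(\<lambda>i. P.prob (A i)) sums P.prob (\<Union>i. A i)"
    using A by (intro P.finite_measure_UNION) auto
  have "(\<lambda>n. \<Sum>i. g n (A i)) \<longlonglongrightarrow> (\<Sum>i. P.prob (A i) * p)"
    using tannerys_theorem[of "\<lambda>i n. g n (A i)" "\<lambda>i. P.prob (A i) * p" sequentially "\<lambda>i. P.prob (A i)"]
      lim sums_summable[OF s] always_eventually[of "\<lambda>(k, n). norm (g n (A k)) \<le> P.prob (A k)"] bd
    by (simp only: case_prod_beta real_norm_def sequentially_bot) simp
  moreover have "(\<Sum>i. P.prob (A i) * p) = P.prob (\<Union>i. A i) * p"
    using sums_mult2[OF s, of p] by (simp add: sums_iff)
  ultimately show ?thesis using sums by (simp add: sums_iff)
qed

text \<open>Dynkin's argument in one variable at a time: first A becomes arbitrary while B is still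
  a cylinder, then B.\<close>

lemma mixes_all:
  assumes A: "A \<in> sets P" and B: "B \<in> sets P" and k: "k \<ge> 1"
  shows "mixes k A B"
proof -
  let ?G = "prod_algebra UNIV (\<lambda>_::int. D)"
  have gen: "sets P = sigma_sets UNIV ?G" unfolding P_def sets_PiM by (simp add: space_PiM)
  have G: "B \<in> sets P" if "B \<in> ?G" for B using that gen by auto
  have sub: "?G \<subseteq> Pow UNIV" by auto
  have one: "mixes k A B" if B: "B \<in> ?G" and A: "A \<in> sets P" for A B
  proof -
    have [measurable]: "B \<in> sets P" using G[OF B] .
    from A[unfolded gen] show ?thesis
    proof (induction rule: sigma_sets_induct_disjoint[OF Int_stable_prod_algebra sub, consumes 1, case_names basic empty compl union])
      case (basic A) then show ?case using mixes_cylinders B k by blast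
    next
      case empty show ?case by (simp add: mixes_def)
    next
      case (compl A)
      have A: "A \<in> sets P" using compl gen by simp
      have "P.prob ((UNIV - A) \<inter> tshift (int n * k) -` B) = P.prob B - P.prob (A \<inter> tshift (int n * k) -` B)" for n
      proof -
        have "(UNIV - A) \<inter> tshift (int n * k) -` B = tshift (int n * k) -` B - A \<inter> tshift (int n * k) -` B" by auto
        then show ?thesis using A prob_tshift_vimage[of B "int n * k"]
          by (simp add: P.finite_measure_Diff)
      qed
      moreover have "P.prob (UNIV - A) * P.prob B = P.prob B - P.prob A * P.prob B"
        using P.prob_compl[OF A] by (simp only: space_P left_diff_distrib right_diff_distrib mult_1 mult_1_right)
      ultimately show ?case using tendsto_diff[OF tendsto_const compl(2)[unfolded mixes_def], of "P.prob B"]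
        by (simp only: mixes_def)
    next
      case (union F)
      have F: "F i \<in> sets P" for i using union gen by auto
      show ?case unfolding mixes_def
      proof (rule prob_disjoint_union_tendsto[where g="\<lambda>n C. P.prob (C \<inter> tshift (int n * k) -` B)"])
        show "(\<lambda>i. P.prob (F i \<inter> tshift (int n * k) -` B)) sums P.prob ((\<Union>i. F i) \<inter> tshift (int n * k) -` B)" for n
          unfolding Int_UN_distrib2[symmetric] using F union(1)
          by (subst UN_extend_simps(4), intro P.finite_measure_UNION) (auto simp: disjoint_family_on_def)
        show "\<bar>P.prob (F i \<inter> tshift (int n * k) -` B)\<bar> \<le> P.prob (F i)" for i n
          using F by (auto intro!: P.finite_measure_mono)
      qed (use union F in \<open>auto simp: mixes_def\<close>)
    qed
  qed
  from B[unfolded gen] show ?thesis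
  proof (induction rule: sigma_sets_induct_disjoint[OF Int_stable_prod_algebra sub, consumes 1, case_names basic empty compl union])
    case (basic B) then show ?case using one A by blast
  next
    case empty show ?case by (simp add: mixes_def)
  next
    case (compl B)
    have B: "B \<in> sets P" using compl gen by simp
    have "P.prob (A \<inter> tshift (int n * k) -` (UNIV - B)) = P.prob A - P.prob (A \<inter> tshift (int n * k) -` B)" for n
    proof -
      have "A \<inter> tshift (int n * k) -` (UNIV - B) = A - A \<inter> tshift (int n * k) -` B" by auto
      then show ?thesis using A B by (simp add: P.finite_measure_Diff)
    qed
    moreover have "P.prob A * P.prob (UNIV - B) = P.prob A - P.prob A * P.prob B"
      using P.prob_compl[OF B] by (simp only: space_P left_diff_distrib right_diff_distrib mult_1 mult_1_right)
    ultimately show ?case using tendsto_diff[OF tendsto_const compl(2)[unfolded mixes_def], of "P.prob A"]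
      by (simp only: mixes_def)
  next
    case (union F)
    have F[measurable]: "F i \<in> sets P" for i using union gen by auto
    have "(\<lambda>n. P.prob (A \<inter> tshift (int n * k) -` (\<Union>i. F i))) \<longlonglongrightarrow> P.prob (\<Union>i. F i) * P.prob A"
    proof (rule prob_disjoint_union_tendsto[where g="\<lambda>n C. P.prob (A \<inter> tshift (int n * k) -` C)"])
      show "(\<lambda>i. P.prob (A \<inter> tshift (int n * k) -` F i)) sums P.prob (A \<inter> tshift (int n * k) -` (\<Union>i. F i))" for n
        using A union(1) unfolding vimage_UN Int_UN_distrib
        by (intro P.finite_measure_UNION) (auto simp: disjoint_family_on_def)
      show "\<bar>P.prob (A \<inter> tshift (int n * k) -` F i)\<bar> \<le> P.prob (F i)" for i n
        using A prob_tshift_vimage[OF F, of "int n * k" i] P.finite_measure_mono[of "A \<inter> tshift (int n * k) -` F i" "tshift (int n * k) -` F i"] by auto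
    qed (use union F in \<open>auto simp: mixes_def mult.commute\<close>)
    then show ?case by (simp add: mixes_def mult.commute)
  qed
qed

text \<open>Mixing an invariant event with itself makes its probability equal to its own
  square.\<close>

lemma tshift_ergodic:
  assumes "k \<ge> 1" "A \<in> sets P" "tshift k -` A \<inter> space P = A"
  shows "P.prob A = 0 \<or> P.prob A = 1"
proof -
  have "tshift (int n * k) -` A = A" for n
  proof (induction n)
    case (Suc n)
    have "tshift (int (Suc n) * k) -` A = tshift (int n * k) -` (tshift k -` A)"
      by (auto simp: vimage_def algebra_simps simp del: tshift_apply)
    also have "\<dots> = A" using Suc assms by (simp only: space_P Int_UNIV_right)
    finally show ?case .
  next
    case 0 show ?case by (simp add: vimage_def del: tshift_apply)
  qed
  then have "(\<lambda>n. P.prob A) \<longlonglongrightarrow> P.prob A * P.prob A"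
    using mixes_all[of A A k] assms unfolding mixes_def by simp
  then have "P.prob A = P.prob A * P.prob A" by (simp add: LIMSEQ_const_iff)
  then show ?thesis by simp
qed

lemma tshift_sums_linear_growth:
  assumes "k \<ge> 1" "integrable P f" "c < (\<integral>z. f z \<partial>P)"
  shows "AE z in P. \<exists>C. \<forall>n. real n * c - C \<le> (\<Sum>i<n. f (tshift (int i * k) z))"
  using P.birkhoff_sums_linear_growth[OF measurable_tshift distr_tshift tshift_ergodic[OF assms(1)] assms(2,3)]
  by (simp add: funpow_tshift)

end

section \<open>Linear recursions with varying coefficients\<close>

text \<open>The coefficient is read at the time \<open>k - j\<close> of the value that it
  multiplies, since in the volatility recursion the news and the volatility of one past time enter
  as a product. Values before time 0 count as zero; their effect can be put into the source
  w.\<close>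

function lin_rec :: "nat \<Rightarrow> (nat \<Rightarrow> int \<Rightarrow> real) \<Rightarrow> (nat \<Rightarrow> real) \<Rightarrow> nat \<Rightarrow> real" where
  "lin_rec d C w k = w k + (\<Sum>j=1..d. if j \<le> k then C j (int k - int j) * lin_rec d C w (k - j) else 0)"
  by pat_completeness auto
termination
  by (relation "Wellfounded.measure (\<lambda>(d, C, w, k). k)") auto

declare lin_rec.simps [simp del]

lemma lin_rec_unique:
  assumes "\<And>k. x k = w k + (\<Sum>j=1..d. if j \<le> k then C j (int k - int j) * x (k - j) else 0)"
  shows "x k = lin_rec d C w k"
proof (induction k rule: less_induct)
  case (less k)
  show ?case
    by (subst assms, subst lin_rec.simps) (intro arg_cong2[of _ _ _ _ "(+)"] sum.cong refl, use less in auto)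
qed

lemma lin_rec_nonneg:
  assumes "\<And>j t. j \<in> {1..d} \<Longrightarrow> 0 \<le> C j t" "\<And>k. 0 \<le> w k"
  shows "0 \<le> lin_rec d C w k"
proof (induction k rule: less_induct)
  case (less k)
  show ?case
    by (subst lin_rec.simps) (intro add_nonneg_nonneg sum_nonneg, use assms less in auto)
qed

lemma lin_rec_add:
  "lin_rec d C (\<lambda>k. w k + w' k) k = lin_rec d C w k + lin_rec d C w' k"
proof (rule lin_rec_unique[symmetric])
  fix k
  have "(\<Sum>j=1..d. if j \<le> k then C j (int k - int j) * (lin_rec d C w (k - j) + lin_rec d C w' (k - j)) else 0)
    = (\<Sum>j=1..d. if j \<le> k then C j (int k - int j) * lin_rec d C w (k - j) else 0)
    + (\<Sum>j=1..d. if j \<le> k then C j (int k - int j) * lin_rec d C w' (k - j) else 0)"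
    unfolding sum.distrib[symmetric] by (intro sum.cong refl) (simp add: distrib_left)
  then show "lin_rec d C w k + lin_rec d C w' k = w k + w' k +
    (\<Sum>j=1..d. if j \<le> k then C j (int k - int j) * (lin_rec d C w (k - j) + lin_rec d C w' (k - j)) else 0)"
    by (simp add: lin_rec.simps[of d C w k] lin_rec.simps[of d C w' k])
qed

lemma lin_rec_scale:
  "lin_rec d C (\<lambda>k. c * w k) k = c * lin_rec d C w k"
  by (rule lin_rec_unique[symmetric], subst lin_rec.simps)
     (simp add: algebra_simps sum_distrib_left, auto intro!: sum.cong)

lemma lin_rec_mono:
  assumes C: "\<And>j t. j \<in> {1..d} \<Longrightarrow> 0 \<le> C j t" and w: "\<And>k. w k \<le> w' k"
  shows "lin_rec d C w k \<le> lin_rec d C w' k"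
proof -
  have "lin_rec d C w' k = lin_rec d C w k + lin_rec d C (\<lambda>k. w' k - w k) k"
    by (subst lin_rec_add[symmetric]) simp
  moreover have "0 \<le> lin_rec d C (\<lambda>k. w' k - w k) k" using C w by (intro lin_rec_nonneg) auto
  ultimately show ?thesis by simp
qed

text \<open>All claims about which innovations an iterate depends on come from here. Time k itself
  is excluded, so an iterate will be independent of the innovation of its own time.\<close>

lemma lin_rec_cong:
  assumes "\<And>j t. j \<in> {1..d} \<Longrightarrow> 0 \<le> t \<Longrightarrow> t < int k \<Longrightarrow> C j t = C' j t"
  shows "lin_rec d C w k = lin_rec d C' w k"
  using assms
proof (induction k rule: less_induct)
  case (less k)
  have "lin_rec d C w (k - j) = lin_rec d C' w (k - j)" if "j \<in> {1..d}" "j \<le> k" for j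
    using that by (intro less) auto
  then show ?case
    by (subst lin_rec.simps, subst (2) lin_rec.simps)
       (intro arg_cong2[of _ _ _ _ "(+)"] sum.cong refl, use less.prems in auto)
qed

text \<open>Restarting the recursion at time \<open>s\<close> turns the contribution of the past into a source term.\<close>
lemma lin_rec_restart:
  assumes "\<And>k. u (s + int k) = a + (\<Sum>j=1..d. C j (s + int k - int j) * u (s + int k - int j))"
  shows "u (s + int k) = lin_rec d (\<lambda>j t. C j (s + t)) (\<lambda>_. a) k
    + lin_rec d (\<lambda>j t. C j (s + t)) (\<lambda>k. \<Sum>j=1..d. if j \<le> k then 0 else C j (s + int k - int j) * u (s + int k - int j)) k"
proof -
  have "u (s + int k) = lin_rec d (\<lambda>j t. C j (s + t))
      (\<lambda>k. a + (\<Sum>j=1..d. if j \<le> k then 0 else C j (s + int k - int j) * u (s + int k - int j))) k"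
  proof (rule lin_rec_unique)
    fix k
    have "(\<Sum>j=1..d. C j (s + int k - int j) * u (s + int k - int j)) =
      (\<Sum>j=1..d. if j \<le> k then 0 else C j (s + int k - int j) * u (s + int k - int j))
      + (\<Sum>j=1..d. if j \<le> k then C j (s + (int k - int j)) * u (s + int (k - j)) else 0)"
      unfolding sum.distrib[symmetric] by (intro sum.cong refl) (auto simp: of_nat_diff algebra_simps)
    then show "u (s + int k) = a + (\<Sum>j=1..d. if j \<le> k then 0 else C j (s + int k - int j) * u (s + int k - int j))
      + (\<Sum>j=1..d. if j \<le> k then C j (s + (int k - int j)) * u (s + int (k - j)) else 0)"
      using assms[of k] by simp
  qed
  then show ?thesis by (simp add: lin_rec_add)
qed

text \<open>A homogeneous solution loses the fraction \<open>a / K\<close> relative to the inhomogeneous solution \<open>u\<close> on every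
  block of length \<open>d\<close> on which \<open>u\<close> is bounded by \<open>K\<close>.\<close>
lemma homogeneous_contraction:
  fixes R u :: "nat \<Rightarrow> real"
  assumes d: "d \<ge> 1" and a: "0 < a" "a \<le> K" and C: "\<And>j t. j \<in> {1..d} \<Longrightarrow> 0 \<le> C j t"
    and u: "\<And>k. d \<le> k \<Longrightarrow> u k = a + (\<Sum>j=1..d. C j k * u (k - j))"
    and R: "\<And>k. d \<le> k \<Longrightarrow> R k = (\<Sum>j=1..d. C j k * R (k - j))"
    and Ru: "\<And>k. k < d \<Longrightarrow> R k \<le> u k" and u0: "\<And>k. 0 \<le> u k"
  shows "i < d \<Longrightarrow> R (n * d + i) \<le> (\<Prod>m=1..n. if \<forall>i<d. u (m * d + i) \<le> K then 1 - a / K else 1) * u (n * d + i)"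
proof (induction n arbitrary: i)
  case 0 then show ?case using Ru by simp
next
  case (Suc n)
  define f where "f = (\<lambda>m. if \<forall>i<d. u (m * d + i) \<le> K then 1 - a / K else 1)"
  define Q where "Q n = (\<Prod>m=1..n. f m)" for n
  have f: "0 \<le> f m" "f m \<le> 1" for m using a unfolding f_def by (auto simp: divide_le_eq_1)
  have Q0: "0 \<le> Q n" for n unfolding Q_def using f by (intro prod_nonneg) auto
  have QS: "Q (Suc n) = Q n * f (Suc n)" by (simp add: Q_def)
  have Qle: "Q (Suc n) \<le> Q n" unfolding QS using f[of "Suc n"] Q0[of n] by (simp add: mult_left_le)
  have prev: "R (n * d + i) \<le> Q n * u (n * d + i)" if "i < d" for i
    using Suc.IH[OF that] unfolding Q_def f_def .
  have "R (Suc n * d + i) \<le> Q (Suc n) * u (Suc n * d + i)" using \<open>i < d\<close>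
  proof (induction i rule: less_induct)
    case (less i)
    let ?k = "Suc n * d + i"
    \<comment> \<open>A lag of at most d reaches back into the current block, where the inner
      induction already gives the smaller factor, or into the preceding one.\<close>
    have *: "R (?k - j) \<le> Q n * u (?k - j)" if j: "j \<in> {1..d}" for j
    proof (cases "j \<le> i")
      case True
      then have k: "?k - j = Suc n * d + (i - j)" by simp
      have "R (?k - j) \<le> Q (Suc n) * u (?k - j)" unfolding k using True j less by (intro less) auto
      also have "\<dots> \<le> Q n * u (?k - j)" using Qle u0 by (intro mult_right_mono) auto
      finally show ?thesis .
    next
      case False
      then have k: "?k - j = n * d + (d + i - j)" using j by auto
      show ?thesis unfolding k using False j by (intro prev) auto
    qed
    have kd: "d \<le> ?k" by simp
    have "R ?k = (\<Sum>j=1..d. C j ?k * R (?k - j))" by (rule R[OF kd])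
    also have "\<dots> \<le> (\<Sum>j=1..d. C j ?k * (Q n * u (?k - j)))"
      using C * by (intro sum_mono mult_left_mono) auto
    also have "\<dots> = Q n * (u ?k - a)" using u[OF kd] by (simp add: sum_distrib_left algebra_simps)
    also have "\<dots> \<le> Q n * (f (Suc n) * u ?k)"
    proof (intro mult_left_mono Q0)
      \<comment> \<open>The actual loss: on a bounded block the constant a is at least the fraction
        \<open>a / K\<close> of \<open>u ?k\<close>.\<close>
      show "u ?k - a \<le> f (Suc n) * u ?k"
      proof (cases "\<forall>i<d. u (Suc n * d + i) \<le> K")
        case True
        then have "u ?k \<le> K" using less.prems by blast
        then have "a / K * u ?k \<le> a / K * K" using a by (intro mult_left_mono) auto
        then show ?thesis using True a by (simp add: f_def algebra_simps)
      next
        case False then show ?thesis using a by (simp only: f_def if_False)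
      qed
    qed
    finally show ?case by (simp add: QS mult.assoc)
  qed
  then show ?case unfolding Q_def f_def .
qed

section \<open>The volatility as a function of the innovations\<close>

text \<open>Since \<open>X_t = sigma_t Z_t\<close>, the news term of \<open>X_t\<close> is
  \<open>sigma_t^2\<close> times that of \<open>Z_t\<close>. Hence the squared volatility solves a
  linear recursion whose random coefficients involve only the innovations. A and B stand for the
  alpha and beta coefficients, padded by zeros to a common order d.\<close>

locale agarch_rec =
  fixes d :: nat and a0 g :: real and A B :: "nat \<Rightarrow> real"
  assumes d: "d \<ge> 1" and a0: "a0 > 0" and A: "\<And>j. A j \<ge> 0" and B: "\<And>j. B j \<ge> 0" and g: "\<bar>g\<bar> \<le> 1"
begin

definition cf :: "(int \<Rightarrow> real) \<Rightarrow> nat \<Rightarrow> int \<Rightarrow> real" where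
  "cf z j t = A j * (\<bar>z t\<bar> - g * z t)\<^sup>2 + B j"

lemma cf_nonneg: "0 \<le> cf z j t"
  unfolding cf_def using A B by simp

lemma cf_tshift: "cf (tshift s z) j t = cf z j (t + s)"
  by (simp add: cf_def)

lemma cf_tshift': "cf (tshift s z) = (\<lambda>j t. cf z j (s + t))"
  by (simp add: cf_def fun_eq_iff add.commute)

lemma news_le: "(\<bar>x\<bar> - g * x)\<^sup>2 \<le> 4 * x\<^sup>2"
proof -
  have "\<bar>g * x\<bar> \<le> \<bar>x\<bar>" using g by (simp add: abs_mult mult_left_le_one_le)
  then have "\<bar>\<bar>x\<bar> - g * x\<bar> \<le> 2 * \<bar>x\<bar>" by linarith
  then have "\<bar>\<bar>x\<bar> - g * x\<bar>\<^sup>2 \<le> (2 * \<bar>x\<bar>)\<^sup>2" by (intro power_mono) auto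
  then show ?thesis by (simp add: power2_abs power_mult_distrib)
qed

lemma cf_le: "cf z j t \<le> 4 * (A j + B j) * (1 + (z t)\<^sup>2)"
proof -
  have "A j * (\<bar>z t\<bar> - g * z t)\<^sup>2 \<le> A j * (4 * (z t)\<^sup>2)" using A news_le by (intro mult_left_mono) auto
  moreover have "0 \<le> A j" "0 \<le> B j" "0 \<le> B j * (z t)\<^sup>2" using A B by auto
  moreover have "4 * (A j + B j) * (1 + (z t)\<^sup>2) = 4 * A j + 4 * B j + A j * (4 * (z t)\<^sup>2) + 4 * (B j * (z t)\<^sup>2)"
    by (simp add: algebra_simps)
  ultimately show ?thesis unfolding cf_def by linarith
qed

section \<open>Iteration from a zero past\<close>

definition vstart :: "(int \<Rightarrow> real) \<Rightarrow> nat \<Rightarrow> real" where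
  "vstart z = lin_rec d (cf z) (\<lambda>_. a0)"

lemma vstart_ge: "a0 \<le> vstart z k"
proof -
  have "0 \<le> vstart z k" for k unfolding vstart_def using a0 cf_nonneg by (intro lin_rec_nonneg) auto
  then show ?thesis unfolding vstart_def
    by (subst lin_rec.simps) (auto intro!: sum_nonneg mult_nonneg_nonneg simp: cf_nonneg)
qed

lemma vstart_le_solution:
  assumes u: "\<And>k. u (s + int k) = a0 + (\<Sum>j=1..d. cf z j (s + int k - int j) * u (s + int k - int j))"
    and u0: "\<And>t. 0 \<le> u t"
  shows "vstart (tshift s z) k \<le> u (s + int k)"
proof -
  have "0 \<le> lin_rec d (\<lambda>j t. cf z j (s + t)) (\<lambda>k. \<Sum>j=1..d. if j \<le> k then 0 else cf z j (s + int k - int j) * u (s + int k - int j)) k"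
    using cf_nonneg u0 by (intro lin_rec_nonneg sum_nonneg) auto
  then show ?thesis
    using lin_rec_restart[where u=u and s=s and a=a0 and d=d and C="cf z" and k=k, OF u] unfolding vstart_def cf_tshift' by simp
qed

lemma vstart_rec:
  "vstart z k = a0 + (\<Sum>j=1..d. if j \<le> k then cf z j (int k - int j) * vstart z (k - j) else 0)"
  unfolding vstart_def by (rule lin_rec.simps)

text \<open>An earlier start only adds nonnegative terms. So the iterates with receding starting
  time are monotone, and boundedness alone decides their convergence.\<close>

lemma vstart_earlier: "vstart (tshift s z) k \<le> vstart (tshift (s - 1) z) (Suc k)"
proof (induction k rule: less_induct)
  case (less k)
  have "vstart (tshift s z) k \<le> a0 + (\<Sum>j=1..d. if j \<le> Suc k then cf (tshift (s - 1) z) j (int (Suc k) - int j) * vstart (tshift (s - 1) z) (Suc k - j) else 0)"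
    unfolding vstart_rec[of "tshift s z" k]
  proof (intro add_left_mono sum_mono)
    fix j assume j: "j \<in> {1..d}"
    have "cf (tshift s z) j (int k - int j) * vstart (tshift s z) (k - j) \<le>
        cf (tshift (s - 1) z) j (int (Suc k) - int j) * vstart (tshift (s - 1) z) (Suc k - j)" if "j \<le> k"
    proof -
      have "cf (tshift s z) j (int k - int j) = cf (tshift (s - 1) z) j (int (Suc k) - int j)"
        by (simp add: cf_def algebra_simps)
      moreover have "vstart (tshift s z) (k - j) \<le> vstart (tshift (s - 1) z) (Suc k - j)"
        using less[of "k - j"] j that by (simp add: Suc_diff_le del: tshift_apply)
      ultimately show ?thesis using cf_nonneg by (simp add: mult_left_mono)
    qed
    moreover have "0 \<le> cf (tshift (s - 1) z) j (int (Suc k) - int j) * vstart (tshift (s - 1) z) (Suc k - j)"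
      using cf_nonneg a0 vstart_ge[of "tshift (s - 1) z" "Suc k - j"] by (intro mult_nonneg_nonneg) auto
    ultimately show "(if j \<le> k then cf (tshift s z) j (int k - int j) * vstart (tshift s z) (k - j) else 0)
      \<le> (if j \<le> Suc k then cf (tshift (s - 1) z) j (int (Suc k) - int j) * vstart (tshift (s - 1) z) (Suc k - j) else 0)"
      by auto
  qed
  then show ?case unfolding vstart_rec[of "tshift (s - 1) z" "Suc k"] .
qed

definition vstep :: "(int \<Rightarrow> real) \<Rightarrow> int \<Rightarrow> nat \<Rightarrow> real" where
  "vstep z t n = vstart (tshift (t - int n) z) n"

text \<open>As \<open>lim\<close> is total, this is a real number for every z, measurable and
  determined by the past without an exceptional set. It has its intended meaning where
  \<open>stable\<close> holds.\<close>

definition vol2 :: "(int \<Rightarrow> real) \<Rightarrow> int \<Rightarrow> real" where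
  "vol2 z t = lim (vstep z t)"

lemma vstep_tshift: "vstep (tshift s z) t = vstep z (t + s)"
  by (simp add: vstep_def fun_eq_iff algebra_simps)

lemma vol2_tshift: "vol2 (tshift s z) t = vol2 z (t + s)"
  by (simp add: vol2_def vstep_tshift)

lemma incseq_vstep: "incseq (vstep z t)"
proof (rule incseq_SucI)
  fix n show "vstep z t n \<le> vstep z t (Suc n)"
    using vstart_earlier[of "t - int n" z n] by (simp add: vstep_def algebra_simps)
qed

lemma vstep_ge: "a0 \<le> vstep z t n"
  unfolding vstep_def by (rule vstart_ge)

lemma vstep_rec:
  "vstep z t n = a0 + (\<Sum>j=1..d. if j \<le> n then cf z j (t - int j) * vstep z (t - int j) (n - j) else 0)"
  unfolding vstep_def by (subst vstart_rec) (intro arg_cong2[of _ _ _ _ "(+)"] sum.cong refl,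
     auto simp: cf_def of_nat_diff algebra_simps)

lemma depends_vstart: "depends_on (\<lambda>z. vstart z k) {0..<int k}"
  unfolding depends_on_def vstart_def by (intro allI impI lin_rec_cong) (auto simp: cf_def)

lemma depends_vstep: "depends_on (\<lambda>z. vstep z t n) {..<t}"
  unfolding depends_on_def vstep_def
proof (intro allI impI)
  fix z z' :: "int \<Rightarrow> real" assume "\<forall>i\<in>{..<t}. z i = z' i"
  then have "\<forall>i\<in>{0..<int n}. tshift (t - int n) z i = tshift (t - int n) z' i" by auto
  then show "vstart (tshift (t - int n) z) n = vstart (tshift (t - int n) z') n"
    using depends_vstart[of n] unfolding depends_on_def by blast
qed

lemma depends_vol2: "depends_on (\<lambda>z. vol2 z t) {..<t}"
  unfolding depends_on_def vol2_def
proof (intro allI impI)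
  fix z z' :: "int \<Rightarrow> real" assume "\<forall>i\<in>{..<t}. z i = z' i"
  then have "vstep z t = vstep z' t" using depends_vstep[of t] unfolding depends_on_def by blast
  then show "lim (vstep z t) = lim (vstep z' t)" by simp
qed

definition stable :: "(int \<Rightarrow> real) \<Rightarrow> bool" where
  "stable z \<longleftrightarrow> (\<forall>t. convergent (vstep z t))"

lemma vstep_tendsto: "stable z \<Longrightarrow> vstep z t \<longlonglongrightarrow> vol2 z t"
  unfolding stable_def vol2_def convergent_LIMSEQ_iff by blast

lemma vstep_le_vol2: "stable z \<Longrightarrow> vstep z t n \<le> vol2 z t"
  using incseq_le[OF incseq_vstep vstep_tendsto] .

lemma vol2_ge: "stable z \<Longrightarrow> a0 \<le> vol2 z t"
  using vstep_ge vstep_le_vol2 order_trans by blast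

lemma vol2_rec:
  assumes "stable z"
  shows "vol2 z t = a0 + (\<Sum>j=1..d. cf z j (t - int j) * vol2 z (t - int j))"
proof (rule LIMSEQ_unique)
  show "vstep z t \<longlonglongrightarrow> vol2 z t" using vstep_tendsto assms by blast
  show "vstep z t \<longlonglongrightarrow> a0 + (\<Sum>j=1..d. cf z j (t - int j) * vol2 z (t - int j))"
    unfolding vstep_rec[of z t, abs_def]
  proof (intro tendsto_intros)
    fix j assume "j \<in> {1..d}"
    have "(\<lambda>n. cf z j (t - int j) * vstep z (t - int j) (n - j)) \<longlonglongrightarrow> cf z j (t - int j) * vol2 z (t - int j)"
      using vstep_tendsto[OF assms, of "t - int j"]
      by (intro tendsto_intros) (rule filterlim_compose[OF _ filterlim_minus_const_nat_at_top])
    moreover have "eventually (\<lambda>n. cf z j (t - int j) * vstep z (t - int j) (n - j) =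
        (if j \<le> n then cf z j (t - int j) * vstep z (t - int j) (n - j) else 0)) sequentially"
      using eventually_ge_at_top[of j] by eventually_elim auto
    ultimately show "(\<lambda>n. if j \<le> n then cf z j (t - int j) * vstep z (t - int j) (n - j) else 0) \<longlonglongrightarrow> cf z j (t - int j) * vol2 z (t - int j)"
      by (rule Lim_transform_eventually)
  qed
qed

text \<open>If some bound holds on infinitely many blocks in the past, the influence of the remote past on a
  solution vanishes.\<close>
lemma solution_eq_vol2:
  assumes u: "\<And>t. u t = a0 + (\<Sum>j=1..d. cf z j (t - int j) * u (t - int j))"
    and u0: "\<And>t. 0 \<le> u t"
    and inf: "infinite {m. \<forall>i<d. u (int i - int m * int d) \<le> K}"
  shows "vstep z 0 \<longlonglongrightarrow> u 0"
proof -
  have ua: "a0 \<le> u t" for t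
    by (subst u) (auto intro!: sum_nonneg mult_nonneg_nonneg simp: cf_nonneg u0)
  \<comment> \<open>A single bounded block forces \<open>a0 <= K\<close>, which places the
    contraction factor in [0, 1).\<close>
  obtain m where "\<forall>i<d. u (int i - int m * int d) \<le> K" using inf by (metis (mono_tags, lifting) Collect_empty_eq finite.emptyI)
  then have K: "a0 \<le> K" using ua[of "int 0 - int m * int d"] d by (metis less_le_trans order_trans zero_less_one)
  define \<rho> where "\<rho> = 1 - a0 / K"
  have \<rho>: "0 \<le> \<rho>" "\<rho> < 1" using K a0 by (auto simp: \<rho>_def divide_le_eq_1)
  define good where "good m \<longleftrightarrow> (\<forall>i<d. u (int i - int m * int d) \<le> K)" for m :: nat
  have ub: "vstep z 0 n \<le> u 0" for n
    using vstart_le_solution[where u=u and s="- int n" and z=z and k=n, OF u u0] unfolding vstep_def by simp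
  have main: "u 0 - vstep z 0 (n * d) \<le> (\<Prod>m<n. if good m then \<rho> else 1) * u 0" for n
  proof -
    define s where "s = - int (n * d)"
    define w where "w k = u (s + int k)" for k
    \<comment> \<open>The contribution of the times before s. From time d on its source is empty, so
      it solves the homogeneous recursion.\<close>
    define R where "R k = lin_rec d (\<lambda>j t. cf z j (s + t)) (\<lambda>k. \<Sum>j=1..d. if j \<le> k then 0 else cf z j (s + int k - int j) * u (s + int k - int j)) k" for k
    have split: "w k = vstart (tshift s z) k + R k" for k
      using lin_rec_restart[where u=u and s=s and a=a0 and d=d and C="cf z" and k=k] u unfolding w_def R_def vstart_def cf_tshift' by blast
    have "R (n * d + 0) \<le> (\<Prod>m=1..n. if \<forall>i<d. w (m * d + i) \<le> K then 1 - a0 / K else 1) * w (n * d + 0)"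
    proof (rule homogeneous_contraction[where C="\<lambda>j k. cf z j (s + int k - int j)"])
      show "w k = a0 + (\<Sum>j=1..d. cf z j (s + int k - int j) * w (k - j))" if "d \<le> k" for k
        unfolding w_def using that by (subst u) (auto intro!: sum.cong simp: of_nat_diff algebra_simps)
      show "R k = (\<Sum>j=1..d. cf z j (s + int k - int j) * R (k - j))" if "d \<le> k" for k
        unfolding R_def using that
        by (subst lin_rec.simps) (auto intro!: sum.cong simp: algebra_simps)
      show "R k \<le> w k" if "k < d" for k
        using split[of k] vstart_ge[of "tshift s z" k] a0 by simp
    qed (use d a0 K cf_nonneg u0 in \<open>auto simp: w_def\<close>)
    \<comment> \<open>The contraction numbers blocks forward from s, whereas \<open>good\<close>
      numbers them backward from time 0.\<close>
    also have "(\<Prod>m=1..n. if \<forall>i<d. w (m * d + i) \<le> K then 1 - a0 / K else 1) = (\<Prod>m<n. if good m then \<rho> else 1)"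
    proof (rule prod.reindex_bij_witness[of _ "\<lambda>m. n - m" "\<lambda>m. n - m"])
      fix m assume m: "m \<in> {1..n}"
      have eq: "s + int (m * d + i) = int i - int (n - m) * int d" for i
        using m unfolding s_def by (simp add: of_nat_diff algebra_simps)
      then show "(if good (n - m) then \<rho> else 1) = (if \<forall>i<d. w (m * d + i) \<le> K then 1 - a0 / K else 1)"
        by (simp only: good_def w_def \<rho>_def eq)
    qed auto
    finally show ?thesis using split[of "n * d"] unfolding w_def vstep_def s_def by simp
  qed
  have "(\<lambda>n. \<Prod>m<n. if good m then \<rho> else 1) \<longlonglongrightarrow> 0"
  proof (rule LIMSEQ_I)
    fix e :: real assume "0 < e"
    then obtain N where N: "\<rho> ^ N < e" using \<rho> real_arch_pow_inv by blast
    have "infinite {m. good m}" using inf unfolding good_def .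
    then obtain F where F: "F \<subseteq> {m. good m}" "finite F" "card F = N" using infinite_arbitrarily_large by blast
    define n0 where "n0 = Suc (Max (insert 0 F))"
    have "norm ((\<Prod>m<n. if good m then \<rho> else 1) - 0) < e" if "n \<ge> n0" for n
    proof -
      have FF: "F \<subseteq> {..<n}"
      proof
        fix x assume "x \<in> F"
        then have "x \<le> Max (insert 0 F)" using F by (intro Max_ge) auto
        then show "x \<in> {..<n}" using that unfolding n0_def by simp
      qed
      have "(\<Prod>m<n. if good m then \<rho> else 1) = (\<Prod>m\<in>F. if good m then \<rho> else 1) * (\<Prod>m\<in>{..<n} - F. if good m then \<rho> else 1)"
        using FF by (subst prod.subset_diff[of F]) (auto simp: mult.commute)
      also have "\<dots> \<le> (\<Prod>m\<in>F. if good m then \<rho> else 1) * 1"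
        using \<rho> by (intro mult_left_mono prod_le_1 prod_nonneg) auto
      also have "(\<Prod>m\<in>F. if good m then \<rho> else 1) = \<rho> ^ N" using F by (subst prod.cong[of F F _ "\<lambda>_. \<rho>"]) auto
      finally have "(\<Prod>m<n. if good m then \<rho> else 1) < e" using N by simp
      moreover have "0 \<le> (\<Prod>m<n. if good m then \<rho> else 1)" using \<rho> by (intro prod_nonneg) auto
      ultimately show ?thesis by simp
    qed
    then show "\<exists>no. \<forall>n\<ge>no. norm ((\<Prod>m<n. if good m then \<rho> else 1) - 0) < e" by blast
  qed
  then have "(\<lambda>n. (\<Prod>m<n. if good m then \<rho> else 1) * u 0) \<longlonglongrightarrow> 0 * u 0" by (intro tendsto_intros)
  then have "(\<lambda>n. u 0 - vstep z 0 (n * d)) \<longlonglongrightarrow> 0"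
    using main ub by (intro tendsto_sandwich[OF _ _ tendsto_const, of 0 "\<lambda>n. u 0 - vstep z 0 (n * d)" sequentially "\<lambda>n. (\<Prod>m<n. if good m then \<rho> else 1) * u 0"]) auto
  then have sub: "(\<lambda>n. vstep z 0 (n * d)) \<longlonglongrightarrow> u 0"
    using tendsto_diff[OF tendsto_const, of _ 0 sequentially "u 0"] by force
  have "convergent (vstep z 0)"
    using incseq_convergent[OF incseq_vstep] ub by (metis convergentI)
  then obtain L where L: "vstep z 0 \<longlonglongrightarrow> L" by (auto simp: convergent_def)
  have "strict_mono (\<lambda>n. n * d)" using d by (simp add: strict_mono_def)
  then have "(\<lambda>n. vstep z 0 (n * d)) \<longlonglongrightarrow> L" using LIMSEQ_subseq_LIMSEQ[OF L] by (simp add: o_def)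
  then show ?thesis using L sub LIMSEQ_unique by blast
qed

end

section \<open>Fractional moments of the volatility\<close>

lemma measurable_lin_rec [measurable (raw)]:
  assumes [measurable]: "\<And>j t. (\<lambda>z. C z j t) \<in> borel_measurable N" "\<And>k. (\<lambda>z. w z k) \<in> borel_measurable N"
  shows "(\<lambda>z. lin_rec d (C z) (w z) k) \<in> borel_measurable N"
proof (induction k rule: less_induct)
  case (less k)
  have "(\<lambda>z. if j \<le> k then C z j (int k - int j) * lin_rec d (C z) (w z) (k - j) else 0) \<in> borel_measurable N"
    if "j \<in> {1..d}" for j
  proof (cases "j \<le> k")
    case True
    then have [measurable]: "(\<lambda>z. lin_rec d (C z) (w z) (k - j)) \<in> borel_measurable N" using that by (intro less) auto
    show ?thesis using True by simp
  qed simp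
  then show ?case by (subst lin_rec.simps) (intro borel_measurable_add borel_measurable_sum, auto)
qed

text \<open>After division by \<open>a + b\<close> this is \<open>x <= x powr s\<close> on [0, 1].
  It lets s-th moments be propagated through a recursion with an additive term.\<close>

lemma powr_add_le:
  fixes a b s :: real
  assumes "0 \<le> a" "0 \<le> b" "0 < s" "s \<le> 1"
  shows "(a + b) powr s \<le> a powr s + b powr s"
proof (cases "a + b = 0")
  case False
  then have ab: "a + b > 0" using assms by linarith
  have *: "x / (a + b) \<le> (x / (a + b)) powr s" if "0 \<le> x" "x \<le> a + b" for x
  proof (cases "x = 0")
    case False
    then have "(x / (a + b)) powr 1 \<le> (x / (a + b)) powr s"
      using that ab assms by (intro powr_mono') auto
    then show ?thesis using that ab by simp
  qed simp
  have "1 = a / (a + b) + b / (a + b)" using ab by (simp flip: add_divide_distrib)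
  also have "\<dots> \<le> (a / (a + b)) powr s + (b / (a + b)) powr s"
    using assms by (intro add_mono *) auto
  also have "\<dots> = (a powr s + b powr s) / (a + b) powr s"
    using assms ab by (simp add: powr_divide add_divide_distrib)
  finally show ?thesis using ab by (simp add: pos_le_divide_eq)
qed (use assms in auto)

context iid_sequences
begin

lemma prob_tendsto_0:
  assumes [measurable]: "\<And>n. Measurable.pred P (Q n)" and "AE z in P. eventually (\<lambda>n. \<not> Q n z) sequentially"
  shows "(\<lambda>n. P.prob {z. Q n z}) \<longlonglongrightarrow> 0"
proof -
  have m: "{z. Q n z} \<in> sets P" for n using assms(1)[of n] by (simp add: pred_def)
  have "(\<lambda>n. \<integral>z. indicator {z. Q n z} z \<partial>P) \<longlonglongrightarrow> (\<integral>z. (0::real) \<partial>P)"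
  proof (rule integral_dominated_convergence[where w="\<lambda>_. 1"])
    show "AE z in P. (\<lambda>n. indicator {z. Q n z} z :: real) \<longlonglongrightarrow> 0"
      using assms(2)
    proof (rule AE_mp, intro AE_I2 impI)
      fix z assume "eventually (\<lambda>n. \<not> Q n z) sequentially"
      then have "eventually (\<lambda>n. 0 = (indicator {z. Q n z} z :: real)) sequentially" by eventually_elim auto
      then show "(\<lambda>n. indicator {z. Q n z} z :: real) \<longlonglongrightarrow> 0"
        by (rule Lim_transform_eventually[OF tendsto_const])
    qed
  qed (use m in auto)
  then show ?thesis using m by simp
qed

end

locale agarch_innovations = iid_sequences D + agarch_rec d a0 g A B
  for D d a0 g A B
begin

lemma measurable_cf [measurable]: "(\<lambda>z. cf z j t) \<in> borel_measurable P"
  unfolding cf_def by measurable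

lemma measurable_vstart [measurable]: "(\<lambda>z. vstart z k) \<in> borel_measurable P"
  unfolding vstart_def by measurable

lemma measurable_vstep [measurable]: "(\<lambda>z. vstep z t n) \<in> borel_measurable P"
  unfolding vstep_def by measurable

lemma measurable_vol2 [measurable]: "(\<lambda>z. vol2 z t) \<in> borel_measurable P"
  unfolding vol2_def by measurable

lemma measurable_stable [measurable]: "Measurable.pred P stable"
proof -
  \<comment> \<open>Monotonicity turns convergence into boundedness by some natural number, a
    countable condition.\<close>
  have "convergent (vstep z t) \<longleftrightarrow> (\<exists>K::nat. \<forall>n. vstep z t n \<le> real K)" for z t
  proof
    assume "convergent (vstep z t)"
    then obtain L where "vstep z t \<longlonglongrightarrow> L" by (auto simp: convergent_def)
    moreover obtain K :: nat where "L \<le> real K" using real_arch_simple by blast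
    ultimately show "\<exists>K::nat. \<forall>n. vstep z t n \<le> real K" using incseq_le[OF incseq_vstep] order_trans by blast
  next
    assume "\<exists>K::nat. \<forall>n. vstep z t n \<le> real K"
    then obtain K :: nat where K: "\<forall>i. vstep z t i \<le> real K" by blast
    show "convergent (vstep z t)" using incseq_convergent[OF incseq_vstep K] by (auto simp: convergent_def)
  qed
  then show ?thesis unfolding stable_def by simp
qed

end

locale agarch_seq = agarch_innovations D d a0 g A B
  for D d a0 g A B +
  assumes second_moment: "(\<integral>\<^sup>+x. ennreal (x\<^sup>2) \<partial>D) = 1"
    and news_pos: "0 < D.prob {x. 0 < (\<bar>x\<bar> - g * x)\<^sup>2}"
    and AE_stable: "AE z in P. stable z"
begin

text \<open>One number that controls the effect of the past on the future: the weight
  \<open>1 + z^2\<close> is the one in \<open>cf_le\<close>, so every product of a coefficient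
  before s with u is at most \<open>4 * (A j + B j)\<close> times this sum.\<close>

definition state :: "(int \<Rightarrow> real) \<Rightarrow> (int \<Rightarrow> real) \<Rightarrow> int \<Rightarrow> real" where
  "state z u s = (\<Sum>i=1..d. (1 + (z (s - int i))\<^sup>2) * u (s - int i))"

definition ext :: "(nat \<Rightarrow> real) \<Rightarrow> int \<Rightarrow> real" where
  "ext x t = (if t \<ge> 0 then x (nat t) else 0)"

text \<open>The response to a past of size one, with the random coefficients before time 0 replaced
  by \<open>A j + B j\<close>. It therefore depends only on innovations from time 0 on.\<close>

definition vhom :: "(int \<Rightarrow> real) \<Rightarrow> nat \<Rightarrow> real" where
  "vhom z = lin_rec d (cf z) (\<lambda>k. \<Sum>j=1..d. if j \<le> k then 0 else A j + B j)"

lemma measurable_vhom [measurable]: "(\<lambda>z. vhom z k) \<in> borel_measurable P"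
  unfolding vhom_def by measurable

lemma vhom_nonneg: "0 \<le> vhom z k"
  unfolding vhom_def using A B by (intro lin_rec_nonneg sum_nonneg cf_nonneg) auto

lemma depends_vhom: "depends_on (\<lambda>z. vhom z k) {0..<int k}"
  unfolding depends_on_def vhom_def by (intro allI impI lin_rec_cong) (auto simp: cf_def)

lemma state_nonneg: "(\<And>t. 0 \<le> u t) \<Longrightarrow> 0 \<le> state z u s"
  unfolding state_def by (intro sum_nonneg mult_nonneg_nonneg) auto

lemma state_tshift: "state (tshift s z) (\<lambda>t. u (t + s)) t = state z u (t + s)"
  by (simp add: state_def algebra_simps)

text \<open>Restarting at s and bounding the source from the past separates the two sides of s: the
  past enters only through the scalar \<open>state z u s\<close>, which multiplies a process driven
  by later innovations.\<close>

lemma solution_le_hom: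
  assumes u: "\<And>k. u (s + int k) = a0 + (\<Sum>j=1..d. cf z j (s + int k - int j) * u (s + int k - int j))"
    and u0: "\<And>t. 0 \<le> u t"
  shows "u (s + int k) \<le> vstart (tshift s z) k + 4 * state z u s * vhom (tshift s z) k"
proof -
  let ?w = "\<lambda>k. \<Sum>j=1..d. if j \<le> k then 0 else cf z j (s + int k - int j) * u (s + int k - int j)"
  have 1: "u (s + int k) = vstart (tshift s z) k + lin_rec d (cf (tshift s z)) ?w k"
    using lin_rec_restart[where u=u and s=s and a=a0 and d=d and C="cf z" and k=k, OF u] unfolding vstart_def cf_tshift' .
  have "lin_rec d (cf (tshift s z)) ?w k \<le> lin_rec d (cf (tshift s z)) (\<lambda>k. 4 * state z u s * (\<Sum>j=1..d. if j \<le> k then 0 else A j + B j)) k"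
  proof (rule lin_rec_mono)
    fix k
    show "?w k \<le> 4 * state z u s * (\<Sum>j=1..d. if j \<le> k then 0 else A j + B j)"
      unfolding sum_distrib_left
    proof (rule sum_mono)
      fix j assume j: "j \<in> {1..d}"
      have "cf z j (s + int k - int j) * u (s + int k - int j) \<le> 4 * state z u s * (A j + B j)" if "\<not> j \<le> k"
      proof -
        let ?t = "s + int k - int j"
        have "(1 + (z (s - int (j - k)))\<^sup>2) * u (s - int (j - k)) \<le> state z u s"
          unfolding state_def using j that u0 by (intro member_le_sum) auto
        then have st: "(1 + (z ?t)\<^sup>2) * u ?t \<le> state z u s" using that by (simp add: of_nat_diff algebra_simps)
        have "cf z j ?t * u ?t \<le> 4 * (A j + B j) * (1 + (z ?t)\<^sup>2) * u ?t"
          using cf_le u0 by (intro mult_right_mono) auto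
        also have "\<dots> = 4 * (A j + B j) * ((1 + (z ?t)\<^sup>2) * u ?t)" by simp
        also have "\<dots> \<le> 4 * (A j + B j) * state z u s"
          using st A[of j] B[of j] by (intro mult_left_mono) auto
        finally show ?thesis by (simp add: algebra_simps)
      qed
      then show "(if j \<le> k then 0 else cf z j (s + int k - int j) * u (s + int k - int j))
        \<le> 4 * state z u s * (if j \<le> k then 0 else A j + B j)" by auto
    qed
  qed (rule cf_nonneg)
  also have "\<dots> = 4 * state z u s * vhom (tshift s z) k" unfolding vhom_def by (rule lin_rec_scale)
  finally show ?thesis unfolding 1 by simp
qed

lemma ext_vstart_rec:
  "ext (vstart z) (0 + int k) = a0 + (\<Sum>j=1..d. cf z j (0 + int k - int j) * ext (vstart z) (0 + int k - int j))"
proof -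
  have "ext (vstart z) (0 + int k) = vstart z k" by (simp add: ext_def)
  also have "\<dots> = a0 + (\<Sum>j=1..d. if j \<le> k then cf z j (int k - int j) * vstart z (k - j) else 0)"
    by (rule vstart_rec)
  also have "(\<Sum>j=1..d. if j \<le> k then cf z j (int k - int j) * vstart z (k - j) else 0)
    = (\<Sum>j=1..d. cf z j (0 + int k - int j) * ext (vstart z) (0 + int k - int j))"
    by (intro sum.cong refl) (auto simp: ext_def nat_diff_distrib')
  finally show ?thesis .
qed

lemma ext_vstart_nonneg: "0 \<le> ext (vstart z) t"
  using order_trans[OF less_imp_le[OF a0] vstart_ge] by (simp add: ext_def)

text \<open>A crude growth rate per step in the mean: the factor 8 is the 4 of \<open>cf_le\<close>
  times the mean 2 of \<open>1 + z^2\<close>. It may be large; only its finiteness matters.\<close>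

definition Lam :: real where "Lam = 1 + (\<Sum>j=1..d. 8 * (A j + B j))"

lemma Lam_ge_1: "Lam \<ge> 1"
  unfolding Lam_def using A B by (auto intro!: sum_nonneg)

lemma measurable_D: "borel_measurable D = borel_measurable borel"
  by (rule measurable_cong_sets) (simp_all add: sets_D)

lemma nn_integral_coord: "f \<in> borel_measurable borel \<Longrightarrow> (\<integral>\<^sup>+z. f (z t) \<partial>P) = (\<integral>\<^sup>+x. f x \<partial>D)"
  using nn_integral_distr[OF measurable_coord, of f t] by (simp add: distr_coord measurable_D)

lemma nn_integral_1_sq: "(\<integral>\<^sup>+z. ennreal (1 + (z t)\<^sup>2) \<partial>P) = 2"
proof -
  have "(\<integral>\<^sup>+x. ennreal (1 + x\<^sup>2) \<partial>D) = (\<integral>\<^sup>+x. 1 + ennreal (x\<^sup>2) \<partial>D)"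
    by (intro nn_integral_cong) (simp add: ennreal_plus flip: ennreal_1)
  also have "\<dots> = 2" using D.emeasure_space_1
    by (subst nn_integral_add) (auto simp: second_moment measurable_D)
  finally show ?thesis by (subst nn_integral_coord[of "\<lambda>x. ennreal (1 + x\<^sup>2)"]) auto
qed

lemma nn_integral_cf_le: "(\<integral>\<^sup>+z. ennreal (cf z j t) \<partial>P) \<le> ennreal (8 * (A j + B j))"
proof -
  have "(\<integral>\<^sup>+z. ennreal (cf z j t) \<partial>P) \<le> (\<integral>\<^sup>+z. ennreal (4 * (A j + B j)) * ennreal (1 + (z t)\<^sup>2) \<partial>P)"
    using A[of j] B[of j] cf_le
    by (intro nn_integral_mono) (simp add: ennreal_mult[symmetric] ennreal_leI del: ennreal_plus)
  also have "\<dots> = ennreal (4 * (A j + B j)) * ennreal 2"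
    by (subst nn_integral_cmult) (auto simp: nn_integral_1_sq simp del: ennreal_plus)
  also have "\<dots> = ennreal (8 * (A j + B j))" using A[of j] B[of j] by (subst ennreal_mult[symmetric]) auto
  finally show ?thesis .
qed

lemma depends_lin_rec: "depends_on (\<lambda>z. lin_rec d (cf z) w k) {0..<int k}"
  unfolding depends_on_def by (intro allI impI lin_rec_cong) (auto simp: cf_def)

lemma depends_comp: "depends_on f I \<Longrightarrow> depends_on (\<lambda>z. h (f z)) I"
  unfolding depends_on_def by metis

lemma depends_coord: "depends_on (\<lambda>z. h (z t)) {t}"
  unfolding depends_on_def by auto

text \<open>The coefficient at time \<open>k - j\<close> is independent of the iterate at that same
  time, which uses strictly earlier innovations, so the expectations multiply.\<close>

lemma nn_integral_lin_rec_le: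
  assumes w: "\<And>k. 0 \<le> w k" "\<And>k. w k \<le> W"
  shows "(\<integral>\<^sup>+z. ennreal (lin_rec d (cf z) w k) \<partial>P) \<le> ennreal (W * Lam ^ k)"
proof (induction k rule: less_induct)
  case (less k)
  let ?x = "\<lambda>z k. lin_rec d (cf z) w k"
  have W: "0 \<le> W" using w order_trans by blast
  have nn: "0 \<le> ?x z k" for z k using w cf_nonneg by (intro lin_rec_nonneg) auto
  have "(\<integral>\<^sup>+z. ennreal (?x z k) \<partial>P) =
    (\<integral>\<^sup>+z. ennreal (w k) + (\<Sum>j=1..d. if j \<le> k then ennreal (cf z j (int k - int j)) * ennreal (?x z (k - j)) else 0) \<partial>P)"
  proof (rule nn_integral_cong)
    fix z
    have "ennreal (?x z k) = ennreal (w k) + ennreal (\<Sum>j=1..d. if j \<le> k then cf z j (int k - int j) * ?x z (k - j) else 0)"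
      by (subst lin_rec.simps, rule ennreal_plus) (auto intro!: w sum_nonneg mult_nonneg_nonneg cf_nonneg nn)
    also have "ennreal (\<Sum>j=1..d. if j \<le> k then cf z j (int k - int j) * ?x z (k - j) else 0)
      = (\<Sum>j=1..d. ennreal (if j \<le> k then cf z j (int k - int j) * ?x z (k - j) else 0))"
      by (rule sum_ennreal[symmetric]) (auto intro!: mult_nonneg_nonneg cf_nonneg nn)
    also have "\<dots> = (\<Sum>j=1..d. if j \<le> k then ennreal (cf z j (int k - int j)) * ennreal (?x z (k - j)) else 0)"
      by (intro sum.cong refl) (auto simp: ennreal_mult cf_nonneg nn)
    finally show "ennreal (?x z k) = ennreal (w k) + (\<Sum>j=1..d. if j \<le> k then ennreal (cf z j (int k - int j)) * ennreal (?x z (k - j)) else 0)" .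
  qed
  also have "\<dots> = ennreal (w k) + (\<Sum>j=1..d. \<integral>\<^sup>+z. (if j \<le> k then ennreal (cf z j (int k - int j)) * ennreal (?x z (k - j)) else 0) \<partial>P)"
    by (subst nn_integral_add) (auto simp: P.emeasure_space_1[simplified] nn_integral_sum)
  also have "\<dots> \<le> ennreal W + (\<Sum>j=1..d. ennreal (if j \<le> k then 8 * (A j + B j) * (W * Lam ^ (k - 1)) else 0))"
  proof (intro add_mono ennreal_leI w sum_mono)
    fix j assume j: "j \<in> {1..d}"
    show "(\<integral>\<^sup>+z. (if j \<le> k then ennreal (cf z j (int k - int j)) * ennreal (?x z (k - j)) else 0) \<partial>P)
      \<le> ennreal (if j \<le> k then 8 * (A j + B j) * (W * Lam ^ (k - 1)) else 0)"
    proof (cases "j \<le> k")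
      case True
      have "(\<integral>\<^sup>+z. ennreal (cf z j (int k - int j)) * ennreal (?x z (k - j)) \<partial>P)
        = (\<integral>\<^sup>+z. ennreal (cf z j (int k - int j)) \<partial>P) * (\<integral>\<^sup>+z. ennreal (?x z (k - j)) \<partial>P)"
      proof (rule nn_integral_mult_indep)
        show "depends_on (\<lambda>z. ennreal (cf z j (int k - int j))) {int k - int j}"
          unfolding cf_def by (rule depends_coord)
        show "depends_on (\<lambda>z. ennreal (?x z (k - j))) {0..<int (k - j)}" by (rule depends_comp[OF depends_lin_rec])
      qed (use True in auto)
      also have "\<dots> \<le> ennreal (8 * (A j + B j)) * ennreal (W * Lam ^ (k - j))"
        using True j by (intro mult_mono nn_integral_cf_le less) auto
      also have "\<dots> = ennreal (8 * (A j + B j) * (W * Lam ^ (k - j)))"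
        using A[of j] B[of j] W Lam_ge_1 by (subst ennreal_mult[symmetric]) auto
      also have "\<dots> \<le> ennreal (8 * (A j + B j) * (W * Lam ^ (k - 1)))"
        using A[of j] B[of j] W Lam_ge_1 j by (intro ennreal_leI mult_left_mono power_increasing) auto
      finally show ?thesis using True by simp
    qed simp
  qed
  also have "\<dots> = ennreal (W + (\<Sum>j=1..d. if j \<le> k then 8 * (A j + B j) * (W * Lam ^ (k - 1)) else 0))"
    using A B W Lam_ge_1 by (subst sum_ennreal, force, subst ennreal_plus) (auto intro!: sum_nonneg)
  also have "\<dots> \<le> ennreal (W * Lam ^ k)"
  proof (intro ennreal_leI)
    show "W + (\<Sum>j=1..d. if j \<le> k then 8 * (A j + B j) * (W * Lam ^ (k - 1)) else 0) \<le> W * Lam ^ k"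
    proof (cases k)
      case (Suc k')
      have "(\<Sum>j=1..d. if j \<le> k then 8 * (A j + B j) * (W * Lam ^ (k - 1)) else 0) \<le> (\<Sum>j=1..d. 8 * (A j + B j) * (W * Lam ^ k'))"
        using A B W Lam_ge_1 Suc by (intro sum_mono) auto
      also have "\<dots> = (Lam - 1) * (W * Lam ^ k')" unfolding Lam_def by (simp add: sum_distrib_right)
      finally have "W + (\<Sum>j=1..d. if j \<le> k then 8 * (A j + B j) * (W * Lam ^ (k - 1)) else 0) \<le> W * 1 + (Lam - 1) * (W * Lam ^ k')" by simp
      also have "W * 1 \<le> W * Lam ^ k'" using W Lam_ge_1 by (intro mult_left_mono) auto
      finally show ?thesis using Suc by (simp add: algebra_simps)
    qed (use W in auto)
  qed
  finally show ?case .
qed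

lemma nn_integral_state_le:
  assumes w: "\<And>k. 0 \<le> w k" "\<And>k. w k \<le> W"
  shows "(\<integral>\<^sup>+z. ennreal (state z (ext (lin_rec d (cf z) w)) (int n)) \<partial>P) \<le> ennreal (2 * real d * W * Lam ^ n)"
proof -
  let ?x = "\<lambda>z k. lin_rec d (cf z) w k"
  have W: "0 \<le> W" using w order_trans by blast
  have nn: "0 \<le> ?x z k" for z k using w cf_nonneg by (intro lin_rec_nonneg) auto
  have [measurable]: "(\<lambda>z. ext (?x z) t) \<in> borel_measurable P" for t unfolding ext_def by measurable
  have "(\<integral>\<^sup>+z. ennreal (state z (ext (?x z)) (int n)) \<partial>P) =
    (\<integral>\<^sup>+z. (\<Sum>i=1..d. ennreal (1 + (z (int n - int i))\<^sup>2) * ennreal (ext (?x z) (int n - int i))) \<partial>P)"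
    unfolding state_def
    by (intro nn_integral_cong, subst sum_ennreal[symmetric])
       (auto simp: ext_def nn ennreal_mult intro!: sum.cong)
  also have "\<dots> = (\<Sum>i=1..d. \<integral>\<^sup>+z. ennreal (1 + (z (int n - int i))\<^sup>2) * ennreal (ext (?x z) (int n - int i)) \<partial>P)"
    by (rule nn_integral_sum) measurable
  also have "\<dots> \<le> (\<Sum>i=1..d. ennreal (2 * (W * Lam ^ n)))"
  proof (rule sum_mono)
    fix i assume i: "i \<in> {1..d}"
    show "(\<integral>\<^sup>+z. ennreal (1 + (z (int n - int i))\<^sup>2) * ennreal (ext (?x z) (int n - int i)) \<partial>P) \<le> ennreal (2 * (W * Lam ^ n))"
    proof (cases "i \<le> n")
      case True
      then have e: "ext (?x z) (int n - int i) = ?x z (n - i)" for z by (simp add: ext_def nat_diff_distrib')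
      have "(\<integral>\<^sup>+z. ennreal (1 + (z (int n - int i))\<^sup>2) * ennreal (?x z (n - i)) \<partial>P) =
        (\<integral>\<^sup>+z. ennreal (1 + (z (int n - int i))\<^sup>2) \<partial>P) * (\<integral>\<^sup>+z. ennreal (?x z (n - i)) \<partial>P)"
        by (rule nn_integral_mult_indep[of _ _ "{int n - int i}" "{0..<int (n - i)}"])
           (use True in \<open>auto intro: depends_comp[OF depends_lin_rec] depends_coord[of "\<lambda>x. ennreal (1 + x\<^sup>2)"] simp del: ennreal_plus of_nat_diff\<close>)
      also have "\<dots> \<le> 2 * ennreal (W * Lam ^ (n - i))"
        unfolding nn_integral_1_sq by (intro mult_left_mono nn_integral_lin_rec_le w) auto
      also have "\<dots> = ennreal (2 * (W * Lam ^ (n - i)))"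
        using W Lam_ge_1 by (subst ennreal_mult) auto
      also have "\<dots> \<le> ennreal (2 * (W * Lam ^ n))"
        using W Lam_ge_1 by (intro ennreal_leI mult_left_mono power_increasing) auto
      finally show ?thesis unfolding e .
    next
      case False
      then show ?thesis by (simp add: ext_def)
    qed
  qed
  also have "\<dots> = ennreal (2 * real d * W * Lam ^ n)"
    using W Lam_ge_1 by (simp add: sum_constant ennreal_of_nat_eq_real_of_nat ennreal_mult[symmetric] algebra_simps)
  finally show ?thesis .
qed

end

context iid_sequences
begin

lemma pred_sets: "Measurable.pred P Q \<Longrightarrow> {z. Q z} \<in> sets P"
  by (simp add: pred_def)

end

section \<open>Frequency of bounded blocks and decay of homogeneous solutions\<close>

context agarch_seq
begin

text \<open>The block is \<open>d..2d-1\<close> and not \<open>0..d-1\<close>, because the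
  contraction starts with block number 1; block 0 only supplies the initial comparison.\<close>

definition bounded_block :: "real \<Rightarrow> (int \<Rightarrow> real) \<Rightarrow> bool" where
  "bounded_block K z \<longleftrightarrow> (\<forall>i<d. vol2 z (int d + int i) \<le> K)"

lemma measurable_bounded_block [measurable]: "Measurable.pred P (bounded_block K)"
  unfolding bounded_block_def by measurable

lemma exists_block_bound: "\<exists>K>a0. 1 / 2 < P.prob {z. bounded_block K z}"
proof -
  have m: "{z. bounded_block K z} \<in> sets P" for K
    using measurable_bounded_block[of K] by (simp add: pred_def)
  have "(\<lambda>n. P.prob {z. bounded_block (real n) z}) \<longlonglongrightarrow> P.prob (\<Union>n. {z. bounded_block (real n) z})"
    using m by (intro P.finite_Lim_measure_incseq)
      (auto simp: incseq_def bounded_block_def intro: order_trans)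
  moreover have "(\<Union>n. {z. bounded_block (real n) z}) = UNIV"
  proof -
    have "\<exists>n. bounded_block (real n) z" for z
    proof -
      obtain n :: nat where n: "(\<Sum>i<d. \<bar>vol2 z (int d + int i)\<bar>) \<le> real n" using real_arch_simple by blast
      have "vol2 z (int d + int i) \<le> real n" if "i < d" for i
      proof -
        have "\<bar>vol2 z (int d + int i)\<bar> \<le> (\<Sum>i<d. \<bar>vol2 z (int d + int i)\<bar>)"
          using that by (intro member_le_sum[where f="\<lambda>i. \<bar>vol2 z (int d + int i)\<bar>"]) auto
        then show ?thesis using n by linarith
      qed
      then show ?thesis unfolding bounded_block_def by blast
    qed
    then show ?thesis by blast
  qed
  ultimately have "(\<lambda>n. P.prob {z. bounded_block (real n) z}) \<longlonglongrightarrow> 1" using P.prob_space by simp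
  then have "eventually (\<lambda>n. 1 / 2 < P.prob {z. bounded_block (real n) z}) sequentially"
    by (rule order_tendstoD) simp
  moreover have "eventually (\<lambda>n. a0 < real n) sequentially"
    using filterlim_real_sequentially unfolding filterlim_at_top_dense by blast
  ultimately have "eventually (\<lambda>n. a0 < real n \<and> 1 / 2 < P.prob {z. bounded_block (real n) z}) sequentially"
    by eventually_elim simp
  then show ?thesis by (auto simp: eventually_sequentially)
qed

definition block_count :: "real \<Rightarrow> nat \<Rightarrow> (int \<Rightarrow> real) \<Rightarrow> nat" where
  "block_count K L z = (\<Sum>m<L. if bounded_block K (tshift (int m * int d) z) then 1 else 0)"

lemma measurable_block_count [measurable]: "block_count K L \<in> measurable P (count_space UNIV)"
  unfolding block_count_def by measurable

lemma AE_block_count: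
  assumes "1 / 2 < P.prob {z. bounded_block K z}"
  shows "AE z in P. eventually (\<lambda>L. L \<le> 4 * block_count K L z) sequentially"
proof -
  have m: "{z. bounded_block K z} \<in> sets P"
    using measurable_bounded_block[of K] by (simp add: pred_def)
  have "AE z in P. \<exists>C. \<forall>n. real n * (1 / 2) - C \<le> (\<Sum>i<n. indicator {z. bounded_block K z} (tshift (int i * int d) z))"
    by (rule tshift_sums_linear_growth) (use d m assms P.emeasure_eq_measure in auto)
  then show ?thesis
  proof (rule AE_mp, intro AE_I2 impI)
    fix z assume "\<exists>C. \<forall>n. real n * (1 / 2) - C \<le> (\<Sum>i<n. indicator {z. bounded_block K z} (tshift (int i * int d) z))"
    then obtain C where C: "\<And>n. real n * (1 / 2) - C \<le> (\<Sum>i<n. indicator {z. bounded_block K z} (tshift (int i * int d) z))" by blast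
    have c: "real (block_count K n z) = (\<Sum>i<n. indicator {z. bounded_block K z} (tshift (int i * int d) z))" for n
      unfolding block_count_def of_nat_sum by (intro sum.cong) (auto simp: indicator_def)
    \<comment> \<open>Once \<open>4 * C <= L\<close>, the lower bound \<open>L / 2 - C\<close> is
      still at least \<open>L / 4\<close>.\<close>
    have "eventually (\<lambda>n. 4 * C \<le> real n) sequentially"
      using filterlim_real_sequentially unfolding filterlim_at_top by blast
    then show "eventually (\<lambda>L. L \<le> 4 * block_count K L z) sequentially"
    proof eventually_elim
      case (elim L)
      have "real L \<le> real (4 * block_count K L z)" using C[of L] elim unfolding c[symmetric] by simp
      then show ?case by linarith
    qed
  qed
qed

definition active :: "real \<Rightarrow> (int \<Rightarrow> real) \<Rightarrow> bool" where
  "active e z \<longleftrightarrow> (\<forall>i\<in>{-int d..-1}. e \<le> (\<bar>z i\<bar> - g * z i)\<^sup>2)"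

text \<open>Let R be the part of the volatility that stems from before time 0. On
  \<open>active e\<close> the true coefficients there are at least \<open>e * (A j + B j)\<close>
  and the volatility is at least a0, so R dominates \<open>e * a0\<close> times \<open>vhom\<close>.
  At the same time R contracts on every bounded block.\<close>

lemma hom_state_le:
  assumes st: "stable z" and e: "0 \<le> e" "e \<le> 1" "active e z" and K: "a0 < K"
  shows "e * a0 * state z (ext (vhom z)) (int (Suc L * d)) \<le> (1 - a0 / K) ^ block_count K L z * state z (vol2 z) (int (Suc L * d))"
proof -
  define src where "src k = (\<Sum>j=1..d. if j \<le> k then 0 else cf z j (int k - int j) * vol2 z (int k - int j))" for k
  define R where "R k = lin_rec d (cf z) src k" for k
  define u where "u k = vol2 z (int k)" for k
  have up: "0 \<le> vol2 z t" for t using vol2_ge[OF st] a0 by (meson less_imp_le order_trans)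
  have split: "u k = vstart z k + R k" for k
    using lin_rec_restart[where u="vol2 z" and s=0 and a=a0 and d=d and C="cf z" and k=k, OF vol2_rec[OF st]]
    unfolding u_def R_def vstart_def src_def by (simp cong: if_cong)
  have low: "e * a0 * vhom z k \<le> R k" for k
    unfolding vhom_def R_def lin_rec_scale[symmetric]
  proof (rule lin_rec_mono)
    fix k
    show "e * a0 * (\<Sum>j=1..d. if j \<le> k then 0 else A j + B j) \<le> src k"
      unfolding src_def sum_distrib_left
    proof (rule sum_mono)
      fix j assume j: "j \<in> {1..d}"
      have "e * a0 * (A j + B j) \<le> cf z j (int k - int j) * vol2 z (int k - int j)" if "\<not> j \<le> k"
      proof -
        have "int k - int j \<in> {-int d..-1}" using that j by auto
        then have "e \<le> (\<bar>z (int k - int j)\<bar> - g * z (int k - int j))\<^sup>2" using e unfolding active_def by blast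
        then have "A j * e \<le> A j * (\<bar>z (int k - int j)\<bar> - g * z (int k - int j))\<^sup>2" using A[of j] by (rule mult_left_mono)
        moreover have "e * B j \<le> B j" using B[of j] e by (simp add: mult_left_le_one_le)
        ultimately have "e * (A j + B j) \<le> cf z j (int k - int j)" unfolding cf_def by (simp add: distrib_left mult.commute)
        then have "e * (A j + B j) * a0 \<le> cf z j (int k - int j) * vol2 z (int k - int j)"
          using vol2_ge[OF st] a0 cf_nonneg by (intro mult_mono) auto
        then show ?thesis by (simp add: mult_ac)
      qed
      then show "e * a0 * (if j \<le> k then 0 else A j + B j) \<le> (if j \<le> k then 0 else cf z j (int k - int j) * vol2 z (int k - int j))"
        by auto
    qed
  qed (rule cf_nonneg)
  have contr: "R (L * d + i) \<le> (1 - a0 / K) ^ block_count K L z * u (L * d + i)" if i: "i < d" for i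
  proof -
    have "R (L * d + i) \<le> (\<Prod>m=1..L. if \<forall>i<d. u (m * d + i) \<le> K then 1 - a0 / K else 1) * u (L * d + i)"
    proof (rule homogeneous_contraction[where C="\<lambda>j k. cf z j (int k - int j)"])
      show "u k = a0 + (\<Sum>j=1..d. cf z j (int k - int j) * u (k - j))" if "d \<le> k" for k
        unfolding u_def using that by (subst vol2_rec[OF st]) (auto intro!: sum.cong simp: of_nat_diff)
      show "R k = (\<Sum>j=1..d. cf z j (int k - int j) * R (k - j))" if "d \<le> k" for k
        unfolding R_def using that by (subst lin_rec.simps) (auto intro!: sum.cong simp: src_def)
      show "R k \<le> u k" if "k < d" for k using split[of k] vstart_ge[of z k] a0 by simp
    qed (use d a0 K cf_nonneg up i in \<open>auto simp: u_def\<close>)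
    also have "(\<Prod>m=1..L. if \<forall>i<d. u (m * d + i) \<le> K then 1 - a0 / K else 1) = (1 - a0 / K) ^ block_count K L z"
      unfolding block_count_def power_sum
    proof (rule prod.reindex_bij_witness[of _ Suc "\<lambda>m. m - 1"])
      fix m assume "m \<in> {1..L}"
      then obtain m' where m': "m = Suc m'" by (cases m) auto
      have "bounded_block K (tshift (int (m - 1) * int d) z) \<longleftrightarrow> (\<forall>i<d. u (m * d + i) \<le> K)"
        by (simp add: m' bounded_block_def u_def vol2_tshift algebra_simps)
      then show "(1 - a0 / K) ^ (if bounded_block K (tshift (int (m - 1) * int d) z) then 1 else 0) =
        (if \<forall>i<d. u (m * d + i) \<le> K then 1 - a0 / K else 1)"
        by auto
    qed auto
    finally show ?thesis .
  qed
  let ?q = "(1 - a0 / K) ^ block_count K L z"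
  show ?thesis
    unfolding state_def sum_distrib_left
  proof (rule sum_mono)
    fix i assume i: "i \<in> {1..d}"
    define k where "k = L * d + (d - i)"
    have t: "int (Suc L * d) - int i = int k" using i by (simp add: k_def of_nat_diff)
    have "e * a0 * vhom z k \<le> R k" by (rule low)
    also have "\<dots> \<le> ?q * u k" unfolding k_def using i d by (intro contr) auto
    finally have "(1 + (z (int k))\<^sup>2) * (e * a0 * vhom z k) \<le> (1 + (z (int k))\<^sup>2) * (?q * u k)"
      by (intro mult_left_mono) auto
    then show "e * a0 * ((1 + (z (int (Suc L * d) - int i))\<^sup>2) * ext (vhom z) (int (Suc L * d) - int i)) \<le>
      ?q * ((1 + (z (int (Suc L * d) - int i))\<^sup>2) * vol2 z (int (Suc L * d) - int i))"
      unfolding t u_def ext_def by (simp add: mult_ac)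
  qed
qed

lemma measurable_state [measurable (raw)]:
  assumes [measurable]: "\<And>t. (\<lambda>z. u z t) \<in> borel_measurable P"
  shows "(\<lambda>z. state z (u z) s) \<in> borel_measurable P"
  unfolding state_def by measurable

lemma measurable_ext [measurable (raw)]:
  assumes [measurable]: "\<And>k. (\<lambda>z. x z k) \<in> borel_measurable P"
  shows "(\<lambda>z. ext (x z) t) \<in> borel_measurable P"
  unfolding ext_def by measurable

lemma measurable_active [measurable]: "Measurable.pred P (active e)"
  unfolding active_def by measurable

lemma active_pos: "\<exists>e. 0 < e \<and> e \<le> 1 \<and> 0 < P.prob {z. active e z}"
proof -
  let ?S = "\<lambda>n. {x. 1 / real (Suc n) \<le> (\<bar>x\<bar> - g * x)\<^sup>2}"
  have m: "?S n \<in> sets D" for n unfolding sets_D by measurable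
  have "\<exists>n. 1 / real (Suc n) \<le> y" if "0 < y" for y :: real
    using reals_Archimedean[OF that] by (auto simp: inverse_eq_divide intro: less_imp_le)
  then have U: "{x. 0 < (\<bar>x\<bar> - g * x)\<^sup>2} \<subseteq> (\<Union>n. ?S n)" by fast
  have "0 < D.prob (\<Union>n. ?S n)"
    using news_pos D.finite_measure_mono[OF U] m by (auto intro: less_le_trans)
  have inc: "incseq ?S"
  proof (rule incseq_SucI, safe)
    fix n x assume h: "1 / real (Suc n) \<le> (\<bar>x\<bar> - g * x)\<^sup>2"
    have "1 / real (Suc (Suc n)) \<le> 1 / real (Suc n)" by (simp add: frac_le)
    then show "1 / real (Suc (Suc n)) \<le> (\<bar>x\<bar> - g * x)\<^sup>2" using h by linarith
  qed
  have "(\<lambda>n. D.prob (?S n)) \<longlonglongrightarrow> D.prob (\<Union>n. ?S n)"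
    using m inc by (intro D.finite_Lim_measure_incseq) auto
  then obtain n where n: "0 < D.prob (?S n)"
    using order_tendstoD(1)[of _ "D.prob (\<Union>n. ?S n)" sequentially 0] \<open>0 < D.prob (\<Union>n. ?S n)\<close>
    by (metis (no_types, lifting) eventually_sequentially order_refl)
  define e where "e = 1 / real (Suc n)"
  have "emeasure P {z. active e z} = (\<Prod>i\<in>{-int d..-1}. emeasure D (?S n))"
    using PP.emeasure_PiM_Collect[of "{-int d..-1}" "\<lambda>_. ?S n"] m
    by (simp add: active_def e_def P_def[symmetric])
  also have "\<dots> = ennreal (D.prob (?S n) ^ d)"
    by (simp add: D.emeasure_eq_measure ennreal_power)
  finally have "P.prob {z. active e z} = D.prob (?S n) ^ d" by (simp add: P.emeasure_eq_measure)
  then show ?thesis using n by (intro exI[of _ e]) (simp add: e_def)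
qed

lemma depends_active: "depends_on (active e) {-int d..-1}"
  unfolding depends_on_def active_def by auto

lemma depends_hom_state: "depends_on (\<lambda>z. state z (ext (vhom z)) (int n)) {0..<int n} " if "n \<ge> d"
  unfolding depends_on_def state_def
proof (intro allI impI sum.cong refl)
  fix z z' :: "int \<Rightarrow> real" and i assume zz: "\<forall>i\<in>{0..<int n}. z i = z' i" and i: "i \<in> {1..d}"
  have "vhom z (n - i) = vhom z' (n - i)"
  proof -
    have "\<forall>i\<in>{0..<int (n - i)}. z i = z' i" using zz by auto
    then show ?thesis using depends_vhom[of "n - i"] unfolding depends_on_def by blast
  qed
  moreover have "z (int n - int i) = z' (int n - int i)" using zz i that by auto
  ultimately show "(1 + (z (int n - int i))\<^sup>2) * ext (vhom z) (int n - int i) = (1 + (z' (int n - int i))\<^sup>2) * ext (vhom z') (int n - int i)"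
    using i that by (simp add: ext_def nat_diff_distrib')
qed

text \<open>On the event that the news terms before time \<open>0\<close> are bounded away from \<open>0\<close>, which is independent of the
  homogeneous solution, the latter is controlled by the ergodic frequency of bounded blocks.\<close>
lemma hom_state_exponential:
  "\<exists>\<theta>. 0 < \<theta> \<and> \<theta> < 1 \<and> (\<lambda>L. P.prob {z. \<theta> ^ L < 4 * state z (ext (vhom z)) (int (Suc L * d))}) \<longlonglongrightarrow> 0"
proof -
  obtain K where K: "a0 < K" "1 / 2 < P.prob {z. bounded_block K z}" using exists_block_bound by blast
  obtain e where e: "0 < e" "e \<le> 1" "0 < P.prob {z. active e z}" using active_pos by blast
  define \<rho> where "\<rho> = 1 - a0 / K"
  have \<rho>: "0 < \<rho>" "\<rho> < 1" using K a0 by (auto simp: \<rho>_def)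
  \<comment> \<open>At least \<open>L / 4\<close> bounded blocks give the factor
    \<open>\<rho> powr (L / 4)\<close>, which is \<open>\<theta> ^ (2 * L)\<close>. One half of this
    decay absorbs the stationary factor y, the other half remains.\<close>
  define \<theta> where "\<theta> = \<rho> powr (1 / 8)"
  have \<theta>: "0 < \<theta>" "\<theta> < 1" using \<rho> powr_less_mono2[of "1/8" \<rho> 1] by (auto simp: \<theta>_def)
  define c where "c = 4 / (e * a0)"
  define V where "V z L = 4 * state z (ext (vhom z)) (int (Suc L * d))" for z L
  \<comment> \<open>The stationary state of the volatility. Its value at the end of the L blocks has
    the same law as at time 0, so it exceeds a growing threshold with vanishing probability.\<close>
  define y where "y z = state z (vol2 z) 0" for z
  have [measurable]: "(\<lambda>z. V z L) \<in> borel_measurable P" "y \<in> borel_measurable P" for L unfolding V_def y_def by measurable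
  have ysh: "state z (vol2 z) t = y (tshift t z)" for z t
    unfolding y_def using state_tshift[of t z "vol2 z" 0] by (simp add: vol2_tshift[abs_def])
  define Q1 where "Q1 L z \<longleftrightarrow> \<not> L \<le> 4 * block_count K L z" for L z
  define Q2 where "Q2 L z \<longleftrightarrow> 1 < c * \<theta> ^ L * y z" for L :: nat and z
  have [measurable]: "Measurable.pred P (Q1 L)" "Measurable.pred P (Q2 L)" for L unfolding Q1_def Q2_def by measurable
  have l1: "(\<lambda>L. P.prob {z. Q1 L z}) \<longlonglongrightarrow> 0"
    using AE_block_count[OF K(2)] by (intro prob_tendsto_0) (auto simp: Q1_def)
  have l2: "(\<lambda>L. P.prob {z. Q2 L z}) \<longlonglongrightarrow> 0"
  proof (intro prob_tendsto_0 AE_I2)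
    fix z
    have "(\<lambda>L. c * \<theta> ^ L * y z) \<longlonglongrightarrow> c * 0 * y z" using \<theta> by (intro tendsto_intros LIMSEQ_realpow_zero) auto
    then have "eventually (\<lambda>L. c * \<theta> ^ L * y z < 1) sequentially" by (intro order_tendstoD(2)) auto
    then show "eventually (\<lambda>L. \<not> Q2 L z) sequentially" by eventually_elim (auto simp: Q2_def)
  qed simp
  have key: "P.prob {z. \<theta> ^ L < V z L} * P.prob {z. active e z} \<le> P.prob {z. Q1 L z} + P.prob {z. Q2 L z}" for L
  proof -
    let ?n = "int (Suc L * d)"
    have sets: "{z. \<theta> ^ L < V z L} \<in> sets P" "{z. active e z} \<in> sets P" "{z. Q1 L z} \<in> sets P" "{z. Q2 L (tshift ?n z)} \<in> sets P"
      by (intro pred_sets; measurable)+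
    have "P.prob {z. \<theta> ^ L < V z L} * P.prob {z. active e z} = P.prob {z. \<theta> ^ L < V z L \<and> active e z}"
    proof (rule prob_Int_indep[symmetric])
      show "depends_on (\<lambda>z. \<theta> ^ L < V z L) {0..<?n}"
        unfolding V_def by (rule depends_comp[of _ _ "\<lambda>v. \<theta> ^ L < 4 * v"], rule depends_hom_state) simp
    qed (use sets depends_active in auto)
    also have "\<dots> \<le> P.prob ({z. Q1 L z} \<union> {z. Q2 L (tshift ?n z)})"
    proof (rule P.finite_measure_mono_AE)
      show "AE z in P. z \<in> {z. \<theta> ^ L < V z L \<and> active e z} \<longrightarrow> z \<in> {z. Q1 L z} \<union> {z. Q2 L (tshift ?n z)}"
        using AE_stable
      proof (rule AE_mp, intro AE_I2 impI)
        fix z assume st: "stable z" and "z \<in> {z. \<theta> ^ L < V z L \<and> active e z}"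
        then have z: "\<theta> ^ L < V z L" "active e z" by auto
        have "Q2 L (tshift ?n z)" if "\<not> Q1 L z"
        proof -
          have y0: "0 \<le> y (tshift ?n z)" unfolding ysh[symmetric]
            using vol2_ge[OF st] a0 by (intro state_nonneg) (meson less_imp_le order_trans)
          have "\<rho> ^ block_count K L z = \<rho> powr real (block_count K L z)" using \<rho> by (simp add: powr_realpow)
          also have "\<dots> \<le> \<rho> powr (real L / 4)" using that \<rho> unfolding Q1_def by (intro powr_mono') auto
          also have "\<dots> = \<theta> powr real (2 * L)" using \<rho> by (simp add: \<theta>_def powr_powr)
          also have "\<dots> = \<theta> ^ L * \<theta> ^ L" using \<theta> by (subst powr_realpow) (auto simp: power_add mult_2)
          finally have p: "\<rho> ^ block_count K L z \<le> \<theta> ^ L * \<theta> ^ L" .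
          have "V z L = c * (e * a0 * state z (ext (vhom z)) ?n)" using e a0 by (simp add: V_def c_def)
          also have "\<dots> \<le> c * (\<rho> ^ block_count K L z * y (tshift ?n z))"
            using hom_state_le[OF st _ e(2) z(2) K(1), of L] e a0 unfolding \<rho>_def ysh by (intro mult_left_mono) (auto simp: c_def)
          also have "\<dots> \<le> c * (\<theta> ^ L * \<theta> ^ L * y (tshift ?n z))"
            using p y0 e a0 by (intro mult_left_mono mult_right_mono) (auto simp: c_def)
          finally have "\<theta> ^ L * 1 < \<theta> ^ L * (c * \<theta> ^ L * y (tshift ?n z))" using z by (simp add: mult_ac)
          then show ?thesis unfolding Q2_def using \<theta> by (subst (asm) mult_less_cancel_left_pos) auto
        qed
        then show "z \<in> {z. Q1 L z} \<union> {z. Q2 L (tshift ?n z)}" by blast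
      qed
    qed (use sets in auto)
    also have "\<dots> \<le> P.prob {z. Q1 L z} + P.prob {z. Q2 L (tshift ?n z)}" using sets by (intro measure_Un_le)
    also have "P.prob {z. Q2 L (tshift ?n z)} = P.prob {z. Q2 L z}" by (rule prob_tshift) simp
    finally show ?thesis .
  qed
  have "(\<lambda>L. (P.prob {z. Q1 L z} + P.prob {z. Q2 L z}) / P.prob {z. active e z}) \<longlonglongrightarrow> (0 + 0) / P.prob {z. active e z}"
    using e by (intro tendsto_intros l1 l2) auto
  then have "(\<lambda>L. P.prob {z. \<theta> ^ L < V z L}) \<longlonglongrightarrow> 0"
    using key e by (intro tendsto_sandwich[OF _ _ tendsto_const, of 0 "\<lambda>L. P.prob {z. \<theta> ^ L < V z L}" sequentially "\<lambda>L. (P.prob {z. Q1 L z} + P.prob {z. Q2 L z}) / P.prob {z. active e z}"])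
      (auto simp: pos_le_divide_eq)
  then show ?thesis using \<theta> unfolding V_def by blast
qed

lemma vhom_src_le: "(\<Sum>j=1..d. if j \<le> k then 0 else A j + B j) \<le> Lam"
proof -
  have "(\<Sum>j=1..d. if j \<le> k then 0 else A j + B j) \<le> (\<Sum>j=1..d. 8 * (A j + B j))"
  proof (rule sum_mono)
    fix j show "(if j \<le> k then 0 else A j + B j) \<le> 8 * (A j + B j)" using A[of j] B[of j] by auto
  qed
  then show ?thesis unfolding Lam_def by simp
qed

text \<open>The exponent \<open>1 / n\<close> is chosen so that exponential growth \<open>H\<^sup>n\<close> only costs a constant factor \<open>H\<close>.\<close>
lemma hom_state_moment:
  "\<exists>n s. d \<le> n \<and> 0 < s \<and> s \<le> 1 \<and> (\<integral>\<^sup>+z. ennreal ((4 * state z (ext (vhom z)) (int n)) powr s) \<partial>P) < 1"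
proof -
  obtain \<theta> where \<theta>: "0 < \<theta>" "\<theta> < 1" and lim: "(\<lambda>L. P.prob {z. \<theta> ^ L < 4 * state z (ext (vhom z)) (int (Suc L * d))}) \<longlonglongrightarrow> 0"
    using hom_state_exponential by blast
  define V where "V z L = 4 * state z (ext (vhom z)) (int (Suc L * d))" for z L
  have [measurable]: "(\<lambda>z. V z L) \<in> borel_measurable P" for L unfolding V_def by measurable
  have V0: "0 \<le> V z L" for z L unfolding V_def by (auto intro!: state_nonneg simp: ext_def vhom_nonneg)
  \<comment> \<open>The exponent is \<open>1 / n\<close> with \<open>n = (L + 1) * d\<close>, and
    \<open>L / n >= 1 / (2 * d)\<close> for \<open>L >= 1\<close>; so the decay rate survives as a
    constant below 1 that does not depend on L.\<close>
  define \<kappa> where "\<kappa> = \<theta> powr (1 / (2 * real d))"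
  have \<kappa>: "0 < \<kappa>" "\<kappa> < 1" using \<theta> d powr_less_mono2[of "1 / (2 * real d)" \<theta> 1] by (auto simp: \<kappa>_def)
  \<comment> \<open>Twice the mean growth rate, so that a mean of order \<open>Lam ^ n\<close>
    divided by \<open>H ^ n\<close> is of order \<open>2 ^ (-n)\<close>.\<close>
  define H where "H = 2 * Lam"
  have H: "H > 1" using Lam_ge_1 by (simp add: H_def)
  define c where "c = 8 * real d * Lam"
  have c: "0 \<le> c" unfolding c_def using Lam_ge_1 by simp
  have EV: "(\<integral>\<^sup>+z. ennreal (V z L) \<partial>P) \<le> ennreal (c * Lam ^ (Suc L * d))" for L
  proof -
    have "(\<integral>\<^sup>+z. ennreal (V z L) \<partial>P) = (\<integral>\<^sup>+z. ennreal 4 * ennreal (state z (ext (vhom z)) (int (Suc L * d))) \<partial>P)"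
      unfolding V_def by (intro nn_integral_cong) (subst ennreal_mult[symmetric], auto intro!: state_nonneg simp: ext_def vhom_nonneg)
    also have "\<dots> = ennreal 4 * (\<integral>\<^sup>+z. ennreal (state z (ext (vhom z)) (int (Suc L * d))) \<partial>P)"
      by (rule nn_integral_cmult) measurable
    also have "\<dots> \<le> ennreal 4 * ennreal (2 * real d * Lam * Lam ^ (Suc L * d))"
      unfolding vhom_def by (intro mult_left_mono nn_integral_state_le vhom_src_le sum_nonneg) (use A B in auto)
    also have "\<dots> = ennreal (c * Lam ^ (Suc L * d))" unfolding c_def using Lam_ge_1 by (subst ennreal_mult[symmetric]) (auto simp: mult_ac)
    finally show ?thesis .
  qed
  have bound: "(\<integral>\<^sup>+z. ennreal (V z L powr (1 / real (Suc L * d))) \<partial>P)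
      \<le> ennreal (\<kappa> + H * (P.prob {z. \<theta> ^ L < V z L} + c * (1 / 2) ^ (Suc L * d)))" if L: "L \<ge> 1" for L
  proof -
    define n where "n = Suc L * d"
    define s where "s = 1 / real n"
    have n: "n \<ge> 1" using d by (simp add: n_def)
    have s: "0 < s" "s \<le> 1" using n by (auto simp: s_def)
    have m: "{z. \<theta> ^ L < V z L} \<in> sets P" by (intro pred_sets) measurable
    \<comment> \<open>Off the exceptional event V is at most \<open>\<theta> ^ L\<close>. On it,
      rescale V by \<open>H ^ n\<close>, whose s-th power is just H, and use
      \<open>x powr s <= 1 + x\<close>.\<close>
    have pt: "V z L powr s \<le> \<kappa> + H * (indicator {z. \<theta> ^ L < V z L} z + V z L / H ^ n)" for z
    proof (cases "\<theta> ^ L < V z L")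
      case False
      have "V z L powr s \<le> (\<theta> ^ L) powr s" using False V0 s by (intro powr_mono2) auto
      also have "\<dots> = \<theta> powr (real L / real n)" using \<theta> by (simp add: powr_realpow[symmetric] powr_powr s_def)
      also have "\<theta> powr (real L / real n) \<le> \<kappa>" unfolding \<kappa>_def
      proof (rule powr_mono')
        have "real n \<le> 2 * real L * real d" using mult_right_mono[of 1 "real L" "real d"] L unfolding n_def by (simp add: algebra_simps)
        then have "real L / (2 * real L * real d) \<le> real L / real n" using n by (intro divide_left_mono) auto
        then show "1 / (2 * real d) \<le> real L / real n" using L by (simp add: field_simps)
      qed (use \<theta> in auto)
      finally have "V z L powr s \<le> \<kappa>" .
      moreover have "0 \<le> H * (V z L / H ^ n)" using V0[of z L] H by simp
      ultimately show ?thesis using False by simp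
    next
      case True
      have "V z L powr s = (H ^ n * (V z L / H ^ n)) powr s" using H by simp
      also have "\<dots> = H * (V z L / H ^ n) powr s"
        using H n V0[of z L] by (subst powr_mult) (auto simp: powr_realpow[symmetric] powr_powr s_def)
      also have "(V z L / H ^ n) powr s \<le> 1 + V z L / H ^ n"
      proof (cases "V z L / H ^ n \<le> 1")
        case True
        then have "(V z L / H ^ n) powr s \<le> 1" using V0 H s by (intro powr_le1) auto
        then show ?thesis using V0[of z L] H by (simp add: add_increasing2)
      next
        case False
        then have "(V z L / H ^ n) powr s \<le> (V z L / H ^ n) powr 1" using s by (intro powr_mono) auto
        then show ?thesis using False by simp
      qed
      finally have "V z L powr s \<le> H * (1 + V z L / H ^ n)" using H by simp
      then show ?thesis using True \<kappa> by simp
    qed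
    have "(\<integral>\<^sup>+z. ennreal (V z L powr s) \<partial>P) \<le> (\<integral>\<^sup>+z. ennreal \<kappa> + ennreal H * (indicator {z. \<theta> ^ L < V z L} z + ennreal (1 / H ^ n) * ennreal (V z L)) \<partial>P)"
    proof (rule nn_integral_mono)
      fix z
      have "ennreal (V z L powr s) \<le> ennreal (\<kappa> + H * (indicator {z. \<theta> ^ L < V z L} z + V z L / H ^ n))"
        using pt by (rule ennreal_leI)
      also have "\<dots> = ennreal \<kappa> + ennreal H * (ennreal (indicator {z. \<theta> ^ L < V z L} z) + ennreal (1 / H ^ n) * ennreal (V z L))"
        using \<kappa> H V0[of z L] by (simp add: ennreal_plus[symmetric] ennreal_mult[symmetric] del: ennreal_plus)
      finally show "ennreal (V z L powr s) \<le> ennreal \<kappa> + ennreal H * (indicator {z. \<theta> ^ L < V z L} z + ennreal (1 / H ^ n) * ennreal (V z L))"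
        by (simp add: ennreal_indicator)
    qed
    also have "\<dots> = ennreal \<kappa> + ennreal H * (emeasure P {z. \<theta> ^ L < V z L} + ennreal (1 / H ^ n) * (\<integral>\<^sup>+z. ennreal (V z L) \<partial>P))"
      using m P.emeasure_space_1 by (simp add: nn_integral_add nn_integral_cmult)
    also have "\<dots> \<le> ennreal \<kappa> + ennreal H * (emeasure P {z. \<theta> ^ L < V z L} + ennreal (1 / H ^ n) * ennreal (c * Lam ^ n))"
      using EV[of L] unfolding n_def by (intro add_left_mono mult_left_mono) auto
    also have "\<dots> = ennreal (\<kappa> + H * (P.prob {z. \<theta> ^ L < V z L} + (1 / H ^ n) * (c * Lam ^ n)))"
      using \<kappa> H c Lam_ge_1 by (simp add: P.emeasure_eq_measure ennreal_plus[symmetric] ennreal_mult[symmetric] del: ennreal_plus)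
    also have "(1 / H ^ n) * (c * Lam ^ n) = c * (1 / 2) ^ n" using Lam_ge_1 by (simp add: H_def power_mult_distrib power_divide)
    finally show ?thesis unfolding n_def s_def .
  qed
  have "(\<lambda>L. (1 / 2 :: real) ^ (Suc L * d)) \<longlonglongrightarrow> 0"
  proof -
    have "strict_mono (\<lambda>L. Suc L * d)" using d by (simp add: strict_mono_Suc_iff)
    moreover have "(\<lambda>n. (1 / 2 :: real) ^ n) \<longlonglongrightarrow> 0" by (rule LIMSEQ_realpow_zero) auto
    ultimately show ?thesis using LIMSEQ_subseq_LIMSEQ[of "\<lambda>n. (1 / 2 :: real) ^ n" 0 "\<lambda>L. Suc L * d"] by (simp only: o_def)
  qed
  then have "(\<lambda>L. \<kappa> + H * (P.prob {z. \<theta> ^ L < V z L} + c * (1 / 2) ^ (Suc L * d))) \<longlonglongrightarrow> \<kappa> + H * (0 + c * 0)"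
    using lim unfolding V_def by (intro tendsto_add tendsto_mult tendsto_const)
  then have "eventually (\<lambda>L. \<kappa> + H * (P.prob {z. \<theta> ^ L < V z L} + c * (1 / 2) ^ (Suc L * d)) < 1) sequentially"
    by (rule order_tendstoD(2)) (use \<kappa> in simp)
  then have "eventually (\<lambda>L. L \<ge> 1 \<and> \<kappa> + H * (P.prob {z. \<theta> ^ L < V z L} + c * (1 / 2) ^ (Suc L * d)) < 1) sequentially"
    using eventually_ge_at_top[of "1 :: nat"] by eventually_elim simp
  then obtain L where L: "L \<ge> 1" "\<kappa> + H * (P.prob {z. \<theta> ^ L < V z L} + c * (1 / 2) ^ (Suc L * d)) < 1"
    using eventually_happens'[OF sequentially_bot] by blast
  have "(\<integral>\<^sup>+z. ennreal (V z L powr (1 / real (Suc L * d))) \<partial>P) < 1"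
    using order.strict_trans1[OF bound[OF L(1)]] L(2) by (simp add: ennreal_less_one_iff)
  moreover have "1 \<le> Suc L * d" using d by simp
  then have "1 \<le> real (Suc L * d)" by linarith
  then have "0 < 1 / real (Suc L * d)" "1 / real (Suc L * d) \<le> 1" by (auto simp del: of_nat_mult mult_Suc)
  moreover have "d \<le> Suc L * d" by simp
  ultimately show ?thesis unfolding V_def by blast
qed


section \<open>From the homogeneous factor to a moment of the volatility\<close>

definition start_state :: "(int \<Rightarrow> real) \<Rightarrow> nat \<Rightarrow> real" where
  "start_state z m = state z (ext (vstart z)) (int m)"

lemma measurable_start_state [measurable]: "(\<lambda>z. start_state z m) \<in> borel_measurable P"
  unfolding start_state_def by measurable

lemma start_state_nonneg: "0 \<le> start_state z m"
  unfolding start_state_def by (intro state_nonneg ext_vstart_nonneg)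

lemma nn_integral_start_state_finite: "(\<integral>\<^sup>+z. ennreal (start_state z m) \<partial>P) < \<infinity>"
proof -
  have "(\<integral>\<^sup>+z. ennreal (start_state z m) \<partial>P) \<le> ennreal (2 * real d * a0 * Lam ^ m)"
    unfolding start_state_def vstart_def by (intro nn_integral_state_le) (use a0 in auto)
  then show ?thesis by (rule order.strict_trans1) simp
qed

lemma depends_start_state: "depends_on (\<lambda>z. start_state z m) {0..<int m}"
  unfolding depends_on_def start_state_def state_def
proof (intro allI impI sum.cong refl)
  fix z z' :: "int \<Rightarrow> real" and i assume zz: "\<forall>i\<in>{0..<int m}. z i = z' i" and i: "i \<in> {1..d}"
  show "(1 + (z (int m - int i))\<^sup>2) * ext (vstart z) (int m - int i) = (1 + (z' (int m - int i))\<^sup>2) * ext (vstart z') (int m - int i)"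
  proof (cases "i \<le> m")
    case True
    have "\<forall>i\<in>{0..<int (m - i)}. z i = z' i" using zz by auto
    then have "vstart z (m - i) = vstart z' (m - i)" using depends_vstart[of "m - i"] unfolding depends_on_def by blast
    moreover have "z (int m - int i) = z' (int m - int i)" using zz i True by auto
    ultimately show ?thesis using True by (simp add: ext_def nat_diff_distrib')
  qed (simp add: ext_def)
qed

text \<open>A random affine recursion in steps of length n. The multiplier and the additive term use
  innovations from m on, hence are independent of \<open>start_state z m\<close>; the additive term
  is a fresh start at m.\<close>

lemma start_state_add_le:
  assumes "d \<le> n"
  shows "start_state z (m + n) \<le> 4 * state (tshift (int m) z) (ext (vhom (tshift (int m) z))) (int n) * start_state z m
    + start_state (tshift (int m) z) n"
proof -
  let ?z = "tshift (int m) z"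
  have "start_state z (m + n) \<le> (\<Sum>i=1..d. 4 * start_state z m * ((1 + (?z (int n - int i))\<^sup>2) * ext (vhom ?z) (int n - int i))
      + (1 + (?z (int n - int i))\<^sup>2) * ext (vstart ?z) (int n - int i))"
    unfolding start_state_def[of z "m + n"] state_def
  proof (rule sum_mono)
    fix i assume i: "i \<in> {1..d}"
    then have e: "int (m + n) - int i = int m + int (n - i)" "int n - int i = int (n - i)" using assms by auto
    have u: "ext (vstart z) (int m + int k) = a0 + (\<Sum>j=1..d. cf z j (int m + int k - int j) * ext (vstart z) (int m + int k - int j))" for k
      using ext_vstart_rec[of z "m + k"] by simp
    have "ext (vstart z) (int m + int (n - i)) \<le> vstart ?z (n - i) + 4 * start_state z m * vhom ?z (n - i)"
      unfolding start_state_def by (rule solution_le_hom[OF u ext_vstart_nonneg])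
    then have "(1 + (z (int m + int (n - i)))\<^sup>2) * ext (vstart z) (int m + int (n - i))
      \<le> (1 + (z (int m + int (n - i)))\<^sup>2) * (vstart ?z (n - i) + 4 * start_state z m * vhom ?z (n - i))"
      by (intro mult_left_mono) auto
    then show "(1 + (z (int (m + n) - int i))\<^sup>2) * ext (vstart z) (int (m + n) - int i) \<le>
      4 * start_state z m * ((1 + (?z (int n - int i))\<^sup>2) * ext (vhom ?z) (int n - int i))
      + (1 + (?z (int n - int i))\<^sup>2) * ext (vstart ?z) (int n - int i)"
      unfolding e by (simp add: ext_def add.commute distrib_left mult_ac)
  qed
  then show ?thesis unfolding start_state_def[of ?z] state_def
    by (simp only: sum.distrib sum_distrib_left[symmetric]) (simp add: mult_ac)
qed

text \<open>The s-th moments satisfy \<open>a (m + n) <= \<rho> * a m + a n\<close> with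
  \<open>\<rho> < 1\<close>, so along multiples of n they stay below the fixed point
  \<open>b / (1 - r)\<close>. By stationarity the bound also holds for starts at receding times, and
  Fatou's lemma passes it to the volatility.\<close>

lemma vol2_state_moment:
  "\<exists>s. 0 < s \<and> s \<le> 1 \<and> (\<integral>\<^sup>+z. ennreal (state z (vol2 z) 0 powr s) \<partial>P) < \<infinity>"
proof -
  obtain n s where n: "d \<le> n" and s: "0 < s" "s \<le> 1"
    and lt: "(\<integral>\<^sup>+z. ennreal ((4 * state z (ext (vhom z)) (int n)) powr s) \<partial>P) < 1"
    using hom_state_moment by blast
  define V where "V z = 4 * state z (ext (vhom z)) (int n)" for z
  have [measurable]: "V \<in> borel_measurable P" unfolding V_def by measurable
  have V0: "0 \<le> V z" for z unfolding V_def by (auto intro!: state_nonneg simp: ext_def vhom_nonneg)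
  define a where "a m = (\<integral>\<^sup>+z. ennreal (start_state z m powr s) \<partial>P)" for m
  have afin: "a m < \<infinity>" for m
  proof -
    have "a m \<le> (\<integral>\<^sup>+z. 1 + ennreal (start_state z m) \<partial>P)" unfolding a_def
    proof (rule nn_integral_mono)
      fix z
      have "start_state z m powr s \<le> 1 + start_state z m"
      proof (cases "start_state z m \<le> 1")
        case True
        then have "start_state z m powr s \<le> 1" using s start_state_nonneg by (intro powr_le1) auto
        then show ?thesis using start_state_nonneg[of z m] by linarith
      next
        case False
        then have "start_state z m powr s \<le> start_state z m powr 1" using s by (intro powr_mono) auto
        then show ?thesis using False by simp
      qed
      then have "ennreal (start_state z m powr s) \<le> ennreal (1 + start_state z m)" by (rule ennreal_leI)
      then show "ennreal (start_state z m powr s) \<le> 1 + ennreal (start_state z m)"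
        using start_state_nonneg by (simp add: ennreal_plus)
    qed
    also have "\<dots> = 1 + (\<integral>\<^sup>+z. ennreal (start_state z m) \<partial>P)"
      using P.emeasure_space_1 by (simp add: nn_integral_add)
    also have "\<dots> < \<infinity>" using nn_integral_start_state_finite[of m] by (simp add: less_top)
    finally show ?thesis .
  qed
  define \<rho> where "\<rho> = (\<integral>\<^sup>+z. ennreal (V z powr s) \<partial>P)"
  have rec: "a (m + n) \<le> \<rho> * a m + a n" for m
  proof -
    let ?z = "\<lambda>z. tshift (int m) z"
    have "a (m + n) \<le> (\<integral>\<^sup>+z. ennreal (V (?z z) powr s) * ennreal (start_state z m powr s) + ennreal (start_state (?z z) n powr s) \<partial>P)"
      unfolding a_def
    proof (rule nn_integral_mono)
      fix z
      have "start_state z (m + n) powr s \<le> (V (?z z) * start_state z m + start_state (?z z) n) powr s"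
        using start_state_add_le[OF n, of z m] s start_state_nonneg unfolding V_def by (intro powr_mono2) auto
      also have "\<dots> \<le> (V (?z z) * start_state z m) powr s + start_state (?z z) n powr s"
        using s V0 start_state_nonneg by (intro powr_add_le) auto
      also have "(V (?z z) * start_state z m) powr s = V (?z z) powr s * start_state z m powr s"
        using V0 start_state_nonneg by (simp add: powr_mult)
      finally have "ennreal (start_state z (m + n) powr s) \<le> ennreal (V (?z z) powr s * start_state z m powr s + start_state (?z z) n powr s)"
        by (rule ennreal_leI)
      then show "ennreal (start_state z (m + n) powr s) \<le> ennreal (V (?z z) powr s) * ennreal (start_state z m powr s) + ennreal (start_state (?z z) n powr s)"
        by (simp add: ennreal_plus ennreal_mult)
    qed
    also have "\<dots> = (\<integral>\<^sup>+z. ennreal (V (?z z) powr s) * ennreal (start_state z m powr s) \<partial>P) + (\<integral>\<^sup>+z. ennreal (start_state (?z z) n powr s) \<partial>P)"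
      by (rule nn_integral_add) measurable
    also have "(\<integral>\<^sup>+z. ennreal (start_state (?z z) n powr s) \<partial>P) = a n"
      unfolding a_def by (rule nn_integral_tshift[of "\<lambda>z. ennreal (start_state z n powr s)"]) measurable
    also have "(\<integral>\<^sup>+z. ennreal (V (?z z) powr s) * ennreal (start_state z m powr s) \<partial>P) = (\<integral>\<^sup>+z. ennreal (V (?z z) powr s) \<partial>P) * a m"
      unfolding a_def
    proof (rule nn_integral_mult_indep)
      show "depends_on (\<lambda>z. ennreal (start_state z m powr s)) {0..<int m}"
        by (rule depends_comp[OF depends_start_state])
      show "depends_on (\<lambda>z. ennreal (V (?z z) powr s)) {int m..<int m + int n}"
        unfolding depends_on_def
      proof (intro allI impI)
        fix z z' :: "int \<Rightarrow> real" assume "\<forall>i\<in>{int m..<int m + int n}. z i = z' i"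
        then have "\<forall>i\<in>{0..<int n}. ?z z i = ?z z' i" by auto
        then have "state (?z z) (ext (vhom (?z z))) (int n) = state (?z z') (ext (vhom (?z z'))) (int n)"
          using depends_hom_state[OF n] unfolding depends_on_def by blast
        then show "ennreal (V (?z z) powr s) = ennreal (V (?z z') powr s)" unfolding V_def by simp
      qed
    qed auto
    also have "(\<integral>\<^sup>+z. ennreal (V (?z z) powr s) \<partial>P) = \<rho>"
      unfolding \<rho>_def by (rule nn_integral_tshift[of "\<lambda>z. ennreal (V z powr s)"]) measurable
    finally show ?thesis .
  qed
  have \<rho>: "\<rho> < 1" using lt unfolding \<rho>_def V_def .
  obtain r where r: "\<rho> = ennreal r" "0 \<le> r" "r < 1"
    using \<rho> by (cases \<rho>) (auto simp: ennreal_less_one_iff)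
  define b where "b = enn2real (a n)"
  have b: "a n = ennreal b" "0 \<le> b" using afin[of n] unfolding b_def by (auto simp: less_top[symmetric])
  have al: "a (l * n) \<le> ennreal (b / (1 - r))" for l
  proof (induction l)
    case 0
    have "start_state z 0 = 0" for z unfolding start_state_def state_def ext_def by (auto intro!: sum.neutral)
    then show ?case unfolding a_def by simp
  next
    case (Suc l)
    have "a (Suc l * n) \<le> \<rho> * a (l * n) + a n" using rec[of "l * n"] by (simp add: add.commute)
    also have "\<dots> \<le> ennreal r * ennreal (b / (1 - r)) + ennreal b"
      unfolding r(1)[symmetric] b(1)[symmetric] using Suc by (intro add_right_mono mult_left_mono) auto
    also have "\<dots> = ennreal (r * (b / (1 - r)) + b)" using r b by (simp add: ennreal_mult[symmetric] ennreal_plus[symmetric] del: ennreal_plus)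
    also have "r * (b / (1 - r)) + b = b / (1 - r)" using r by (simp add: field_simps)
    finally show ?case .
  qed
  have "(\<integral>\<^sup>+z. ennreal (state z (vol2 z) 0 powr s) \<partial>P)
    \<le> (\<integral>\<^sup>+z. liminf (\<lambda>l. ennreal (start_state (tshift (- int (l * n)) z) (l * n) powr s)) \<partial>P)"
  proof (rule nn_integral_mono_AE)
    show "AE z in P. ennreal (state z (vol2 z) 0 powr s) \<le> liminf (\<lambda>l. ennreal (start_state (tshift (- int (l * n)) z) (l * n) powr s))"
      using AE_stable
    proof (rule AE_mp, intro AE_I2 impI)
      fix z assume st: "stable z"
      have t1: "(\<lambda>m. ext (vstart (tshift (- int m) z)) (int m - int i)) \<longlonglongrightarrow> vol2 z (- int i)" for i
      proof -
        have "(\<lambda>m. vstep z (- int i) (m - i)) \<longlonglongrightarrow> vol2 z (- int i)"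
          by (rule filterlim_compose[OF vstep_tendsto[OF st] filterlim_minus_const_nat_at_top])
        moreover have "eventually (\<lambda>m. vstep z (- int i) (m - i) = ext (vstart (tshift (- int m) z)) (int m - int i)) sequentially"
          using eventually_ge_at_top[of i]
          by eventually_elim (simp add: vstep_def ext_def of_nat_diff nat_diff_distrib')
        ultimately show ?thesis by (rule Lim_transform_eventually)
      qed
      have t2: "(\<lambda>m. start_state (tshift (- int m) z) m) \<longlonglongrightarrow> state z (vol2 z) 0"
        unfolding start_state_def state_def using t1 by (auto intro!: tendsto_intros)
      have "strict_mono (\<lambda>l. l * n)" using d n by (simp add: strict_mono_Suc_iff)
      then have t3: "(\<lambda>l. start_state (tshift (- int (l * n)) z) (l * n)) \<longlonglongrightarrow> state z (vol2 z) 0"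
        using LIMSEQ_subseq_LIMSEQ[OF t2] by (simp only: o_def)
      have "0 < state z (vol2 z) 0"
      proof -
        have vp: "0 < vol2 z t" for t using vol2_ge[OF st, of t] a0 by linarith
        show ?thesis unfolding state_def using d vp by (intro sum_pos mult_pos_pos) (auto intro: add_pos_nonneg)
      qed
      then have lim: "(\<lambda>l. ennreal (start_state (tshift (- int (l * n)) z) (l * n) powr s)) \<longlonglongrightarrow> ennreal (state z (vol2 z) 0 powr s)"
        using t3 by (intro tendsto_ennrealI tendsto_powr) auto
      show "ennreal (state z (vol2 z) 0 powr s) \<le> liminf (\<lambda>l. ennreal (start_state (tshift (- int (l * n)) z) (l * n) powr s))"
        by (rule eq_refl[OF lim_imp_Liminf[OF sequentially_bot lim, symmetric]])
    qed
  qed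
  also have "\<dots> \<le> liminf (\<lambda>l. \<integral>\<^sup>+z. ennreal (start_state (tshift (- int (l * n)) z) (l * n) powr s) \<partial>P)"
    by (rule nn_integral_liminf) measurable
  also have "\<dots> \<le> liminf (\<lambda>l. ennreal (b / (1 - r)))"
  proof (rule Liminf_mono, rule always_eventually, rule allI)
    fix l
    have "(\<integral>\<^sup>+z. ennreal (start_state (tshift (- int (l * n)) z) (l * n) powr s) \<partial>P) = a (l * n)"
      unfolding a_def by (rule nn_integral_tshift[of "\<lambda>z. ennreal (start_state z (l * n) powr s)"]) measurable
    then show "(\<integral>\<^sup>+z. ennreal (start_state (tshift (- int (l * n)) z) (l * n) powr s) \<partial>P) \<le> ennreal (b / (1 - r))"
      using al[of l] by simp
  qed
  also have "\<dots> < \<infinity>" by (simp add: Liminf_const)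
  finally show ?thesis using s by blast
qed

lemma vol2_moment:
  "\<exists>s. 0 < s \<and> s \<le> 1 \<and> (\<integral>\<^sup>+z. ennreal (((1 + (z 0)\<^sup>2) * vol2 z 0) powr s) \<partial>P) < \<infinity>"
proof -
  obtain s where s: "0 < s" "s \<le> 1" and fin: "(\<integral>\<^sup>+z. ennreal (state z (vol2 z) 0 powr s) \<partial>P) < \<infinity>"
    using vol2_state_moment by blast
  have "(\<integral>\<^sup>+z. ennreal (((1 + (z 0)\<^sup>2) * vol2 z 0) powr s) \<partial>P) = (\<integral>\<^sup>+z. ennreal (((1 + (z (-1))\<^sup>2) * vol2 z (-1)) powr s) \<partial>P)"
    using nn_integral_tshift[of "\<lambda>z. ennreal (((1 + (z 0)\<^sup>2) * vol2 z 0) powr s)" "-1"] by (simp add: vol2_tshift)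
  also have "\<dots> \<le> (\<integral>\<^sup>+z. ennreal (state z (vol2 z) 0 powr s) \<partial>P)"
  proof (rule nn_integral_mono_AE)
    show "AE z in P. ennreal (((1 + (z (-1))\<^sup>2) * vol2 z (-1)) powr s) \<le> ennreal (state z (vol2 z) 0 powr s)"
      using AE_stable
    proof (rule AE_mp, intro AE_I2 impI)
      fix z assume st: "stable z"
      have vp: "0 \<le> vol2 z t" for t using vol2_ge[OF st, of t] a0 by linarith
      have "(1 + (z (0 - int 1))\<^sup>2) * vol2 z (0 - int 1) \<le> state z (vol2 z) 0"
        unfolding state_def using d vp by (intro member_le_sum) auto
      then show "ennreal (((1 + (z (-1))\<^sup>2) * vol2 z (-1)) powr s) \<le> ennreal (state z (vol2 z) 0 powr s)"
        using s vp by (intro ennreal_leI powr_mono2) auto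
    qed
  qed
  finally show ?thesis using s fin by (auto intro: order.strict_trans1)
qed

text \<open>A stationary sequence with a fractional moment grows subexponentially in both directions of time.\<close>
lemma AE_subexponential:
  "AE z in P. \<forall>\<rho>. 0 < \<rho> \<longrightarrow> \<rho> < 1 \<longrightarrow> (\<forall>t. summable (\<lambda>k. \<rho> ^ k * ((1 + (z (t - int k))\<^sup>2) * vol2 z (t - int k))) \<and>
     summable (\<lambda>k. \<rho> ^ k * ((1 + (z (int k))\<^sup>2) * vol2 z (int k))))"
proof -
  obtain s where s: "0 < s" "s \<le> 1" and fin: "(\<integral>\<^sup>+z. ennreal (((1 + (z 0)\<^sup>2) * vol2 z 0) powr s) \<partial>P) < \<infinity>"
    using vol2_moment by blast
  define w where "w z t = (1 + (z t)\<^sup>2) * vol2 z t" for z :: "int \<Rightarrow> real" and t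
  have [measurable]: "(\<lambda>z. w z t) \<in> borel_measurable P" for t unfolding w_def by measurable
  have I: "(\<integral>\<^sup>+z. ennreal (w z t powr s) \<partial>P) = (\<integral>\<^sup>+z. ennreal (w z 0 powr s) \<partial>P)" for t
    using nn_integral_tshift[of "\<lambda>z. ennreal (w z 0 powr s)" t] by (simp add: w_def vol2_tshift)
  have one: "AE z in P. summable (\<lambda>k. r ^ k * w z (f k) powr s)" if "0 < r" "r < 1" for r and f :: "nat \<Rightarrow> int"
  proof -
    have "(\<integral>\<^sup>+z. (\<Sum>k. ennreal (r ^ k * w z (f k) powr s)) \<partial>P) = (\<Sum>k. \<integral>\<^sup>+z. ennreal (r ^ k * w z (f k) powr s) \<partial>P)"
      by (rule nn_integral_suminf) measurable
    also have "\<dots> = (\<Sum>k. ennreal (r ^ k) * (\<integral>\<^sup>+z. ennreal (w z 0 powr s) \<partial>P))"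
    proof (rule suminf_cong)
      fix k
      have "(\<integral>\<^sup>+z. ennreal (r ^ k * w z (f k) powr s) \<partial>P) = (\<integral>\<^sup>+z. ennreal (r ^ k) * ennreal (w z (f k) powr s) \<partial>P)"
        using that by (simp add: ennreal_mult)
      also have "\<dots> = ennreal (r ^ k) * (\<integral>\<^sup>+z. ennreal (w z (f k) powr s) \<partial>P)"
        by (rule nn_integral_cmult) measurable
      finally show "(\<integral>\<^sup>+z. ennreal (r ^ k * w z (f k) powr s) \<partial>P) = ennreal (r ^ k) * (\<integral>\<^sup>+z. ennreal (w z 0 powr s) \<partial>P)"
        unfolding I[of "f k"] .
    qed
    also have "\<dots> = ennreal (\<Sum>k. r ^ k) * (\<integral>\<^sup>+z. ennreal (w z 0 powr s) \<partial>P)"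
      by (subst ennreal_suminf_multc, subst suminf_ennreal2) (use that in \<open>auto intro: summable_geometric\<close>)
    also have "\<dots> < \<infinity>" using fin by (simp add: w_def ennreal_mult_less_top)
    finally have "AE z in P. (\<Sum>k. ennreal (r ^ k * w z (f k) powr s)) \<noteq> \<infinity>"
      by (intro nn_integral_PInf_AE) auto
    then show ?thesis
      by eventually_elim (use that in \<open>auto intro!: summable_suminf_not_top\<close>)
  qed
  \<comment> \<open>Rates increasing to 1 along a sequence: countably many null sets then serve all
    real rates.\<close>
  define r where "r n = 1 - 1 / real (n + 2)" for n
  have r: "0 < r n" "r n < 1" for n unfolding r_def by (auto simp: field_simps)
  have A1: "AE z in P. \<forall>n t. summable (\<lambda>k. r n ^ k * w z (t - int k) powr s)"
    unfolding AE_all_countable by (intro allI one r)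
  have A2: "AE z in P. \<forall>n. summable (\<lambda>k. r n ^ k * w z (int k) powr s)"
    unfolding AE_all_countable by (intro allI one r)
  have det: "summable (\<lambda>k. \<rho> ^ k * x k)" if x: "\<And>k. 0 \<le> x k" and sm: "\<And>n. summable (\<lambda>k. r n ^ k * x k powr s)"
    and \<rho>: "0 < \<rho>" "\<rho> < 1" for x :: "nat \<Rightarrow> real" and \<rho>
  proof -
    \<comment> \<open>Half of the decay is spent on making the terms bounded, the other half on
      summing them.\<close>
    define \<sigma> where "\<sigma> = sqrt \<rho>"
    have \<sigma>: "0 < \<sigma>" "\<sigma> < 1" "\<rho> = \<sigma> * \<sigma>" using \<rho> by (auto simp: \<sigma>_def)
    have ps: "\<sigma> powr s < 1" using \<sigma> s powr_less_mono2[of s \<sigma> 1] by simp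
    have "(\<lambda>n. r n) \<longlonglongrightarrow> 1 - 0" unfolding r_def
      by (intro tendsto_diff tendsto_const LIMSEQ_ignore_initial_segment[OF lim_1_over_n])
    then have "eventually (\<lambda>n. \<sigma> powr s < r n) sequentially" using ps by (intro order_tendstoD(1)) auto
    then obtain n where n: "\<sigma> powr s < r n" by (auto simp: eventually_sequentially)
    have "(\<lambda>k. r n ^ k * x k powr s) \<longlonglongrightarrow> 0" using sm by (rule summable_LIMSEQ_zero)
    then have ev: "eventually (\<lambda>k. r n ^ k * x k powr s < 1) sequentially" by (intro order_tendstoD(2)) auto
    have "eventually (\<lambda>k. norm (\<rho> ^ k * x k) \<le> \<sigma> ^ k) sequentially"
      using ev
    proof eventually_elim
      case (elim k)
      have "(\<sigma> ^ k * x k) powr s = (\<sigma> powr s) ^ k * x k powr s"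
        using \<sigma> x by (simp add: powr_mult powr_realpow[symmetric] powr_powr mult.commute)
      also have "\<dots> \<le> r n ^ k * x k powr s" using n by (intro mult_right_mono power_mono) auto
      finally have "(\<sigma> ^ k * x k) powr s < 1" using elim by linarith
      then have "\<sigma> ^ k * x k \<le> 1"
        using powr_mono2[of s 1 "\<sigma> ^ k * x k"] s by (cases "\<sigma> ^ k * x k \<le> 1") auto
      then have "\<sigma> ^ k * (\<sigma> ^ k * x k) \<le> \<sigma> ^ k * 1" using \<sigma> by (intro mult_left_mono) auto
      then show ?case using \<sigma> x[of k] by (simp add: power_mult_distrib mult.assoc)
    qed
    then show ?thesis by (rule summable_comparison_test_ev) (use \<sigma> in \<open>auto intro: summable_geometric\<close>)
  qed
  show ?thesis using A1 A2 AE_stable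
  proof eventually_elim
    case (elim z)
    have w0: "0 \<le> w z t" for t using vol2_ge[OF elim(3), of t] a0 unfolding w_def by simp
    show ?case unfolding w_def[symmetric]
    proof (intro allI impI)
      fix \<rho> :: real and t assume \<rho>: "0 < \<rho>" "\<rho> < 1"
      have "summable (\<lambda>k. \<rho> ^ k * w z (t - int k))" by (rule det[OF w0 _ \<rho>]) (use elim(1) in blast)
      moreover have "summable (\<lambda>k. \<rho> ^ k * w z (int k))" by (rule det[OF w0 _ \<rho>]) (use elim(2) in blast)
      ultimately show "summable (\<lambda>k. \<rho> ^ k * w z (t - int k)) \<and> summable (\<lambda>k. \<rho> ^ k * w z (int k))" ..
    qed
  qed
qed

end

section \<open>Linear filters with constant coefficients\<close>

text \<open>The power series coefficients of the reciprocal of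
  \<open>1 - b_1 z - ... - b_q z^q\<close>.\<close>

definition psi :: "nat \<Rightarrow> (nat \<Rightarrow> real) \<Rightarrow> nat \<Rightarrow> real" where
  "psi q b = lin_rec q (\<lambda>j t. b j) (\<lambda>k. if k = 0 then 1 else 0)"

lemma psi_rec: "psi q b l = (if l = 0 then 1 else 0) + (\<Sum>j=1..q. if j \<le> l then b j * psi q b (l - j) else 0)"
  unfolding psi_def by (subst lin_rec.simps) (rule refl)

lemma psi_0 [simp]: "psi q b 0 = 1"
  by (subst psi_rec) (auto intro!: sum.neutral)

lemma psi_nonneg: "(\<And>j. j \<in> {1..q} \<Longrightarrow> 0 \<le> b j) \<Longrightarrow> 0 \<le> psi q b l"
  unfolding psi_def by (rule lin_rec_nonneg) auto

lemma psi_mono: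
  assumes "\<And>j. j \<in> {1..q} \<Longrightarrow> 0 \<le> b j" "\<And>j. j \<in> {1..q} \<Longrightarrow> b j \<le> b' j"
  shows "psi q b l \<le> psi q b' l"
proof (induction l rule: less_induct)
  case (less l)
  have "b j * psi q b (l - j) \<le> b' j * psi q b' (l - j)" if "j \<in> {1..q}" "j \<le> l" for j
    using that less[of "l - j"] assms[of j] order_trans by (intro mult_mono psi_nonneg) (auto intro: assms)
  then show ?case by (subst psi_rec, subst (2) psi_rec) (auto intro!: sum_mono)
qed

lemma tendsto_psi:
  assumes "\<And>j. j \<in> {1..q} \<Longrightarrow> ((\<lambda>n. b n j) \<longlongrightarrow> b' j) F"
  shows "((\<lambda>n. psi q (b n) l) \<longlongrightarrow> psi q b' l) F"
proof (induction l rule: less_induct)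
  case (less l)
  have "((\<lambda>n. if j \<le> l then b n j * psi q (b n) (l - j) else 0) \<longlongrightarrow> (if j \<le> l then b' j * psi q b' (l - j) else 0)) F"
    if "j \<in> {1..q}" for j
    using less[of "l - j"] assms that by (auto intro!: tendsto_mult)
  then show ?case
    by (subst psi_rec, subst (2) psi_rec) (intro tendsto_add tendsto_const tendsto_sum)
qed

lemma exists_rate:
  assumes "(\<Sum>j=1..q. b j) < (1::real)" "q \<ge> 1"
  shows "\<exists>\<rho>. 0 < \<rho> \<and> \<rho> < 1 \<and> (\<Sum>j=1..q. b j) \<le> \<rho> ^ q"
proof -
  \<comment> \<open>The maximum with one half keeps the root positive when all coefficients
    vanish.\<close>
  define m where "m = max (1 / 2) (\<Sum>j=1..q. b j)"
  have m: "0 < m" "m < 1" using assms by (auto simp: m_def)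
  have "root q m ^ q = m" using assms m by (intro real_root_pow_pos2) auto
  moreover have "root q m < 1" using m assms by simp
  moreover have "0 < root q m" using m assms by simp
  ultimately show ?thesis by (intro exI[of _ "root q m"]) (auto simp: m_def)
qed

text \<open>A lag of at most q steps inflates the geometric bound by at most
  \<open>\<rho> ^ (-q)\<close>, and the coefficient sum, being at most \<open>\<rho> ^ q\<close>,
  pays for it. The positive part makes the lemma applicable to one-sided errors, as the envelopes
  require.\<close>

lemma filter_contraction:
  fixes E :: "int \<Rightarrow> real"
  assumes b: "\<And>j. j \<in> {1..q} \<Longrightarrow> 0 \<le> b j" and \<rho>: "0 < \<rho>" "\<rho> < 1" "(\<Sum>j=1..q. b j) \<le> \<rho> ^ q"
    and E: "\<And>k. k \<ge> 1 \<Longrightarrow> E (s + int k) \<le> (\<Sum>j=1..q. b j * max 0 (E (s + int k - int j)))"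
    and init: "\<And>i. i < q \<Longrightarrow> E (s - int i) \<le> C" and C: "0 \<le> C"
  shows "k \<ge> 1 \<Longrightarrow> E (s + int k) \<le> C * \<rho> ^ k"
proof (induction k rule: less_induct)
  case (less k)
  have bnd: "max 0 (E (s + int k - int j)) * \<rho> ^ q \<le> C * \<rho> ^ k" if j: "j \<in> {1..q}" for j
  proof (cases "j < k")
    case True
    then have "E (s + int k - int j) \<le> C * \<rho> ^ (k - j)" using less.IH[of "k - j"] j by (auto simp: of_nat_diff algebra_simps)
    then have "max 0 (E (s + int k - int j)) * \<rho> ^ q \<le> (C * \<rho> ^ (k - j)) * \<rho> ^ q"
      using C \<rho> by (intro mult_right_mono) auto
    also have "\<dots> = C * \<rho> ^ (k - j + q)" by (simp add: power_add)
    also have "\<dots> \<le> C * \<rho> ^ k" using C \<rho> j True by (intro mult_left_mono power_decreasing) auto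
    finally show ?thesis .
  next
    case False
    then have "E (s - int (j - k)) \<le> C" using j less.prems by (intro init) auto
    then have "E (s + int k - int j) \<le> C" using False by (simp add: of_nat_diff algebra_simps)
    then have "max 0 (E (s + int k - int j)) * \<rho> ^ q \<le> C * \<rho> ^ q" using C \<rho> by (intro mult_right_mono) auto
    also have "\<dots> \<le> C * \<rho> ^ k" using C \<rho> False j by (intro mult_left_mono power_decreasing) auto
    finally show ?thesis .
  qed
  have "E (s + int k) * \<rho> ^ q \<le> (\<Sum>j=1..q. b j * max 0 (E (s + int k - int j))) * \<rho> ^ q"
    using E[of k] less.prems \<rho> by (intro mult_right_mono) auto
  also have "\<dots> = (\<Sum>j=1..q. b j * (max 0 (E (s + int k - int j)) * \<rho> ^ q))" by (simp add: sum_distrib_right mult.assoc)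
  also have "\<dots> \<le> (\<Sum>j=1..q. b j * (C * \<rho> ^ k))" using bnd b by (intro sum_mono mult_left_mono) auto
  also have "\<dots> = (\<Sum>j=1..q. b j) * (C * \<rho> ^ k)" by (rule sum_distrib_right[symmetric])
  also have "\<dots> \<le> \<rho> ^ q * (C * \<rho> ^ k)" using \<rho> C by (intro mult_right_mono) auto
  finally show ?case using \<rho> by (simp add: mult.commute)
qed

lemma psi_le:
  assumes b: "\<And>j. j \<in> {1..q} \<Longrightarrow> 0 \<le> b j" and \<rho>: "0 < \<rho>" "\<rho> < 1" "(\<Sum>j=1..q. b j) \<le> \<rho> ^ q"
  shows "psi q b l \<le> \<rho> ^ l"
proof (cases "l = 0")
  case False
  define E where "E t = (if t \<ge> 0 then psi q b (nat t) else 0)" for t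
  have "E (0 + int l) \<le> 1 * \<rho> ^ l"
  proof (rule filter_contraction[OF b \<rho>])
    fix k :: nat assume k: "k \<ge> 1"
    have "E (0 + int k) = (\<Sum>j=1..q. if j \<le> k then b j * psi q b (k - j) else 0)"
      using k unfolding E_def by (simp, subst psi_rec) simp
    also have "\<dots> \<le> (\<Sum>j=1..q. b j * max 0 (E (0 + int k - int j)))"
    proof (intro sum_mono)
      fix j assume j: "j \<in> {1..q}"
      show "(if j \<le> k then b j * psi q b (k - j) else 0) \<le> b j * max 0 (E (0 + int k - int j))"
        using b[OF j] psi_nonneg[of q b "k - j"] b by (auto simp: E_def nat_diff_distrib' intro!: mult_left_mono)
    qed
    finally show "E (0 + int k) \<le> (\<Sum>j=1..q. b j * max 0 (E (0 + int k - int j)))" .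
  next
    show "E (0 - int i) \<le> 1" for i by (cases i) (auto simp: E_def)
  qed (use False in auto)
  then show ?thesis by (simp add: E_def)
qed simp

text \<open>Subexponential growth into the past: exactly what makes filters with any geometric rate
  converge, and a class closed under the operations that build the source terms.\<close>

definition tempered :: "(int \<Rightarrow> real) \<Rightarrow> bool" where
  "tempered w \<longleftrightarrow> (\<forall>t. 0 \<le> w t) \<and> (\<forall>\<rho> t. 0 < \<rho> \<longrightarrow> \<rho> < 1 \<longrightarrow> summable (\<lambda>k. \<rho> ^ k * w (t - int k)))"

lemma temperedD: "tempered w \<Longrightarrow> 0 < \<rho> \<Longrightarrow> \<rho> < 1 \<Longrightarrow> summable (\<lambda>k. \<rho> ^ k * w (t - int k))"
  and tempered_nonneg: "tempered w \<Longrightarrow> 0 \<le> w t"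
  unfolding tempered_def by auto

lemma tempered_const: "0 \<le> c \<Longrightarrow> tempered (\<lambda>_. c)"
  unfolding tempered_def by (auto intro!: summable_mult2 summable_geometric)

lemma tempered_add: "tempered w \<Longrightarrow> tempered w' \<Longrightarrow> tempered (\<lambda>t. w t + w' t)"
  unfolding tempered_def by (auto intro!: summable_add simp: distrib_left)

lemma tempered_scale: "0 \<le> c \<Longrightarrow> tempered w \<Longrightarrow> tempered (\<lambda>t. c * w t)"
  unfolding tempered_def by (auto simp: mult.left_commute[of _ c] intro!: summable_mult)

lemma tempered_shift: "tempered w \<Longrightarrow> tempered (\<lambda>t. w (t - s))"
  unfolding tempered_def
proof (intro conjI allI impI)
  fix \<rho> :: real and t assume "(\<forall>t. 0 \<le> w t) \<and> (\<forall>\<rho> t. 0 < \<rho> \<longrightarrow> \<rho> < 1 \<longrightarrow> summable (\<lambda>k. \<rho> ^ k * w (t - int k)))" "0 < \<rho>" "\<rho> < 1"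
  then have "summable (\<lambda>k. \<rho> ^ k * w (t - s - int k))" by blast
  then show "summable (\<lambda>k. \<rho> ^ k * w (t - int k - s))" by (simp add: algebra_simps)
qed auto

lemma tempered_le: "tempered w' \<Longrightarrow> (\<And>t. 0 \<le> w t) \<Longrightarrow> (\<And>t. w t \<le> w' t) \<Longrightarrow> tempered w"
  unfolding tempered_def
proof (intro conjI allI impI)
  fix \<rho> :: real and t assume *: "(\<forall>t. 0 \<le> w' t) \<and> (\<forall>\<rho> t. 0 < \<rho> \<longrightarrow> \<rho> < 1 \<longrightarrow> summable (\<lambda>k. \<rho> ^ k * w' (t - int k)))"
    "\<And>t. 0 \<le> w t" "\<And>t. w t \<le> w' t" "0 < \<rho>" "\<rho> < 1"
  show "summable (\<lambda>k. \<rho> ^ k * w (t - int k))"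
    by (rule summable_comparison_test'[of "\<lambda>k. \<rho> ^ k * w' (t - int k)" 0]) (use * in \<open>auto simp: abs_mult\<close>)
qed auto

lemma tempered_sum: "(\<And>i. i \<in> I \<Longrightarrow> tempered (w i)) \<Longrightarrow> tempered (\<lambda>t. \<Sum>i\<in>I. w i t)"
proof (cases "finite I")
  case True
  assume "\<And>i. i \<in> I \<Longrightarrow> tempered (w i)"
  with True show ?thesis by (induction I) (auto intro: tempered_const tempered_add)
qed (auto intro: tempered_const)

locale contractive_filter =
  fixes q :: nat and b :: "nat \<Rightarrow> real"
  assumes q: "q \<ge> 1" and b: "\<And>j. j \<in> {1..q} \<Longrightarrow> 0 \<le> b j" and sum_b: "(\<Sum>j=1..q. b j) < 1"
begin

lemma summable_psi:
  assumes "tempered w" shows "summable (\<lambda>l. psi q b l * w (t - int l))"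
proof -
  obtain \<rho> where \<rho>: "0 < \<rho>" "\<rho> < 1" "(\<Sum>j=1..q. b j) \<le> \<rho> ^ q" using exists_rate[OF sum_b q] by blast
  show ?thesis
    by (rule summable_comparison_test'[OF temperedD[OF assms \<rho>(1,2), of t], of 0])
       (use psi_le[OF b \<rho>] psi_nonneg[OF b] tempered_nonneg[OF assms] in \<open>auto simp: abs_mult intro!: mult_right_mono\<close>)
qed

lemma filter_eq_rec:
  assumes w: "tempered w"
  shows "(\<Sum>l. psi q b l * w (t - int l)) = w t + (\<Sum>j=1..q. b j * (\<Sum>l. psi q b l * w (t - int j - int l)))"
proof -
  have 1: "(\<lambda>l. (if l = 0 then 1 else 0) * w (t - int l)) sums w t"
    using sums_single[of 0 "\<lambda>l. w (t - int l)", simplified] by (rule back_subst[where P="\<lambda>f. f sums w t"]) auto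
  have 2: "(\<lambda>l. if j \<le> l then b j * psi q b (l - j) * w (t - int l) else 0) sums (b j * (\<Sum>l. psi q b l * w (t - int j - int l)))" for j
  proof -
    let ?f = "\<lambda>l. if j \<le> l then b j * psi q b (l - j) * w (t - int l) else 0"
    have "(\<lambda>l. b j * (psi q b l * w (t - int j - int l))) sums (b j * (\<Sum>l. psi q b l * w (t - int j - int l)))"
      by (intro sums_mult summable_sums summable_psi w)
    then have "(\<lambda>l. ?f (l + j)) sums (b j * (\<Sum>l. psi q b l * w (t - int j - int l)))"
      by (simp add: algebra_simps)
    then show ?thesis by (subst (asm) sums_iff_shift) simp
  qed
  have "(\<lambda>l. (if l = 0 then 1 else 0) * w (t - int l) + (\<Sum>j=1..q. if j \<le> l then b j * psi q b (l - j) * w (t - int l) else 0))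
     sums (w t + (\<Sum>j=1..q. b j * (\<Sum>l. psi q b l * w (t - int j - int l))))"
    by (intro sums_add 1 sums_sum 2)
  moreover have "(if l = 0 then 1 else 0) * w (t - int l) + (\<Sum>j=1..q. if j \<le> l then b j * psi q b (l - j) * w (t - int l) else 0) = psi q b l * w (t - int l)" for l
    by (subst (2) psi_rec) (simp add: distrib_right sum_distrib_right if_distrib[of "\<lambda>x. x * _"] cong: if_cong)
  ultimately show ?thesis by (simp add: sums_iff)
qed

text \<open>Between time \<open>-n\<close> and 0 the distance of two solutions shrinks by
  \<open>\<rho> ^ n\<close>, while at time \<open>-n\<close> it grows more slowly than any such
  power decays.\<close>

lemma tempered_solution_unique:
  assumes w: "tempered w" and u: "tempered u" and rec: "\<And>t. u t = w t + (\<Sum>j=1..q. b j * u (t - int j))"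
  shows "u 0 = (\<Sum>l. psi q b l * w (0 - int l))"
proof -
  obtain \<rho> where \<rho>: "0 < \<rho>" "\<rho> < 1" "(\<Sum>j=1..q. b j) \<le> \<rho> ^ q" using exists_rate[OF sum_b q] by blast
  obtain r where r: "\<rho> < r" "r < 1" using dense[OF \<rho>(2)] by blast
  then have r0: "0 < r" using \<rho> by linarith
  define h where "h t = (\<Sum>l. psi q b l * w (t - int l))" for t
  define E where "E t = \<bar>u t - h t\<bar>" for t
  define W where "W = (\<Sum>m. r ^ m * w (0 - int m))"
  have W0: "0 \<le> W" unfolding W_def using r0 tempered_nonneg[OF w] by (intro suminf_nonneg temperedD[OF w] r r0) auto
  have h0: "0 \<le> h t" for t
    unfolding h_def using tempered_nonneg[OF w] by (intro suminf_nonneg summable_psi w mult_nonneg_nonneg psi_nonneg b) auto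
  \<comment> \<open>That the filter itself is subexponential is not known yet. A rate r strictly
    between \<open>\<rho>\<close> and 1 gives enough: \<open>h (- int k)\<close> is at most
    \<open>W / r ^ k\<close>, and \<open>(\<rho> / r) ^ k\<close> tends to 0.\<close>
  have hW: "r ^ k * h (- int k) \<le> W" for k
  proof -
    have s1: "summable (\<lambda>l. r ^ (l + k) * w (0 - int (l + k)))"
      using temperedD[OF w r0 r(2), of 0] by (subst summable_iff_shift[where f="\<lambda>m. r ^ m * w (0 - int m)"])
    have "r ^ k * h (- int k) = (\<Sum>l. r ^ k * (psi q b l * w (- int k - int l)))"
      unfolding h_def by (rule suminf_mult[symmetric]) (rule summable_psi[OF w])
    also have "\<dots> \<le> (\<Sum>l. r ^ (l + k) * w (0 - int (l + k)))"
    proof (rule suminf_le)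
      fix l
      have "psi q b l \<le> r ^ l" using psi_le[OF b \<rho>, of l] power_mono[of \<rho> r l] r \<rho> by linarith
      then have "r ^ k * (psi q b l * w (- int k - int l)) \<le> r ^ k * (r ^ l * w (- int k - int l))"
        using r0 tempered_nonneg[OF w] by (intro mult_left_mono mult_right_mono) auto
      also have "\<dots> = r ^ (l + k) * w (0 - int (l + k))" by (simp add: power_add algebra_simps)
      finally show "r ^ k * (psi q b l * w (- int k - int l)) \<le> r ^ (l + k) * w (0 - int (l + k))" .
    qed (use s1 in \<open>auto intro: summable_mult summable_psi w\<close>)
    also have "\<dots> \<le> (\<Sum>l. r ^ (l + k) * w (0 - int (l + k))) + (\<Sum>m<k. r ^ m * w (0 - int m))"
      using r0 tempered_nonneg[OF w] by (auto intro!: sum_nonneg)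
    also have "\<dots> = W" unfolding W_def
      using suminf_split_initial_segment[OF temperedD[OF w r0 r(2), of 0], of k] by simp
    finally show ?thesis .
  qed
  have Erec: "E t \<le> (\<Sum>j=1..q. b j * max 0 (E (t - int j)))" for t
  proof -
    have "u t - h t = (\<Sum>j=1..q. b j * (u (t - int j) - h (t - int j)))"
      using rec[of t] filter_eq_rec[OF w, of t] unfolding h_def by (simp add: right_diff_distrib sum_subtractf)
    then have "E t \<le> (\<Sum>j=1..q. \<bar>b j * (u (t - int j) - h (t - int j))\<bar>)" unfolding E_def by (simp only: sum_abs)
    also have "\<dots> = (\<Sum>j=1..q. b j * max 0 (E (t - int j)))"
      using b by (intro sum.cong) (auto simp: E_def abs_mult)
    finally show ?thesis .
  qed
  have bd: "E 0 \<le> (\<Sum>i<q. E (- int n - int i)) * \<rho> ^ n" if "n \<ge> 1" for n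
  proof -
    have "E (- int n + int n) \<le> (\<Sum>i<q. E (- int n - int i)) * \<rho> ^ n"
    proof (rule filter_contraction[OF b \<rho>])
      show "E (- int n - int i) \<le> (\<Sum>i<q. E (- int n - int i))" if "i < q" for i
        using that by (intro member_le_sum[where f="\<lambda>i. E (- int n - int i)"]) (auto simp: E_def)
      show "0 \<le> (\<Sum>i<q. E (- int n - int i))" by (intro sum_nonneg) (simp add: E_def)
    qed (use that Erec in auto)
    then show ?thesis by simp
  qed
  have lim: "(\<lambda>n. E (- int n - int i) * \<rho> ^ n) \<longlonglongrightarrow> 0" for i
  proof -
    have l1: "(\<lambda>n. \<rho> ^ n * u (- int i - int n)) \<longlonglongrightarrow> 0"
      by (rule summable_LIMSEQ_zero[OF temperedD[OF u \<rho>(1,2)]])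
    have "(\<lambda>n. (\<rho> / r) ^ n * (W / r ^ i)) \<longlonglongrightarrow> 0 * (W / r ^ i)"
      using \<rho> r r0 by (intro tendsto_mult LIMSEQ_realpow_zero tendsto_const) auto
    then have l2: "(\<lambda>n. \<rho> ^ n * u (- int i - int n) + (\<rho> / r) ^ n * (W / r ^ i)) \<longlonglongrightarrow> 0"
      using tendsto_add[OF l1] by fastforce
    show ?thesis
    proof (rule tendsto_sandwich[OF _ _ tendsto_const l2]; intro always_eventually allI)
      fix n
      show "0 \<le> E (- int n - int i) * \<rho> ^ n" using \<rho> by (simp add: E_def)
      have "h (- int (n + i)) \<le> W / r ^ (n + i)" using hW[of "n + i"] r0 by (simp add: pos_le_divide_eq mult.commute)
      moreover have "- int n - int i = - int (n + i)" "- int i - int n = - int (n + i)" by simp_all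
      ultimately have "E (- int n - int i) \<le> u (- int i - int n) + W / r ^ (n + i)"
        using tempered_nonneg[OF u, of "- int (n + i)"] h0[of "- int (n + i)"]
        unfolding E_def by (simp only: abs_le_iff) linarith
      then have "E (- int n - int i) * \<rho> ^ n \<le> (u (- int i - int n) + W / r ^ (n + i)) * \<rho> ^ n" using \<rho> by (intro mult_right_mono) auto
      also have "\<dots> = \<rho> ^ n * u (- int i - int n) + (\<rho> / r) ^ n * (W / r ^ i)" by (simp add: power_add power_divide field_simps)
      finally show "E (- int n - int i) * \<rho> ^ n \<le> \<rho> ^ n * u (- int i - int n) + (\<rho> / r) ^ n * (W / r ^ i)" .
    qed
  qed
  have "(\<lambda>n. \<Sum>i<q. E (- int n - int i) * \<rho> ^ n) \<longlonglongrightarrow> (\<Sum>i<q. 0)" by (intro tendsto_sum lim)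
  then have "(\<lambda>n. (\<Sum>i<q. E (- int n - int i)) * \<rho> ^ n) \<longlonglongrightarrow> 0" by (simp add: sum_distrib_right)
  then have "E 0 \<le> 0" by (rule LIMSEQ_le_const) (use bd in blast)
  then show ?thesis unfolding E_def h_def by simp
qed

end

section \<open>Parameter envelopes of the volatility filter\<close>

definition env_b :: "nat \<Rightarrow> (nat \<Rightarrow> real) \<Rightarrow> real \<Rightarrow> nat \<Rightarrow> real" where
  "env_b p th s j = max 0 (beta p th j + s)"

text \<open>Changing g by at most s changes \<open>|y| - g y\<close> by at most
  \<open>s |y|\<close>. Cutting at 0 before squaring keeps the result monotone in s also for
  negative s.\<close>

definition env_news :: "real \<Rightarrow> real \<Rightarrow> real \<Rightarrow> real" where
  "env_news g s y = (max 0 (\<bar>y\<bar> - g * y + s * \<bar>y\<bar>))\<^sup>2"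

definition env_src :: "nat \<Rightarrow> nat \<Rightarrow> (nat \<Rightarrow> real) \<Rightarrow> real \<Rightarrow> (int \<Rightarrow> real) \<Rightarrow> int \<Rightarrow> real" where
  "env_src p q th s x t = alpha0 th + s + (\<Sum>i=1..p. max 0 (alpha th i + s) * env_news (gam p q th) s (x (t - int i)))"

text \<open>The stationary volatility filter with all parameters moved by \<open>s\<close>. It is monotone in \<open>s\<close>, and \<open>s = 0\<close> is the
  filter at \<open>th\<close>, so \<open>-s\<close> and \<open>s\<close> bracket the filters at all parameters within distance \<open>s\<close> of \<open>th\<close>.\<close>
definition env :: "nat \<Rightarrow> nat \<Rightarrow> (nat \<Rightarrow> real) \<Rightarrow> real \<Rightarrow> (int \<Rightarrow> real) \<Rightarrow> int \<Rightarrow> real" where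
  "env p q th s x t = (\<Sum>l. psi q (env_b p th s) l * env_src p q th s x (t - int l))"

lemma env_news_nonneg: "0 \<le> env_news g s y"
  by (simp add: env_news_def)

lemma env_news_le:
  assumes "\<bar>g\<bar> \<le> 1" "\<bar>s\<bar> \<le> 1" shows "env_news g s y \<le> 9 * y\<^sup>2"
proof -
  have "\<bar>g * y\<bar> \<le> \<bar>y\<bar>" "\<bar>s * y\<bar> \<le> \<bar>y\<bar>" using assms by (simp_all add: abs_mult mult_left_le_one_le)
  then have "s * \<bar>y\<bar> \<le> \<bar>y\<bar>" using assms by (metis abs_abs abs_ge_self abs_mult order_trans)
  then have "max 0 (\<bar>y\<bar> - g * y + s * \<bar>y\<bar>) \<le> 3 * \<bar>y\<bar>" using \<open>\<bar>g * y\<bar> \<le> \<bar>y\<bar>\<close> by (simp add: abs_le_iff)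
  then have "env_news g s y \<le> (3 * \<bar>y\<bar>)\<^sup>2" unfolding env_news_def by (intro power_mono) auto
  then show ?thesis by (simp add: power_mult_distrib)
qed

lemma env_news_0: "\<bar>g\<bar> \<le> 1 \<Longrightarrow> env_news g 0 y = (\<bar>y\<bar> - g * y)\<^sup>2"
proof -
  assume "\<bar>g\<bar> \<le> 1"
  then have "\<bar>g * y\<bar> \<le> \<bar>y\<bar>" by (simp add: abs_mult mult_left_le_one_le)
  then show ?thesis unfolding env_news_def by (simp add: max_def)
qed

lemma env_news_mono:
  assumes "\<bar>g - g'\<bar> \<le> s - s'" shows "env_news g' s' y \<le> env_news g s y"
proof -
  have "(g - g') * y \<le> (s - s') * \<bar>y\<bar>"
    using mult_right_mono[OF assms, of "\<bar>y\<bar>"] abs_ge_self[of "(g - g') * y"] by (simp add: abs_mult)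
  then have "\<bar>y\<bar> - g' * y + s' * \<bar>y\<bar> \<le> \<bar>y\<bar> - g * y + s * \<bar>y\<bar>" by (simp add: algebra_simps)
  then show ?thesis unfolding env_news_def by (intro power_mono) auto
qed

lemma tendsto_env_news: "(s \<longlongrightarrow> s') F \<Longrightarrow> ((\<lambda>n. env_news g (s n) y) \<longlongrightarrow> env_news g s' y) F"
  unfolding env_news_def by (intro tendsto_intros)

text \<open>Here r is a radius: for \<open>|s| <= r\<close> the moved intercept stays positive and
  the moved beta coefficients still sum to less than 1, so both envelopes exist. Radius 0 describes
  the filter at th alone.\<close>

locale garch_param =
  fixes p q :: nat and th :: "nat \<Rightarrow> real" and r :: real
  assumes q1: "q \<ge> 1" and th: "th \<in> param_space p q"
    and r0: "0 \<le> r" and r1: "r \<le> 1" and r_alpha0: "r < alpha0 th" and r_beta: "(\<Sum>j=1..q. beta p th j + r) < 1"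
begin

lemma alpha_nonneg: "i \<in> {1..p} \<Longrightarrow> 0 \<le> alpha th i"
  and beta_nonneg: "j \<in> {1..q} \<Longrightarrow> 0 \<le> beta p th j"
  and gam_le: "\<bar>gam p q th\<bar> \<le> 1" and alpha0_pos: "0 < alpha0 th"
  using th by (auto simp: param_space_def Bset_def)

lemma env_b_nonneg: "0 \<le> env_b p th s j"
  by (simp add: env_b_def)

lemma env_b_mono: "s \<le> s' \<Longrightarrow> env_b p th s j \<le> env_b p th s' j"
  by (auto simp: env_b_def)

lemma contractive: "\<bar>s\<bar> \<le> r \<Longrightarrow> contractive_filter q (env_b p th s)"
proof
  assume s: "\<bar>s\<bar> \<le> r"
  have "(\<Sum>j=1..q. env_b p th s j) \<le> (\<Sum>j=1..q. beta p th j + r)"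
    using beta_nonneg s r0 by (intro sum_mono) (force simp: env_b_def)
  then show "(\<Sum>j=1..q. env_b p th s j) < 1" using r_beta by linarith
qed (use q1 in \<open>auto simp: env_b_nonneg\<close>)

lemma env_src_ge: "alpha0 th + s \<le> env_src p q th s x t"
  unfolding env_src_def by (auto intro!: sum_nonneg mult_nonneg_nonneg env_news_nonneg)

lemma env_src_mono:
  assumes "s \<le> s'" shows "env_src p q th s x t \<le> env_src p q th s' x t"
  unfolding env_src_def
  using assms by (intro add_mono sum_mono mult_mono env_news_mono env_news_nonneg) auto

lemma tempered_env_src:
  assumes x: "tempered (\<lambda>t. (x t)\<^sup>2)" and s: "\<bar>s\<bar> \<le> r"
  shows "tempered (env_src p q th s x)"
proof (rule tempered_le)
  show "tempered (\<lambda>t. alpha0 th + s + (\<Sum>i=1..p. max 0 (alpha th i + s) * (9 * (x (t - int i))\<^sup>2)))"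
    using r_alpha0 s
    by (intro tempered_add tempered_const tempered_sum tempered_scale tempered_shift[of "\<lambda>t. (x t)\<^sup>2"] x) auto
  show "0 \<le> env_src p q th s x t" for t using env_src_ge[of s x t] r_alpha0 s by linarith
  show "env_src p q th s x t \<le> alpha0 th + s + (\<Sum>i=1..p. max 0 (alpha th i + s) * (9 * (x (t - int i))\<^sup>2))" for t
    unfolding env_src_def using gam_le s r1 by (intro add_left_mono sum_mono mult_left_mono env_news_le) auto
qed

lemma env_src_nonneg: "\<bar>s\<bar> \<le> r \<Longrightarrow> 0 \<le> env_src p q th s x t"
  using env_src_ge[of s x t] r_alpha0 by linarith

lemma env_rec:
  assumes "tempered (\<lambda>t. (x t)\<^sup>2)" "\<bar>s\<bar> \<le> r"
  shows "env p q th s x t = env_src p q th s x t + (\<Sum>j=1..q. env_b p th s j * env p q th s x (t - int j))"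
  unfolding env_def using contractive_filter.filter_eq_rec[OF contractive tempered_env_src] assms by blast

lemma env_nonneg:
  assumes "tempered (\<lambda>t. (x t)\<^sup>2)" "\<bar>s\<bar> \<le> r"
  shows "0 \<le> env p q th s x t"
  unfolding env_def
  using contractive_filter.summable_psi[OF contractive tempered_env_src] assms env_src_nonneg
  by (intro suminf_nonneg mult_nonneg_nonneg psi_nonneg env_b_nonneg) auto

lemma env_ge:
  assumes "tempered (\<lambda>t. (x t)\<^sup>2)" "\<bar>s\<bar> \<le> r"
  shows "alpha0 th + s \<le> env p q th s x t"
proof -
  have "0 \<le> (\<Sum>j=1..q. env_b p th s j * env p q th s x (t - int j))"
    using env_nonneg[OF assms] env_b_nonneg by (intro sum_nonneg mult_nonneg_nonneg) auto
  then show ?thesis using env_rec[OF assms, of t] env_src_ge[of s x t] by linarith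
qed

text \<open>Dominated convergence for series; by monotonicity the envelope at the full radius r
  dominates all others.\<close>

lemma tendsto_env:
  assumes x: "tempered (\<lambda>t. (x t)\<^sup>2)" and s: "\<And>n. \<bar>s n\<bar> \<le> r" "s \<longlonglongrightarrow> 0"
  shows "(\<lambda>n. env p q th (s n) x t) \<longlonglongrightarrow> env p q th 0 x t"
proof -
  let ?a = "\<lambda>l n. psi q (env_b p th (s n)) l * env_src p q th (s n) x (t - int l)"
  have lim: "(\<lambda>n. ?a l n) \<longlonglongrightarrow> psi q (env_b p th 0) l * env_src p q th 0 x (t - int l)" for l
  proof (intro tendsto_mult tendsto_psi)
    show "(\<lambda>n. env_b p th (s n) j) \<longlonglongrightarrow> env_b p th 0 j" for j
      unfolding env_b_def using s(2) by (intro tendsto_intros)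
    show "(\<lambda>n. env_src p q th (s n) x (t - int l)) \<longlonglongrightarrow> env_src p q th 0 x (t - int l)"
      unfolding env_src_def using s(2) by (intro tendsto_intros tendsto_env_news)
  qed
  have bd: "norm (?a l n) \<le> psi q (env_b p th r) l * env_src p q th r x (t - int l)" for l n
  proof -
    have "s n \<le> r" using s(1)[of n] by linarith
    then have "?a l n \<le> psi q (env_b p th r) l * env_src p q th r x (t - int l)"
      using s(1) r0 by (intro mult_mono psi_mono env_src_mono env_b_mono psi_nonneg env_b_nonneg env_src_nonneg) auto
    moreover have "0 \<le> ?a l n" using s(1) by (intro mult_nonneg_nonneg psi_nonneg env_b_nonneg env_src_nonneg)
    ultimately show ?thesis by simp
  qed
  have sm: "summable (\<lambda>l. psi q (env_b p th r) l * env_src p q th r x (t - int l))"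
    using contractive_filter.summable_psi[OF contractive tempered_env_src[OF x]] r0 by auto
  have "eventually (\<lambda>(l, n). norm (?a l n) \<le> psi q (env_b p th r) l * env_src p q th r x (t - int l)) (at_top \<times>\<^sub>F sequentially)"
    using bd by (intro always_eventually) auto
  then show ?thesis
    unfolding env_def using tannerys_theorem[OF lim _ sm] by auto
qed

end

section \<open>The filter with fixed initial values and its distance to the stationary
  filters\<close>

definition hpath :: "nat \<Rightarrow> nat \<Rightarrow> (int \<Rightarrow> real) \<Rightarrow> (int \<Rightarrow> real) \<Rightarrow> (nat \<Rightarrow> real) \<Rightarrow> int \<Rightarrow> real" where
  "hpath p q c x th t = (if t \<ge> 1 then hhat p q c x th (nat t) else c t)"

lemma hpath_rec:
  assumes "k \<ge> 1"
  shows "hpath p q c x th (int k) = alpha0 th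
    + (\<Sum>i=1..p. alpha th i * (\<bar>x (int k - int i)\<bar> - gam p q th * x (int k - int i))\<^sup>2)
    + (\<Sum>j=1..q. beta p th j * hpath p q c x th (int k - int j))"
proof -
  have "hpath p q c x th (int k) = hhat p q c x th k" using assms by (simp add: hpath_def del: hhat.simps)
  also have "\<dots> = alpha0 th + (\<Sum>i=1..p. alpha th i * (\<bar>x (int k - int i)\<bar> - gam p q th * x (int k - int i))\<^sup>2)
    + (\<Sum>j=1..q. beta p th j * (if k \<le> j then c (int k - int j) else hhat p q c x th (k - j)))"
    using assms by (subst hhat.simps) (simp del: hhat.simps)
  also have "(\<Sum>j=1..q. beta p th j * (if k \<le> j then c (int k - int j) else hhat p q c x th (k - j)))
    = (\<Sum>j=1..q. beta p th j * hpath p q c x th (int k - int j))"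
    by (intro sum.cong refl arg_cong2[of _ _ _ _ "(*)"]) (auto simp: hpath_def nat_diff_distrib' simp del: hhat.simps)
  finally show ?thesis .
qed

lemma hpath_nonneg:
  assumes th: "th \<in> param_space p q" and c: "\<And>s. s \<in> {- int q + 1..0} \<Longrightarrow> 0 \<le> c s"
  shows "- int q + 1 \<le> int k - int q \<Longrightarrow> 0 \<le> hpath p q c x th (int k - int q)"
proof (induction k rule: less_induct)
  case (less k)
  show ?case
  proof (cases "k \<le> q")
    case True
    then show ?thesis using less.prems c by (simp add: hpath_def)
  next
    case False
    then have e: "int k - int q = int (k - q)" and kq: "k - q \<ge> 1" by auto
    have "0 \<le> hpath p q c x th (int (k - q) - int j)" if "j \<in> {1..q}" for j
      using less.IH[of "k - j"] that False by (auto simp: of_nat_diff algebra_simps)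
    then have "0 \<le> (\<Sum>j=1..q. beta p th j * hpath p q c x th (int (k - q) - int j))"
      using th by (intro sum_nonneg mult_nonneg_nonneg) (auto simp: param_space_def Bset_def)
    moreover have "0 \<le> (\<Sum>i=1..p. alpha th i * (\<bar>x (int (k - q) - int i)\<bar> - gam p q th * x (int (k - q) - int i))\<^sup>2)"
      using th by (intro sum_nonneg mult_nonneg_nonneg) (auto simp: param_space_def)
    ultimately show ?thesis unfolding e hpath_rec[OF kq] using th by (simp add: param_space_def)
  qed
qed

lemma hpath_nonneg':
  assumes "th \<in> param_space p q" "\<And>s. s \<in> {- int q + 1..0} \<Longrightarrow> 0 \<le> c s" "- int q + 1 \<le> t"
  shows "0 \<le> hpath p q c x th t"
  using hpath_nonneg[where k="nat (t + int q)" and x=x, OF assms(1,2)] assms(3) by simp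

lemma hpath_ge:
  assumes "th \<in> param_space p q" "\<And>s. s \<in> {- int q + 1..0} \<Longrightarrow> 0 \<le> c s" "k \<ge> 1"
  shows "alpha0 th \<le> hpath p q c x th (int k)"
proof -
  have "0 \<le> (\<Sum>j=1..q. beta p th j * hpath p q c x th (int k - int j))"
    using assms by (intro sum_nonneg mult_nonneg_nonneg hpath_nonneg') (auto simp: param_space_def Bset_def)
  moreover have "0 \<le> (\<Sum>i=1..p. alpha th i * (\<bar>x (int k - int i)\<bar> - gam p q th * x (int k - int i))\<^sup>2)"
    using assms by (intro sum_nonneg mult_nonneg_nonneg) (auto simp: param_space_def)
  ultimately show ?thesis unfolding hpath_rec[OF assms(3)] by linarith
qed

text \<open>Each one-sided error satisfies the inequality of \<open>filter_contraction\<close> with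
  the envelope's coefficients. The constants C and \<open>\<rho>\<close> come from the envelopes and
  the initial values only, so the bounds are uniform over the neighbourhood of th.\<close>

lemma (in garch_param) hpath_bounds:
  assumes x: "tempered (\<lambda>t. (x t)\<^sup>2)" and s: "0 \<le> s" "s \<le> r" and c: "\<And>t. t \<in> {- int q + 1..0} \<Longrightarrow> 0 \<le> c t"
  shows "\<exists>C\<ge>0. \<exists>\<rho>. 0 < \<rho> \<and> \<rho> < 1 \<and> (\<forall>th'. th' \<in> param_space p q \<longrightarrow> (\<forall>k\<le>p+q+1. \<bar>th' k - th k\<bar> \<le> s) \<longrightarrow>
    (\<forall>k\<ge>1. hpath p q c x th' (int k) \<le> env p q th s x (int k) + C * \<rho> ^ k \<and>
       env p q th (-s) x (int k) \<le> hpath p q c x th' (int k) + C * \<rho> ^ k))"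
proof -
  have s': "\<bar>s\<bar> \<le> r" "\<bar>- s\<bar> \<le> r" using s by auto
  interpret U: contractive_filter q "env_b p th s" by (rule contractive[OF s'(1)])
  obtain \<rho> where \<rho>: "0 < \<rho>" "\<rho> < 1" "(\<Sum>j=1..q. env_b p th s j) \<le> \<rho> ^ q" using exists_rate[OF U.sum_b U.q] by blast
  have "(\<Sum>j=1..q. env_b p th (-s) j) \<le> (\<Sum>j=1..q. env_b p th s j)" using s by (intro sum_mono env_b_mono) auto
  then have \<rho>': "(\<Sum>j=1..q. env_b p th (-s) j) \<le> \<rho> ^ q" using \<rho> by linarith
  define C where "C = (\<Sum>i<q. \<bar>c (- int i)\<bar> + env p q th (-s) x (- int i))"
  have C: "0 \<le> C" unfolding C_def using env_nonneg[OF x s'(2)] by (intro sum_nonneg add_nonneg_nonneg) auto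
  have Ci: "\<bar>c (- int i)\<bar> + env p q th (-s) x (- int i) \<le> C" if "i < q" for i
    unfolding C_def using that env_nonneg[OF x s'(2)] by (intro member_le_sum[where f="\<lambda>i. \<bar>c (- int i)\<bar> + env p q th (-s) x (- int i)"]) (auto intro: add_nonneg_nonneg)
  have "hpath p q c x th' (int k) \<le> env p q th s x (int k) + C * \<rho> ^ k \<and>
       env p q th (-s) x (int k) \<le> hpath p q c x th' (int k) + C * \<rho> ^ k"
    if th': "th' \<in> param_space p q" and near: "\<forall>k\<le>p+q+1. \<bar>th' k - th k\<bar> \<le> s" and k: "k \<ge> 1" for th' k
  proof -
    let ?H = "hpath p q c x th'"
    have a0: "\<bar>alpha0 th' - alpha0 th\<bar> \<le> s" using near by (simp add: alpha0_def)
    have al: "\<bar>alpha th' i - alpha th i\<bar> \<le> s" "0 \<le> alpha th' i" if "i \<in> {1..p}" for i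
      using near that th' by (auto simp: alpha_def param_space_def)
    have be: "\<bar>beta p th' j - beta p th j\<bar> \<le> s" "0 \<le> beta p th' j" if "j \<in> {1..q}" for j
      using near that th' by (auto simp: beta_def param_space_def Bset_def)
    have ga: "\<bar>gam p q th' - gam p q th\<bar> \<le> s" "\<bar>gam p q th'\<bar> \<le> 1" using near th' by (auto simp: gam_def param_space_def)
    have news: "(\<bar>y\<bar> - gam p q th' * y)\<^sup>2 \<le> env_news (gam p q th) s y" "env_news (gam p q th) (-s) y \<le> (\<bar>y\<bar> - gam p q th' * y)\<^sup>2" for y
      unfolding env_news_0[OF ga(2), symmetric] using ga(1) by (auto intro!: env_news_mono simp: abs_minus_commute)
    define src where "src t = alpha0 th' + (\<Sum>i=1..p. alpha th' i * (\<bar>x (t - int i)\<bar> - gam p q th' * x (t - int i))\<^sup>2)" for t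
    have src_le: "src t \<le> env_src p q th s x t" for t
      unfolding src_def env_src_def
    proof (intro add_mono sum_mono mult_mono news)
      fix i assume "i \<in> {1..p}" then show "alpha th' i \<le> max 0 (alpha th i + s)" using al[of i] by (auto simp: abs_le_iff)
    qed (use a0 in auto)
    have src_ge: "env_src p q th (-s) x t \<le> src t" for t
      unfolding src_def env_src_def
    proof (intro add_mono sum_mono mult_mono news env_news_nonneg)
      fix i assume i: "i \<in> {1..p}"
      show "max 0 (alpha th i + - s) \<le> alpha th' i" "0 \<le> alpha th' i" using al[OF i] by (auto simp: abs_le_iff)
    qed (use a0 in auto)
    have Hrec: "?H (int k) = src (int k) + (\<Sum>j=1..q. beta p th' j * ?H (int k - int j))" if "k \<ge> 1" for k
      unfolding src_def using hpath_rec[OF that] by simp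
    have H0: "0 \<le> ?H (int k - int j)" if "k \<ge> 1" "j \<in> {1..q}" for k j
      using that by (intro hpath_nonneg'[OF th' c]) auto
    have init: "?H (0 - int i) = c (- int i)" for i by (simp add: hpath_def)
    have up: "?H (0 + int k) - env p q th s x (0 + int k) \<le> C * \<rho> ^ k"
    proof (rule filter_contraction[where b="env_b p th s", OF env_b_nonneg \<rho> _ _ C k])
      fix k :: nat assume k: "k \<ge> 1"
      have "(\<Sum>j=1..q. beta p th' j * ?H (int k - int j)) \<le> (\<Sum>j=1..q. env_b p th s j * ?H (int k - int j))"
      proof (intro sum_mono mult_right_mono)
        fix j assume j: "j \<in> {1..q}"
        show "beta p th' j \<le> env_b p th s j" using be[OF j] by (auto simp: env_b_def abs_le_iff)
      qed (use H0[OF k] in auto)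
      then have "?H (int k) - env p q th s x (int k) \<le> (\<Sum>j=1..q. env_b p th s j * (?H (int k - int j) - env p q th s x (int k - int j)))"
        using Hrec[OF k] env_rec[OF x s'(1), of "int k"] src_le[of "int k"] by (simp add: right_diff_distrib sum_subtractf)
      also have "\<dots> \<le> (\<Sum>j=1..q. env_b p th s j * max 0 (?H (int k - int j) - env p q th s x (int k - int j)))"
        by (intro sum_mono mult_left_mono env_b_nonneg) auto
      finally show "?H (0 + int k) - env p q th s x (0 + int k) \<le> (\<Sum>j=1..q. env_b p th s j * max 0 (?H (0 + int k - int j) - env p q th s x (0 + int k - int j)))"
        by simp
    next
      fix i assume "i < q"
      then show "?H (0 - int i) - env p q th s x (0 - int i) \<le> C"
        unfolding init using Ci[of i] env_nonneg[OF x s'(1), of "0 - int i"] env_nonneg[OF x s'(2), of "- int i"] by linarith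
    qed
    have lo: "env p q th (-s) x (0 + int k) - ?H (0 + int k) \<le> C * \<rho> ^ k"
    proof (rule filter_contraction[where b="env_b p th (-s)", OF env_b_nonneg \<rho>(1,2) \<rho>' _ _ C k])
      fix k :: nat assume k: "k \<ge> 1"
      have "(\<Sum>j=1..q. env_b p th (-s) j * ?H (int k - int j)) \<le> (\<Sum>j=1..q. beta p th' j * ?H (int k - int j))"
      proof (intro sum_mono mult_right_mono)
        fix j assume j: "j \<in> {1..q}"
        show "env_b p th (-s) j \<le> beta p th' j" using be[OF j] by (auto simp: env_b_def abs_le_iff)
      qed (use H0[OF k] in auto)
      then have "env p q th (-s) x (int k) - ?H (int k) \<le> (\<Sum>j=1..q. env_b p th (-s) j * (env p q th (-s) x (int k - int j) - ?H (int k - int j)))"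
        using Hrec[OF k] env_rec[OF x s'(2), of "int k"] src_ge[of "int k"] by (simp add: right_diff_distrib sum_subtractf)
      also have "\<dots> \<le> (\<Sum>j=1..q. env_b p th (-s) j * max 0 (env p q th (-s) x (int k - int j) - ?H (int k - int j)))"
        by (intro sum_mono mult_left_mono env_b_nonneg) auto
      finally show "env p q th (-s) x (0 + int k) - ?H (0 + int k) \<le> (\<Sum>j=1..q. env_b p th (-s) j * max 0 (env p q th (-s) x (0 + int k - int j) - ?H (0 + int k - int j)))"
        by simp
    next
      fix i assume "i < q"
      then show "env p q th (-s) x (0 - int i) - ?H (0 - int i) \<le> C"
        unfolding init using Ci[of i] by simp
    qed
    show ?thesis using up lo by simp
  qed
  then show ?thesis using C \<rho> by blast
qed

lemma perturb_inverse_log: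
  fixes h k a e y :: real
  assumes "0 < a" "a \<le> h" "a \<le> k" "0 \<le> e" "h \<le> k + e" "0 \<le> y"
  shows "y / k \<le> y / h + y * e / a\<^sup>2" and "ln h \<le> ln k + e / a"
proof -
  have "1 / k - 1 / h = (h - k) / (h * k)" using assms by (simp add: field_simps)
  also have "\<dots> \<le> e / (h * k)" using assms by (intro divide_right_mono) auto
  also have "\<dots> \<le> e / a\<^sup>2" using assms unfolding power2_eq_square by (intro divide_left_mono mult_mono) auto
  finally have "y * (1 / k - 1 / h) \<le> y * (e / a\<^sup>2)" using assms by (intro mult_left_mono) auto
  then show "y / k \<le> y / h + y * e / a\<^sup>2" by (simp add: algebra_simps)
  have "ln (h / k) \<le> h / k - 1" using assms by (intro ln_le_minus_one) auto
  also have "\<dots> = (h - k) / k" using assms by (simp add: field_simps)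
  also have "\<dots> \<le> e / k" using assms by (intro divide_right_mono) auto
  also have "\<dots> \<le> e / a" using assms by (intro divide_left_mono) auto
  finally show "ln h \<le> ln k + e / a" using assms by (simp add: ln_div)
qed

text \<open>The quotient falls and the logarithm grows with the volatility, so a lower bound takes
  the upper envelope in the first and the lower envelope in the second. The errors decay
  geometrically even after multiplication by the subexponential squared returns; hence their total
  is a constant, uniform in n and th'.\<close>

lemma likelihood_gap:
  assumes p1: "garch_param p q th s" and p0: "garch_param p q th0 0"
    and x: "tempered (\<lambda>t. (x t)\<^sup>2)" and fwd: "\<And>\<rho>. 0 < \<rho> \<Longrightarrow> \<rho> < 1 \<Longrightarrow> summable (\<lambda>k. \<rho> ^ k * (x (int k))\<^sup>2)"
    and c: "\<And>t. t \<in> {- int q + 1..0} \<Longrightarrow> 0 \<le> c t"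
  shows "\<exists>C. \<forall>th' n. th' \<in> param_space p q \<longrightarrow> (\<forall>k\<le>p+q+1. \<bar>th' k - th k\<bar> \<le> s) \<longrightarrow>
    2 * (Lhat p q c x n th0 - Lhat p q c x n th') \<ge>
    (\<Sum>t=1..n. (x (int t))\<^sup>2 / env p q th s x (int t) + ln (env p q th (-s) x (int t))
       - (x (int t))\<^sup>2 / env p q th0 0 x (int t) - ln (env p q th0 0 x (int t))) - C"
proof -
  interpret A: garch_param p q th s by fact
  interpret B: garch_param p q th0 0 by fact
  obtain C \<rho> where C: "0 \<le> C" "0 < \<rho>" "\<rho> < 1" and CA: "\<And>th' k. th' \<in> param_space p q \<Longrightarrow> (\<forall>k\<le>p+q+1. \<bar>th' k - th k\<bar> \<le> s) \<Longrightarrow>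
    k \<ge> 1 \<Longrightarrow> hpath p q c x th' (int k) \<le> env p q th s x (int k) + C * \<rho> ^ k \<and>
       env p q th (-s) x (int k) \<le> hpath p q c x th' (int k) + C * \<rho> ^ k"
    using A.hpath_bounds[OF x A.r0 order_refl, of c] c by metis
  obtain D \<sigma> where D: "0 \<le> D" "0 < \<sigma>" "\<sigma> < 1" and DB: "\<And>k. k \<ge> 1 \<Longrightarrow> hpath p q c x th0 (int k) \<le> env p q th0 0 x (int k) + D * \<sigma> ^ k \<and>
       env p q th0 0 x (int k) \<le> hpath p q c x th0 (int k) + D * \<sigma> ^ k"
    using B.hpath_bounds[OF x order_refl order_refl, of c] c B.th by (metis abs_eq_0 diff_self minus_zero order_refl)
  define a where "a = alpha0 th - s"
  define b where "b = alpha0 th0"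
  have a: "0 < a" unfolding a_def using A.r_alpha0 by simp
  have b: "0 < b" unfolding b_def by (rule B.alpha0_pos)
  define err where "err k = (x (int k))\<^sup>2 * (C * \<rho> ^ k) / a\<^sup>2 + C * \<rho> ^ k / a + ((x (int k))\<^sup>2 * (D * \<sigma> ^ k) / b\<^sup>2 + D * \<sigma> ^ k / b)" for k
  have err0: "0 \<le> err k" for k unfolding err_def using C D a b by (intro add_nonneg_nonneg) auto
  have sm: "summable err"
  proof -
    have 1: "summable (\<lambda>k. (x (int k))\<^sup>2 * (C * \<rho> ^ k) / a\<^sup>2)" if "0 < \<rho>" "\<rho> < 1" for C \<rho> a :: real
      using summable_mult[OF fwd[OF that], of "C / a\<^sup>2"] by (simp add: mult_ac)
    have 2: "summable (\<lambda>k. C * \<rho> ^ k / a)" if "0 < \<rho>" "\<rho> < 1" for C \<rho> a :: real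
      using summable_mult[of "\<lambda>k. \<rho> ^ k" "C / a"] summable_geometric[of \<rho>] that by simp
    show ?thesis unfolding err_def using C D by (intro summable_add 1 2)
  qed
  have "2 * (Lhat p q c x n th0 - Lhat p q c x n th') \<ge>
    (\<Sum>t=1..n. (x (int t))\<^sup>2 / env p q th s x (int t) + ln (env p q th (-s) x (int t))
       - (x (int t))\<^sup>2 / env p q th0 0 x (int t) - ln (env p q th0 0 x (int t))) - suminf err"
    if th': "th' \<in> param_space p q" "\<forall>k\<le>p+q+1. \<bar>th' k - th k\<bar> \<le> s" for th' n
  proof -
    have one: "(x (int t))\<^sup>2 / env p q th s x (int t) + ln (env p q th (-s) x (int t))
       - (x (int t))\<^sup>2 / env p q th0 0 x (int t) - ln (env p q th0 0 x (int t)) - err t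
       \<le> ((x (int t))\<^sup>2 / hhat p q c x th' t + ln (hhat p q c x th' t)) - ((x (int t))\<^sup>2 / hhat p q c x th0 t + ln (hhat p q c x th0 t))"
      if t: "t \<ge> 1" for t
    proof -
      have H: "hhat p q c x th t = hpath p q c x th (int t)" for th using t by (simp add: hpath_def del: hhat.simps)
      have "\<bar>alpha0 th' - alpha0 th\<bar> \<le> s" using th'(2) by (simp add: alpha0_def)
      then have h1: "a \<le> hpath p q c x th' (int t)" using hpath_ge[where x=x and c=c, OF th'(1) c t] unfolding a_def by linarith
      have h0: "b \<le> hpath p q c x th0 (int t)" unfolding b_def by (rule hpath_ge[OF B.th c t])
      have e1: "a \<le> env p q th s x (int t)" "a \<le> env p q th (-s) x (int t)"
        using A.env_ge[OF x, of s "int t"] A.env_ge[OF x, of "-s" "int t"] A.r0 unfolding a_def by auto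
      have e0: "b \<le> env p q th0 0 x (int t)" using B.env_ge[OF x, of 0 "int t"] unfolding b_def by auto
      have E: "0 \<le> C * \<rho> ^ t" "0 \<le> D * \<sigma> ^ t" using C D by auto
      note 1 = perturb_inverse_log(1)[OF a h1 e1(1) E(1) conjunct1[OF CA[OF th' t]], of "(x (int t))\<^sup>2"]
      note 2 = perturb_inverse_log(2)[OF a e1(2) h1 E(1) conjunct2[OF CA[OF th' t]], of "(x (int t))\<^sup>2"]
      note 3 = perturb_inverse_log(1)[OF b e0 h0 E(2) conjunct2[OF DB[OF t]], of "(x (int t))\<^sup>2"]
      note 4 = perturb_inverse_log(2)[OF b h0 e0 E(2) conjunct1[OF DB[OF t]], of "(x (int t))\<^sup>2"]
      show ?thesis unfolding H err_def using 1 2 3 4 by simp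
    qed
    have "(\<Sum>t=1..n. (x (int t))\<^sup>2 / env p q th s x (int t) + ln (env p q th (-s) x (int t))
       - (x (int t))\<^sup>2 / env p q th0 0 x (int t) - ln (env p q th0 0 x (int t))) - (\<Sum>t=1..n. err t)
      \<le> (\<Sum>t=1..n. ((x (int t))\<^sup>2 / hhat p q c x th' t + ln (hhat p q c x th' t)) - ((x (int t))\<^sup>2 / hhat p q c x th0 t + ln (hhat p q c x th0 t)))"
      unfolding sum_subtractf[symmetric] by (intro sum_mono one) simp
    also have "\<dots> = 2 * (Lhat p q c x n th0 - Lhat p q c x n th')"
      unfolding Lhat_def sum_subtractf by (simp del: hhat.simps)
    finally show ?thesis
      using sum_le_suminf[OF sm, of "{1..n}"] err0 by simp
  qed
  then show ?thesis by blast
qed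

section \<open>Identifiability\<close>

definition gcoef :: "nat \<Rightarrow> nat \<Rightarrow> (nat \<Rightarrow> real) \<Rightarrow> nat \<Rightarrow> real" where
  "gcoef p q th m = (\<Sum>i=1..p. if i \<le> m then alpha th i * psi q (beta p th) (m - i) else 0)"

lemma psi_cong: "(\<And>j. j \<in> {1..q} \<Longrightarrow> b j = b' j) \<Longrightarrow> psi q b l = psi q b' l"
  unfolding psi_def by (intro lin_rec_cong) auto

context garch_param
begin

lemma psi_env_0: "psi q (env_b p th 0) l = psi q (beta p th) l"
  using beta_nonneg by (intro psi_cong) (auto simp: env_b_def)

text \<open>The ARCH(infinity) form: terms with \<open>i + l = m\<close> are collected into one
  weight per lag. The constant part is split off because it carries no innovation.\<close>

lemma env_0_expansion:
  assumes x: "tempered (\<lambda>t. (x t)\<^sup>2)"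
  shows "(\<lambda>m. gcoef p q th m * (\<bar>x (- int m)\<bar> - gam p q th * x (- int m))\<^sup>2) sums
    (env p q th 0 x 0 - alpha0 th * (\<Sum>l. psi q (beta p th) l))"
proof -
  let ?n = "\<lambda>t. (\<bar>x t\<bar> - gam p q th * x t)\<^sup>2"
  let ?psi = "psi q (beta p th)"
  have r: "\<bar>0 :: real\<bar> \<le> r" using r0 by simp
  interpret C: contractive_filter q "env_b p th 0" by (rule contractive[OF r])
  have tn: "tempered ?n"
  proof (rule tempered_le)
    show "tempered (\<lambda>t. 9 * (x t)\<^sup>2)" by (intro tempered_scale x) simp
    show "?n t \<le> 9 * (x t)\<^sup>2" for t using env_news_le[OF gam_le, of 0 "x t"] env_news_0[OF gam_le, of "x t"] by simp
  qed simp
  have s1: "(\<lambda>l. ?psi l) sums (\<Sum>l. ?psi l)"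
    using C.summable_psi[OF tempered_const[of 1]] unfolding psi_env_0 by (simp add: summable_sums)
  have s2: "(\<lambda>l. if i \<le> l then ?psi (l - i) * ?n (- int l) else 0) sums (\<Sum>l. ?psi l * ?n (- int i - int l))" for i
  proof -
    have "(\<lambda>l. ?psi l * ?n (- int i - int l)) sums (\<Sum>l. ?psi l * ?n (- int i - int l))"
      using C.summable_psi[OF tn, of "- int i"] unfolding psi_env_0 by (rule summable_sums)
    moreover have "(\<lambda>l. ?psi l * ?n (- int i - int l)) = (\<lambda>l. if i \<le> l + i then ?psi (l + i - i) * ?n (- int (l + i)) else 0)"
    proof (intro ext)
      fix l
      have "- int i - int l = - int (l + i)" by simp
      then show "?psi l * ?n (- int i - int l) = (if i \<le> l + i then ?psi (l + i - i) * ?n (- int (l + i)) else 0)"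
        by (simp only:) simp
    qed
    ultimately have "(\<lambda>l. (\<lambda>l. if i \<le> l then ?psi (l - i) * ?n (- int l) else 0) (l + i)) sums (\<Sum>l. ?psi l * ?n (- int i - int l))"
      by (simp only:)
    then show ?thesis by (subst (asm) sums_iff_shift) simp
  qed
  have "(\<lambda>l. alpha0 th * ?psi l + (\<Sum>i=1..p. alpha th i * (?psi l * ?n (- int i - int l)))) sums
    (alpha0 th * (\<Sum>l. ?psi l) + (\<Sum>i=1..p. alpha th i * (\<Sum>l. ?psi l * ?n (- int i - int l))))"
  proof (intro sums_add sums_mult s1 sums_sum)
    fix i show "(\<lambda>l. ?psi l * ?n (- int i - int l)) sums (\<Sum>l. ?psi l * ?n (- int i - int l))"
      using C.summable_psi[OF tn, of "- int i"] unfolding psi_env_0 by (rule summable_sums)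
  qed
  moreover have "alpha0 th * ?psi l + (\<Sum>i=1..p. alpha th i * (?psi l * ?n (- int i - int l))) =
      psi q (env_b p th 0) l * env_src p q th 0 x (0 - int l)" for l
  proof -
    have "env_src p q th 0 x (0 - int l) = alpha0 th + (\<Sum>i=1..p. alpha th i * ?n (- int i - int l))"
    proof -
      have "max 0 (alpha th i + 0) * env_news (gam p q th) 0 (x (0 - int l - int i)) = alpha th i * ?n (- int i - int l)" if "i \<in> {1..p}" for i
      proof -
        have t: "0 - int l - int i = - int i - int l" by simp
        show ?thesis unfolding t env_news_0[OF gam_le] using alpha_nonneg[OF that] by simp
      qed
      then show ?thesis unfolding env_src_def by (simp only: add_0_right cong: sum.cong)
    qed
    then show ?thesis unfolding psi_env_0 by (simp add: distrib_left sum_distrib_left mult_ac)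
  qed
  ultimately have e: "env p q th 0 x 0 - alpha0 th * (\<Sum>l. ?psi l) = (\<Sum>i=1..p. alpha th i * (\<Sum>l. ?psi l * ?n (- int i - int l)))"
    unfolding env_def by (simp add: sums_iff)
  have "(\<lambda>l. \<Sum>i=1..p. alpha th i * (if i \<le> l then ?psi (l - i) * ?n (- int l) else 0)) sums
    (\<Sum>i=1..p. alpha th i * (\<Sum>l. ?psi l * ?n (- int i - int l)))"
    by (intro sums_sum sums_mult s2)
  moreover have "(\<Sum>i=1..p. alpha th i * (if i \<le> l then ?psi (l - i) * ?n (- int l) else 0)) = gcoef p q th l * ?n (- int l)" for l
    unfolding gcoef_def sum_distrib_right by (intro sum.cong) auto
  ultimately show ?thesis unfolding e by simp
qed

end

section \<open>The lag weights as a quotient of complex polynomials\<close>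

definition apoly :: "nat \<Rightarrow> (nat \<Rightarrow> real) \<Rightarrow> complex poly" where
  "apoly p th = (\<Sum>i=1..p. monom (of_real (alpha th i)) i)"

definition bpoly :: "nat \<Rightarrow> nat \<Rightarrow> (nat \<Rightarrow> real) \<Rightarrow> complex poly" where
  "bpoly p q th = 1 - (\<Sum>j=1..q. monom (of_real (beta p th j)) j)"

lemma coeff_apoly: "coeff (apoly p th) n = (if 1 \<le> n \<and> n \<le> p then of_real (alpha th n) else 0)"
  unfolding apoly_def by (simp add: coeff_sum coeff_monom sum.delta')

lemma coeff_bpoly: "coeff (bpoly p q th) n = (if n = 0 then 1 else if n \<le> q then - of_real (beta p th n) else 0)"
  unfolding bpoly_def by (auto simp: coeff_sum coeff_monom sum.delta' coeff_1)

lemma psi_times_bpoly: "Abs_fps (\<lambda>n. of_real (psi q (beta p th) n)) * fps_of_poly (bpoly p q th) = 1"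
proof (rule fps_ext)
  fix n
  let ?psi = "psi q (beta p th)"
  have "fps_nth (fps_of_poly (bpoly p q th) * Abs_fps (\<lambda>n. of_real (?psi n))) n
    = (\<Sum>i=0..n. coeff (bpoly p q th) i * of_real (?psi (n - i)))"
    by (simp add: fps_mult_nth)
  also have "\<dots> = of_real (?psi n) + (\<Sum>i=1..n. coeff (bpoly p q th) i * of_real (?psi (n - i)))"
    by (subst sum.atLeast_Suc_atMost) (auto simp: coeff_bpoly)
  also have "(\<Sum>i=1..n. coeff (bpoly p q th) i * of_real (?psi (n - i))) = (\<Sum>i\<in>{1..n} \<inter> {1..q}. - of_real (beta p th i * ?psi (n - i)))"
    by (intro sum.mono_neutral_cong_right) (auto simp: coeff_bpoly)
  also have "\<dots> = (\<Sum>i=1..q. - of_real (if i \<le> n then beta p th i * ?psi (n - i) else 0))"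
    by (intro sum.mono_neutral_cong_left) auto
  also have "of_real (?psi n) + \<dots> = of_real (?psi n - (\<Sum>i=1..q. if i \<le> n then beta p th i * ?psi (n - i) else 0))"
    by (simp add: sum_negf)
  also have "\<dots> = of_real (if n = 0 then 1 else 0)" using psi_rec[of q "beta p th" n] by simp
  finally show "fps_nth (Abs_fps (\<lambda>n. of_real (?psi n)) * fps_of_poly (bpoly p q th)) n = fps_nth 1 n"
    by (simp add: mult.commute)
qed

lemma gcoef_fps: "Abs_fps (\<lambda>n. of_real (gcoef p q th n)) = fps_of_poly (apoly p th) * Abs_fps (\<lambda>n. of_real (psi q (beta p th) n))"
proof (rule fps_ext)
  fix n
  let ?psi = "psi q (beta p th)"
  have "fps_nth (fps_of_poly (apoly p th) * Abs_fps (\<lambda>n. of_real (?psi n))) n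
    = (\<Sum>i=0..n. coeff (apoly p th) i * of_real (?psi (n - i)))"
    by (simp add: fps_mult_nth)
  also have "\<dots> = (\<Sum>i\<in>{0..n} \<inter> {1..p}. of_real (alpha th i * ?psi (n - i)))"
    by (intro sum.mono_neutral_cong_right) (auto simp: coeff_apoly)
  also have "\<dots> = (\<Sum>i=1..p. of_real (if i \<le> n then alpha th i * ?psi (n - i) else 0))"
    by (intro sum.mono_neutral_cong_left) auto
  finally show "fps_nth (Abs_fps (\<lambda>n. of_real (gcoef p q th n))) n = fps_nth (fps_of_poly (apoly p th) * Abs_fps (\<lambda>n. of_real (?psi n))) n"
    by (simp add: gcoef_def)
qed

text \<open>Roots of b are split off one at a time: each is a root of \<open>a * c\<close> but not
  of a, hence of c.\<close>

lemma dvd_of_no_common_root: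
  fixes a b c :: "complex poly"
  assumes "b \<noteq> 0" "b dvd a * c" "\<And>z. poly b z = 0 \<Longrightarrow> poly a z \<noteq> 0"
  shows "b dvd c"
  using assms
proof (induction "degree b" arbitrary: b c)
  case 0
  then have "b dvd 1" using is_unit_iff_degree[of b] by simp
  then show ?case using one_dvd by (rule dvd_trans)
next
  case (Suc n)
  then have "\<not> constant (poly b)" by (simp add: constant_degree)
  then obtain z where z: "poly b z = 0" using fundamental_theorem_of_algebra by blast
  then obtain b' where b': "b = [:- z, 1:] * b'" by (auto simp: poly_eq_0_iff_dvd elim: dvdE)
  have "poly (a * c) z = 0" using Suc.prems(2) z unfolding poly_eq_0_iff_dvd by (rule dvd_trans[rotated])
  then have "poly c z = 0" using Suc.prems(3)[OF z] by simp
  then obtain c' where c': "c = [:- z, 1:] * c'" by (auto simp: poly_eq_0_iff_dvd elim: dvdE)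
  have "b' \<noteq> 0" using Suc.prems(1) b' by auto
  then have "degree b = Suc (degree b')" unfolding b' by (subst degree_mult_eq) auto
  then have deg: "n = degree b'" using Suc.hyps(2) by linarith
  have "[:- z, 1:] * b' dvd [:- z, 1:] * (a * c')"
    using Suc.prems(2) unfolding b' c' by (simp only: mult.left_commute)
  then have dvd: "b' dvd a * c'" by (subst (asm) dvd_mult_cancel_left) simp
  have "poly a w \<noteq> 0" if "poly b' w = 0" for w using Suc.prems(3)[of w] that unfolding b' by simp
  then have "b' dvd c'" by (rule Suc.hyps(1)[OF deg \<open>b' \<noteq> 0\<close> dvd])
  then show ?case unfolding b' c' by (rule mult_dvd_mono[OF dvd_refl])
qed

text \<open>The filter coefficients are the power series of \<open>a/b\<close>. Coprimality and the degree condition make the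
  fraction reduced with no room for a common factor.\<close>
lemma gcoef_identify:
  assumes eq: "\<And>m. gcoef p q th1 m = gcoef p q th0 m" and p: "p \<ge> 1" and q: "q \<ge> 1"
    and pos: "\<exists>i\<in>{1..p}. alpha th0 i > 0"
    and last: "(alpha th0 p, beta p th0 q) \<noteq> (0, 0)"
    and cop: "\<not> (\<exists>z::complex. (\<Sum>i=1..p. of_real (alpha th0 i) * z ^ i) = 0
                     \<and> 1 - (\<Sum>j=1..q. of_real (beta p th0 j) * z ^ j) = 0)"
  shows "(\<forall>i\<in>{1..p}. alpha th1 i = alpha th0 i) \<and> (\<forall>j\<in>{1..q}. beta p th1 j = beta p th0 j)"
proof -
  let ?a = "apoly p" and ?b = "bpoly p q"
  let ?P = "\<lambda>th. Abs_fps (\<lambda>n. complex_of_real (psi q (beta p th) n))"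
  have E: "fps_of_poly (?a th1) * ?P th1 = fps_of_poly (?a th0) * ?P th0"
    using gcoef_fps[of p q th1] gcoef_fps[of p q th0] eq by simp
  have "fps_of_poly (?a th1) * (?P th1 * fps_of_poly (?b th1)) * fps_of_poly (?b th0)
      = (fps_of_poly (?a th1) * ?P th1) * (fps_of_poly (?b th1) * fps_of_poly (?b th0))"
    by (simp only: mult.assoc)
  also have "\<dots> = fps_of_poly (?a th0) * (?P th0 * fps_of_poly (?b th0)) * fps_of_poly (?b th1)"
    unfolding E by (simp only: mult.assoc mult.commute[of "fps_of_poly (?b th1)"])
  finally have "fps_of_poly (?a th1 * ?b th0) = fps_of_poly (?a th0 * ?b th1)"
    unfolding psi_times_bpoly by (simp add: fps_of_poly_mult)
  then have ab: "?a th1 * ?b th0 = ?a th0 * ?b th1" by simp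
  have b0: "?b th \<noteq> 0" for th using coeff_bpoly[of p q th 0] by force
  have "?b th0 dvd ?b th1"
  proof (rule dvd_of_no_common_root[OF b0])
    show "?b th0 dvd ?a th0 * ?b th1" unfolding ab[symmetric] by simp
    show "poly (?a th0) z \<noteq> 0" if "poly (?b th0) z = 0" for z
      using cop that by (simp add: apoly_def bpoly_def poly_sum poly_monom) blast
  qed
  then obtain r where r: "?b th1 = ?b th0 * r" by (elim dvdE)
  have ar: "?a th1 = ?a th0 * r"
  proof -
    have "?a th1 * ?b th0 = (?a th0 * r) * ?b th0" unfolding ab r by (simp add: mult_ac)
    then show ?thesis using b0[of th0] by simp
  qed
  have r0: "r \<noteq> 0" using r b0[of th1] by auto
  have a0: "?a th0 \<noteq> 0"
  proof -
    obtain i where "i \<in> {1..p}" "alpha th0 i > 0" using pos by blast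
    then have "coeff (?a th0) i \<noteq> 0" by (simp add: coeff_apoly)
    then show ?thesis by force
  qed
  have dega: "degree (?a th) \<le> p" for th by (rule degree_le) (simp add: coeff_apoly)
  have degb: "degree (?b th) \<le> q" for th by (rule degree_le) (simp add: coeff_bpoly)
  \<comment> \<open>One of the two true polynomials has the largest admissible degree; a nonconstant
    r would push its counterpart at th1 beyond it. The value 1 of both b polynomials at 0 then makes
    r equal to 1.\<close>
  have "degree r = 0"
  proof (cases "alpha th0 p = 0")
    case False
    then have "p \<le> degree (?a th0)" using p by (intro le_degree) (simp add: coeff_apoly)
    moreover have "degree (?a th1) = degree (?a th0) + degree r" unfolding ar using a0 r0 by (rule degree_mult_eq)
    ultimately show ?thesis using dega[of th1] by simp
  next
    case True
    then have "beta p th0 q \<noteq> 0" using last by simp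
    then have "q \<le> degree (?b th0)" using q by (intro le_degree) (simp add: coeff_bpoly)
    moreover have "degree (?b th1) = degree (?b th0) + degree r" unfolding r using b0 r0 by (intro degree_mult_eq) auto
    ultimately show ?thesis using degb[of th1] by simp
  qed
  then obtain c where c: "r = [:c:]" by (auto elim: degree_eq_zeroE)
  have "coeff (?b th1) 0 = coeff (?b th0) 0 * c" unfolding r c by (simp add: coeff_mult_0)
  then have "c = 1" by (simp add: coeff_bpoly)
  then have "?a th1 = ?a th0" "?b th1 = ?b th0" using ar r c by (simp_all add: pCons_one)
  then have ca: "coeff (?a th1) n = coeff (?a th0) n" and cb: "coeff (?b th1) n = coeff (?b th0) n" for n by simp_all
  have "alpha th1 i = alpha th0 i" if "i \<in> {1..p}" for i using ca[of i] that by (simp add: coeff_apoly)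
  moreover have "beta p th1 j = beta p th0 j" if "j \<in> {1..q}" for j using cb[of j] that by (simp add: coeff_bpoly)
  ultimately show ?thesis by blast
qed

text \<open>Sum and difference of the equations give equal values of \<open>g / (1 + g^2)\<close>,
  which is injective on [-1, 1]: the difference factors as \<open>(g - g') * (1 - g * g')\<close>,
  and the second factor vanishes only at a common endpoint.\<close>

lemma leverage_identify:
  fixes h h' g g' :: real
  assumes e: "h * (1 - g)\<^sup>2 = h' * (1 - g')\<^sup>2" "h * (1 + g)\<^sup>2 = h' * (1 + g')\<^sup>2"
    and h': "h' > 0" and g: "\<bar>g\<bar> \<le> 1" "\<bar>g'\<bar> \<le> 1"
  shows "g = g'"
proof -
  have s: "h * (1 + g\<^sup>2) = h' * (1 + g'\<^sup>2)" and d: "h * g = h' * g'"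
    using e by (simp_all add: power2_eq_square algebra_simps)
  have "h' * (g' * (1 + g\<^sup>2)) = (h * (1 + g\<^sup>2)) * g" using d by (simp add: algebra_simps)
  also have "\<dots> = h' * (g * (1 + g'\<^sup>2))" unfolding s by simp
  finally have "g' * (1 + g\<^sup>2) = g * (1 + g'\<^sup>2)" using h' by simp
  then have "(g - g') * (1 - g * g') = 0" by (simp add: power2_eq_square algebra_simps)
  then consider "g = g'" | "g * g' = 1" by auto
  then show ?thesis
  proof cases
    case 2
    then have "\<bar>g\<bar> * \<bar>g'\<bar> = 1" by (metis abs_mult abs_one)
    moreover have "\<bar>g\<bar> * \<bar>g'\<bar> \<le> \<bar>g\<bar>" using g by (simp add: mult_left_le)
    ultimately have "\<bar>g\<bar> = 1" using g by linarith
    then have "g = 1 \<or> g = - 1" by linarith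
    then show ?thesis
    proof
      assume "g = 1" then show ?thesis using 2 by simp
    next
      assume "g = - 1" then show ?thesis using 2 by simp
    qed
  qed
qed

section \<open>The model on the innovation space and identification by independence\<close>

locale agarch_model = agarch_seq D "max p q" "alpha0 th0" "gam p q th0"
    "\<lambda>j. if j \<le> p then alpha th0 j else 0" "\<lambda>j. if j \<le> q then beta p th0 j else 0"
  for D :: "real measure" and p q :: nat and th0 :: "nat \<Rightarrow> real" +
  assumes p_pos: "p \<ge> 1" and q_pos: "q \<ge> 1" and th0: "th0 \<in> param_space p q"
    and mean_int: "integrable D (\<lambda>x. x)" and mean: "(\<integral>x. x \<partial>D) = 0"
    and not_two: "\<And>a b. D.prob {a, b} < 1"
begin

sublocale P0: garch_param p q th0 0
  using th0 q_pos by unfold_locales (auto simp: param_space_def Bset_def)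

definition ret :: "(int \<Rightarrow> real) \<Rightarrow> int \<Rightarrow> real" where
  "ret z t = sqrt (vol2 z t) * z t"

lemma ret_tshift: "ret (tshift k z) t = ret z (t + k)"
  by (simp add: ret_def vol2_tshift)

lemma measurable_ret [measurable]: "(\<lambda>z. ret z t) \<in> borel_measurable P"
  unfolding ret_def by measurable

lemma depends_ret: "depends_on (\<lambda>z. ret z t) {..t}"
  unfolding depends_on_def
proof (intro allI impI)
  fix z z' :: "int \<Rightarrow> real" assume zz: "\<forall>i\<in>{..t}. z i = z' i"
  then have "vol2 z t = vol2 z' t" using depends_vol2[of t] unfolding depends_on_def by auto
  then show "ret z t = ret z' t" using zz by (simp add: ret_def)
qed

lemma env_shift: "env p q th s (\<lambda>t. x (t + k)) t = env p q th s x (t + k)"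
  unfolding env_def env_src_def by (simp add: algebra_simps)

lemma env_ret_tshift: "env p q th s (ret (tshift k z)) t = env p q th s (ret z) (t + k)"
proof -
  have "ret (tshift k z) = (\<lambda>t. ret z (t + k))" by (simp add: fun_eq_iff ret_tshift)
  then show ?thesis by (simp add: env_shift)
qed

lemma measurable_env_ret [measurable]: "(\<lambda>z. env p q th s (ret z) t) \<in> borel_measurable P"
  unfolding env_def env_src_def env_news_def by measurable

lemma depends_env_ret: "depends_on (\<lambda>z. env p q th s (ret z) t) {..<t}"
  unfolding depends_on_def
proof (intro allI impI)
  fix z z' :: "int \<Rightarrow> real" assume zz: "\<forall>i\<in>{..<t}. z i = z' i"
  have "ret z u = ret z' u" if "u < t" for u
    using depends_ret[of u] zz that unfolding depends_on_def by auto
  then show "env p q th s (ret z) t = env p q th s (ret z') t"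
    unfolding env_def env_src_def by (auto intro!: suminf_cong sum.cong arg_cong2[of _ _ _ _ "(*)"] arg_cong2[of _ _ _ _ "(+)"])
qed

definition regular :: "(int \<Rightarrow> real) \<Rightarrow> bool" where
  "regular z \<longleftrightarrow> stable z \<and> tempered (\<lambda>t. (ret z t)\<^sup>2) \<and> tempered (vol2 z) \<and>
     (\<forall>\<rho>. 0 < \<rho> \<longrightarrow> \<rho> < 1 \<longrightarrow> summable (\<lambda>k. \<rho> ^ k * (ret z (int k))\<^sup>2))"

lemma AE_regular: "AE z in P. regular z"
  using AE_stable AE_subexponential
proof eventually_elim
  case (elim z)
  have v: "0 \<le> vol2 z t" for t using vol2_ge[OF elim(1), of t] P0.alpha0_pos by linarith
  have r: "(ret z t)\<^sup>2 = (z t)\<^sup>2 * vol2 z t" for t using v by (simp add: ret_def power_mult_distrib)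
  have le: "(ret z t)\<^sup>2 \<le> (1 + (z t)\<^sup>2) * vol2 z t" "vol2 z t \<le> (1 + (z t)\<^sup>2) * vol2 z t" for t
    unfolding r using v[of t] by (simp_all add: distrib_right)
  have T: "tempered (\<lambda>t. (1 + (z t)\<^sup>2) * vol2 z t)"
    unfolding tempered_def using elim(2) v by auto
  have "summable (\<lambda>k. \<rho> ^ k * (ret z (int k))\<^sup>2)" if "0 < \<rho>" "\<rho> < 1" for \<rho>
  proof (rule summable_comparison_test'[where N=0])
    show "summable (\<lambda>k. \<rho> ^ k * ((1 + (z (int k))\<^sup>2) * vol2 z (int k)))" using elim(2) that by blast
    show "norm (\<rho> ^ k * (ret z (int k))\<^sup>2) \<le> \<rho> ^ k * ((1 + (z (int k))\<^sup>2) * vol2 z (int k))" for k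
      using that le(1)[of "int k"] by (simp add: mult_left_mono)
  qed
  moreover have "tempered (\<lambda>t. (ret z t)\<^sup>2)" using T le by (rule_tac tempered_le) auto
  moreover have "tempered (vol2 z)" using T le v by (rule_tac tempered_le) auto
  ultimately show ?case unfolding regular_def using elim(1) by blast
qed

lemma regular_tshift: "regular z \<Longrightarrow> tempered (\<lambda>t. (ret (tshift k z) t)\<^sup>2)" "regular z \<Longrightarrow> tempered (vol2 (tshift k z))"
  using tempered_shift[of "\<lambda>t. (ret z t)\<^sup>2" "-k"] tempered_shift[of "vol2 z" "-k"]
  unfolding regular_def by (simp_all add: ret_tshift vol2_tshift[abs_def])

lemma news_scale: "0 \<le> v \<Longrightarrow> (\<bar>sqrt v * y\<bar> - g * (sqrt v * y))\<^sup>2 = v * (\<bar>y\<bar> - g * y)\<^sup>2"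
proof -
  assume "0 \<le> v"
  have "\<bar>sqrt v * y\<bar> - g * (sqrt v * y) = sqrt v * (\<bar>y\<bar> - g * y)"
    using \<open>0 \<le> v\<close> by (simp add: abs_mult algebra_simps)
  then show ?thesis using \<open>0 \<le> v\<close> by (simp add: power_mult_distrib)
qed

lemma vol2_env_rec:
  assumes "stable z"
  shows "vol2 z t = env_src p q th0 0 (ret z) t + (\<Sum>j=1..q. env_b p th0 0 j * vol2 z (t - int j))"
proof -
  have v: "0 \<le> vol2 z t" for t using vol2_ge[OF assms, of t] P0.alpha0_pos by linarith
  let ?d = "max p q"
  have "vol2 z t = alpha0 th0 + (\<Sum>j=1..?d. cf z j (t - int j) * vol2 z (t - int j))" by (rule vol2_rec[OF assms])
  also have "(\<Sum>j=1..?d. cf z j (t - int j) * vol2 z (t - int j)) =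
    (\<Sum>j=1..?d. if j \<le> p then alpha th0 j * (\<bar>ret z (t - int j)\<bar> - gam p q th0 * ret z (t - int j))\<^sup>2 else 0)
    + (\<Sum>j=1..?d. if j \<le> q then beta p th0 j * vol2 z (t - int j) else 0)"
    unfolding sum.distrib[symmetric]
    by (intro sum.cong refl, unfold cf_def ret_def news_scale[OF v]) (auto simp: distrib_right mult_ac)
  also have "(\<Sum>j=1..?d. if j \<le> p then alpha th0 j * (\<bar>ret z (t - int j)\<bar> - gam p q th0 * ret z (t - int j))\<^sup>2 else 0)
    = (\<Sum>i=1..p. max 0 (alpha th0 i + 0) * env_news (gam p q th0) 0 (ret z (t - int i)))"
    using P0.alpha_nonneg by (intro sum.mono_neutral_cong_right) (auto simp: env_news_0[OF P0.gam_le])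
  also have "(\<Sum>j=1..?d. if j \<le> q then beta p th0 j * vol2 z (t - int j) else 0) = (\<Sum>j=1..q. env_b p th0 0 j * vol2 z (t - int j))"
    using P0.beta_nonneg by (intro sum.mono_neutral_cong_right) (auto simp: env_b_def)
  finally show ?thesis unfolding env_src_def by simp
qed

text \<open>Links the two descriptions of the volatility: built from innovations and filtered from
  returns. Both are tempered solutions of the same observation-driven recursion, so uniqueness
  identifies them.\<close>

lemma vol2_eq_env:
  assumes "regular z"
  shows "vol2 z t = env p q th0 0 (ret z) t"
proof -
  interpret C: contractive_filter q "env_b p th0 0" by (rule P0.contractive) simp
  have st: "stable z" using assms by (simp add: regular_def)
  have "vol2 (tshift t z) 0 = (\<Sum>l. psi q (env_b p th0 0) l * env_src p q th0 0 (ret (tshift t z)) (0 - int l))"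
  proof (rule C.tempered_solution_unique)
    show "tempered (env_src p q th0 0 (ret (tshift t z)))"
      by (rule P0.tempered_env_src[OF regular_tshift(1)[OF assms]]) simp
    show "tempered (vol2 (tshift t z))" by (rule regular_tshift(2)[OF assms])
    have "stable (tshift t z)" using st unfolding stable_def vstep_tshift by blast
    then show "vol2 (tshift t z) s = env_src p q th0 0 (ret (tshift t z)) s + (\<Sum>j=1..q. env_b p th0 0 j * vol2 (tshift t z) (s - int j))" for s
      by (rule vol2_env_rec)
  qed
  then show ?thesis using env_ret_tshift[of th0 0 t z 0] unfolding vol2_tshift env_def by simp
qed

lemma AE_coord: "AE z in P. Q (z t) \<Longrightarrow> {x. Q x} \<in> sets borel \<Longrightarrow> AE x in D. Q x"
proof -
  assume *: "AE z in P. Q (z t)" "{x. Q x} \<in> sets borel"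
  then have "AE x in distr P borel (\<lambda>z. z t). Q x" by (subst AE_distr_iff) auto
  then show ?thesis by (simp only: distr_coord)
qed

text \<open>The joint law of the two variables is a product measure carried by the diagonal. Hence
  for some value w of the past the other marginal is the point mass at w.\<close>

lemma coord_eq_past_imp_const:
  assumes [measurable]: "f \<in> borel_measurable borel" "W \<in> borel_measurable P"
    and dep: "depends_on W {..<t}" and eq: "AE z in P. f (z t) = (W z :: real)"
  shows "\<exists>c. AE x in D. f x = c"
proof -
  have ind: "P.indep_var borel (\<lambda>z. f (z t)) borel W"
    by (rule indep_depends_on[of _ _ _ _ "{t}" "{..<t}"]) (auto intro: dep depends_coord)
  let ?F = "distr P borel (\<lambda>z. f (z t))" and ?W = "distr P borel W"
  interpret F: prob_space ?F by (rule P.prob_space_distr) simp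
  interpret W: prob_space ?W by (rule P.prob_space_distr) simp
  interpret FW: pair_prob_space ?W ?F ..
  have "P.indep_var borel W borel (\<lambda>z. f (z t))"
    by (rule indep_depends_on[of _ _ _ _ "{..<t}" "{t}"]) (auto intro: dep depends_coord)
  then have d: "?W \<Otimes>\<^sub>M ?F = distr P (borel \<Otimes>\<^sub>M borel) (\<lambda>z. (W z, f (z t)))"
    unfolding P.indep_var_distribution_eq by blast
  have "AE y in ?W \<Otimes>\<^sub>M ?F. snd y = fst y"
    unfolding d by (subst AE_distr_iff) (use eq in auto)
  then have "AE w in ?W. AE y in ?F. y = w"
    by (auto dest!: FW.AE_pair)
  moreover have "\<exists>w. Q w" if "AE w in ?W. Q w" for Q
  proof (rule ccontr)
    assume n: "\<not> (\<exists>w. Q w)"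
    have "AE w in ?W. False" using that by eventually_elim (use n in blast)
    then show False using W.AE_False by simp
  qed
  ultimately obtain w where "AE y in ?F. y = w" by blast
  then have "AE z in P. f (z t) = w" by (subst (asm) AE_distr_iff) auto
  then have "AE x in D. f x = w" by (rule AE_coord) measurable
  then show ?thesis ..
qed

text \<open>An innovation of one sign with mean zero would vanish almost surely, against the second
  moment 1.\<close>

lemma prob_pos_neg: "0 < D.prob {x. 0 < x}" "0 < D.prob {x. x < 0}"
proof -
  have m: "{x. 0 < x} \<in> sets D" "{x. x < 0} \<in> sets D" unfolding sets_D by auto
  have contra: "False" if "AE x in D. 0 \<le> s * x" "s \<noteq> 0" for s
  proof -
    have "(\<integral>x. s * x \<partial>D) = 0" using mean by simp
    then have "AE x in D. s * x = 0"
      using integral_nonneg_eq_0_iff_AE[OF integrable_mult_right[OF mean_int, of s] that(1)] by blast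
    then have "(\<integral>\<^sup>+x. ennreal (x\<^sup>2) \<partial>D) = (\<integral>\<^sup>+x. 0 \<partial>D)"
      using that by (intro nn_integral_cong_AE) (auto simp: ennreal_eq_0_iff)
    then show False using second_moment by simp
  qed
  show "0 < D.prob {x. 0 < x}"
  proof (rule ccontr)
    assume "\<not> 0 < D.prob {x. 0 < x}"
    then have "D.prob {x. 0 < x} = 0" using measure_nonneg[of D "{x. 0 < x}"] by linarith
    then have "AE x in D. x \<notin> {x. 0 < x}" using D.prob_eq_0[OF m(1)] by simp
    then have "AE x in D. 0 \<le> (-1) * x" by eventually_elim auto
    then show False using contra[of "-1"] by simp
  qed
  show "0 < D.prob {x. x < 0}"
  proof (rule ccontr)
    assume "\<not> 0 < D.prob {x. x < 0}"
    then have "D.prob {x. x < 0} = 0" using measure_nonneg[of D "{x. x < 0}"] by linarith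
    then have "AE x in D. x \<notin> {x. x < 0}" using D.prob_eq_0[OF m(2)] by simp
    then have "AE x in D. 0 \<le> 1 * x" by eventually_elim auto
    then show False using contra[of 1] by simp
  qed
qed

lemma AE_exists_pos_neg:
  assumes "AE x in D. Q x" shows "\<exists>x>0. Q x" "\<exists>x<0. Q x"
proof -
  have m: "{x. 0 < x} \<in> sets D" "{x. x < 0} \<in> sets D" unfolding sets_D by auto
  show "\<exists>x>0. Q x"
  proof (rule ccontr)
    assume n: "\<not> (\<exists>x>0. Q x)"
    have "AE x in D. x \<notin> {x. 0 < x}" using assms by eventually_elim (use n in auto)
    then show False using prob_pos_neg(1) D.prob_eq_0[OF m(1)] by simp
  qed
  show "\<exists>x<0. Q x"
  proof (rule ccontr)
    assume n: "\<not> (\<exists>x<0. Q x)"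
    have "AE x in D. x \<notin> {x. x < 0}" using assms by eventually_elim (use n in auto)
    then show False using prob_pos_neg(2) D.prob_eq_0[OF m(2)] by simp
  qed
qed

text \<open>A nonzero constant value would determine \<open>y\<close> up to its sign, and the law of the innovations
  would sit on two points.\<close>
lemma news_difference_const:
  assumes c: "AE y in D. h * (\<bar>y\<bar> - g * y)\<^sup>2 - h' * (\<bar>y\<bar> - g' * y)\<^sup>2 = c"
  shows "h * (1 - g)\<^sup>2 = h' * (1 - g')\<^sup>2" "h * (1 + g)\<^sup>2 = h' * (1 + g')\<^sup>2"
proof -
  define lp where "lp = h * (1 - g)\<^sup>2 - h' * (1 - g')\<^sup>2"
  define ln where "ln = h * (1 + g)\<^sup>2 - h' * (1 + g')\<^sup>2"
  have pos: "h * (\<bar>y\<bar> - g * y)\<^sup>2 - h' * (\<bar>y\<bar> - g' * y)\<^sup>2 = lp * y\<^sup>2" if "y \<ge> 0" for y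
    using that by (simp add: lp_def power2_eq_square algebra_simps)
  have neg: "h * (\<bar>y\<bar> - g * y)\<^sup>2 - h' * (\<bar>y\<bar> - g' * y)\<^sup>2 = ln * y\<^sup>2" if "y \<le> 0" for y
    using that by (simp add: ln_def power2_eq_square algebra_simps)
  have c0: "c = 0"
  proof (rule ccontr)
    assume c0: "c \<noteq> 0"
    \<comment> \<open>When \<open>lp\<close> is zero the first point is only the default value of
      division by zero, but then no \<open>y >= 0\<close> satisfies the equation, as c is nonzero.
      The same holds for \<open>ln\<close> and negative y.\<close>
    have "AE y in D. y \<in> {sqrt (c / lp), - sqrt (c / ln)}"
      using c
    proof eventually_elim
      case (elim y)
      show ?case
      proof (cases "y \<ge> 0")
        case True
        then have "lp * y\<^sup>2 = c" using pos elim by simp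
        then have "y\<^sup>2 = c / lp" using c0 by (auto simp: field_simps)
        then have "sqrt (c / lp) = y" using True real_sqrt_abs[of y] by simp
        then show ?thesis by simp
      next
        case False
        then have "ln * y\<^sup>2 = c" using neg elim by simp
        then have "y\<^sup>2 = c / ln" using c0 by (auto simp: field_simps)
        then have "sqrt (c / ln) = - y" using False real_sqrt_abs[of y] by simp
        then show ?thesis by simp
      qed
    qed
    then have "D.prob {sqrt (c / lp), - sqrt (c / ln)} = 1"
      by (subst D.prob_eq_1) (auto simp: sets_D)
    then show False using not_two[of "sqrt (c / lp)" "- sqrt (c / ln)"] by simp
  qed
  obtain y where "y > 0" "h * (\<bar>y\<bar> - g * y)\<^sup>2 - h' * (\<bar>y\<bar> - g' * y)\<^sup>2 = c" using AE_exists_pos_neg(1)[OF c] by blast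
  then have "lp * y\<^sup>2 = 0" "y \<noteq> 0" using pos[of y] c0 by auto
  then show "h * (1 - g)\<^sup>2 = h' * (1 - g')\<^sup>2" by (simp add: lp_def)
  obtain y where "y < 0" "h * (\<bar>y\<bar> - g * y)\<^sup>2 - h' * (\<bar>y\<bar> - g' * y)\<^sup>2 = c" using AE_exists_pos_neg(2)[OF c] by blast
  then have "ln * y\<^sup>2 = 0" "y \<noteq> 0" using neg[of y] c0 by auto
  then show "h * (1 + g)\<^sup>2 = h' * (1 + g')\<^sup>2" by (simp add: ln_def)
qed

lemma news_eq_of_signs:
  assumes "h * (1 - g)\<^sup>2 = h' * (1 - g')\<^sup>2" "h * (1 + g)\<^sup>2 = h' * (1 + g')\<^sup>2"
  shows "h * (\<bar>y\<bar> - g * y)\<^sup>2 = h' * (\<bar>y\<bar> - g' * y :: real)\<^sup>2"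
proof (cases "y \<ge> 0")
  case True
  then have "h * (\<bar>y\<bar> - g * y)\<^sup>2 = (h * (1 - g)\<^sup>2) * y\<^sup>2" for h g :: real
    by (simp add: power2_eq_square algebra_simps)
  then show ?thesis by (simp only: assms(1))
next
  case False
  then have "h * (\<bar>y\<bar> - g * y)\<^sup>2 = (h * (1 + g)\<^sup>2) * y\<^sup>2" for h g :: real
    by (simp add: power2_eq_square algebra_simps)
  then show ?thesis by (simp only: assms(2))
qed

text \<open>Peels off one lag at a time. Once the terms of smaller lag cancel, the lag-m term
  divided by the volatility at \<open>- m\<close> is a function of the innovation at
  \<open>- m\<close> alone and equals a function of earlier ones; so it is constant, and
  \<open>news_difference_const\<close> applies.\<close>

lemma gcoef_signs_eq:
  assumes p1: "garch_param p q th1 0"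
    and eq: "AE z in P. env p q th1 0 (ret z) 0 = env p q th0 0 (ret z) 0"
  shows "gcoef p q th1 m * (1 - gam p q th1)\<^sup>2 = gcoef p q th0 m * (1 - gam p q th0)\<^sup>2 \<and>
    gcoef p q th1 m * (1 + gam p q th1)\<^sup>2 = gcoef p q th0 m * (1 + gam p q th0)\<^sup>2"
proof (induction m rule: less_induct)
  case (less m)
  interpret P1: garch_param p q th1 0 by fact
  define F where "F k y = gcoef p q th1 k * (\<bar>y\<bar> - gam p q th1 * y)\<^sup>2 - gcoef p q th0 k * (\<bar>y\<bar> - gam p q th0 * y)\<^sup>2" for k y
  have [measurable]: "F k \<in> borel_measurable borel" for k unfolding F_def by measurable
  define K where "K = alpha0 th0 * (\<Sum>l. psi q (beta p th0) l) - alpha0 th1 * (\<Sum>l. psi q (beta p th1) l)"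
  have Fz: "F k y = 0" if "k < m" for k y
    unfolding F_def using less[OF that] news_eq_of_signs[of "gcoef p q th1 k" "gam p q th1" "gcoef p q th0 k" "gam p q th0" y] by simp
  define R where "R z = (\<Sum>l. F (l + Suc m) (ret z (- int (l + Suc m))))" for z
  have Rm[measurable]: "R \<in> borel_measurable P" unfolding R_def by measurable
  have Rd: "depends_on R {..<- int m}"
    unfolding depends_on_def R_def
  proof (intro allI impI suminf_cong arg_cong[of _ _ "F _"])
    fix z z' :: "int \<Rightarrow> real" and l assume zz: "\<forall>i\<in>{..<- int m}. z i = z' i"
    then have "\<forall>i\<in>{..- int (l + Suc m)}. z i = z' i" by auto
    then show "ret z (- int (l + Suc m)) = ret z' (- int (l + Suc m))"
      using depends_ret[of "- int (l + Suc m)"] unfolding depends_on_def by blast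
  qed
  have "AE z in P. F m (z (- int m)) = (K - R z) / vol2 z (- int m)"
    using eq AE_regular
  proof eventually_elim
    case (elim z)
    have tm: "tempered (\<lambda>t. (ret z t)\<^sup>2)" and st: "stable z" using elim by (auto simp: regular_def)
    have v: "0 < vol2 z (- int m)" using vol2_ge[OF st, of "- int m"] P0.alpha0_pos by linarith
    have s: "(\<lambda>k. F k (ret z (- int k))) sums K"
      using sums_diff[OF P1.env_0_expansion[OF tm] P0.env_0_expansion[OF tm]] elim(1)
      unfolding F_def K_def by (simp add: algebra_simps)
    have "(\<Sum>k. F k (ret z (- int k))) = R z + (\<Sum>k<Suc m. F k (ret z (- int k)))"
      unfolding R_def by (rule suminf_split_initial_segment) (use s in \<open>simp add: sums_iff\<close>)
    also have "(\<Sum>k<Suc m. F k (ret z (- int k))) = F m (ret z (- int m))" using Fz by simp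
    also have "F m (ret z (- int m)) = vol2 z (- int m) * F m (z (- int m))"
      unfolding F_def ret_def news_scale[OF less_imp_le[OF v]] by (simp add: algebra_simps)
    finally have "K = R z + vol2 z (- int m) * F m (z (- int m))" using s by (simp add: sums_iff)
    then show ?case using v by (simp add: field_simps)
  qed
  then have "\<exists>c. AE x in D. F m x = c"
  proof (rule coord_eq_past_imp_const[rotated 3])
    show "depends_on (\<lambda>z. (K - R z) / vol2 z (- int m)) {..<- int m}"
      unfolding depends_on_def
    proof (intro allI impI)
      fix z z' :: "int \<Rightarrow> real" assume zz: "\<forall>i\<in>{..<- int m}. z i = z' i"
      have "R z = R z'" using Rd zz unfolding depends_on_def by blast
      moreover have "vol2 z (- int m) = vol2 z' (- int m)"
        using depends_vol2[of "- int m"] zz unfolding depends_on_def by blast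
      ultimately show "(K - R z) / vol2 z (- int m) = (K - R z') / vol2 z' (- int m)" by simp
    qed
  qed measurable
  then obtain c where "AE x in D. F m x = c" by blast
  then show ?case unfolding F_def using news_difference_const by blast
qed

lemma env_identify:
  assumes p1: "garch_param p q th1 0"
    and eq: "AE z in P. env p q th1 0 (ret z) 0 = env p q th0 0 (ret z) 0"
    and pos: "\<exists>i\<in>{1..p}. alpha th0 i > 0"
    and last: "(alpha th0 p, beta p th0 q) \<noteq> (0, 0)"
    and cop: "\<not> (\<exists>z::complex. (\<Sum>i=1..p. of_real (alpha th0 i) * z ^ i) = 0
                     \<and> 1 - (\<Sum>j=1..q. of_real (beta p th0 j) * z ^ j) = 0)"
  shows "th1 = th0"
proof -
  interpret P1: garch_param p q th1 0 by fact
  note sg = gcoef_signs_eq[OF p1 eq]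
  obtain i where i: "i \<in> {1..p}" "alpha th0 i > 0" using pos by blast
  have gpos: "0 < gcoef p q th0 i"
  proof -
    have "alpha th0 i \<le> (if i \<le> i then alpha th0 i * psi q (beta p th0) (i - i) else 0)" by simp
    also have "\<dots> \<le> gcoef p q th0 i" unfolding gcoef_def
      using i P0.alpha_nonneg P0.beta_nonneg
      by (intro member_le_sum[where f="\<lambda>k. if k \<le> i then alpha th0 k * psi q (beta p th0) (i - k) else 0"])
         (auto intro!: mult_nonneg_nonneg psi_nonneg)
    finally show ?thesis using i by linarith
  qed
  have gam: "gam p q th1 = gam p q th0"
    using leverage_identify[OF conjunct1[OF sg[of i]] conjunct2[OF sg[of i]] gpos P1.gam_le P0.gam_le] .
  \<comment> \<open>With equal gam, the factors \<open>(1 - gam)^2\<close> and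
    \<open>(1 + gam)^2\<close> cannot both vanish, so one of the two equations can be cancelled at
    every lag.\<close>
  have gc: "gcoef p q th1 m = gcoef p q th0 m" for m
  proof (cases "gam p q th0 = 1")
    case True
    then show ?thesis using sg[of m] gam by simp
  next
    case False
    then show ?thesis using sg[of m] gam by simp
  qed
  have ab: "(\<forall>i\<in>{1..p}. alpha th1 i = alpha th0 i) \<and> (\<forall>j\<in>{1..q}. beta p th1 j = beta p th0 j)"
    by (rule gcoef_identify[OF gc p_pos q_pos pos last cop])
  have ps: "psi q (beta p th1) l = psi q (beta p th0) l" for l using ab by (intro psi_cong) auto
  have "AE z in P. alpha0 th1 * (\<Sum>l. psi q (beta p th0) l) = alpha0 th0 * (\<Sum>l. psi q (beta p th0) l)"
    using eq AE_regular
  proof eventually_elim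
    case (elim z)
    have tm: "tempered (\<lambda>t. (ret z t)\<^sup>2)" using elim by (auto simp: regular_def)
    show ?case using sums_unique2[OF P1.env_0_expansion[OF tm, unfolded gam gc] P0.env_0_expansion[OF tm]] elim(1)
      unfolding ps by simp
  qed
  then have "alpha0 th1 * (\<Sum>l. psi q (beta p th0) l) = alpha0 th0 * (\<Sum>l. psi q (beta p th0) l)" by simp
  moreover have "0 < (\<Sum>l. psi q (beta p th0) l)"
  proof -
    interpret C: contractive_filter q "env_b p th0 0" by (rule P0.contractive) simp
    have "summable (\<lambda>l. psi q (beta p th0) l)" using C.summable_psi[OF tempered_const[of 1]] unfolding P0.psi_env_0 by simp
    then show ?thesis using P0.beta_nonneg by (intro suminf_pos2[of _ 0]) (auto intro: psi_nonneg)
  qed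
  ultimately have a0: "alpha0 th1 = alpha0 th0" by simp
  show ?thesis
  proof
    fix k
    consider "k = 0" | "k \<in> {1..p}" | "k \<in> {p+1..p+q}" | "k = p + q + 1" | "k > p + q + 1"
      by (cases "k = 0"; cases "k \<le> p"; cases "k \<le> p + q"; cases "k = p + q + 1") auto
    then show "th1 k = th0 k"
    proof cases
      case 1 then show ?thesis using a0 by (simp add: alpha0_def)
    next
      case 2 then show ?thesis using ab by (simp add: alpha_def)
    next
      case 3
      then have "k - p \<in> {1..q}" "p + (k - p) = k" by auto
      then show ?thesis using ab unfolding beta_def by metis
    next
      case 4 then show ?thesis using gam by (simp add: gam_def)
    next
      case 5 then show ?thesis using P0.th P1.th by (simp add: param_space_def)
    qed
  qed
qed

end

section \<open>Separation of the likelihood and consistency\<close>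

lemma garch_param_exists:
  assumes th: "th \<in> param_space p q" and q: "q \<ge> 1"
  shows "\<exists>r>0. garch_param p q th r"
proof -
  define S where "S = (\<Sum>j=1..q. beta p th j)"
  have S: "S < 1" and a: "0 < alpha0 th" using th by (auto simp: S_def param_space_def Bset_def)
  \<comment> \<open>Half of the slack in each strict inequality, spread over the q beta
    coefficients.\<close>
  define r where "r = min 1 (min (alpha0 th / 2) ((1 - S) / (2 * real q)))"
  have r: "0 < r" using S a q by (simp add: r_def)
  have "r \<le> (1 - S) / (2 * real q)" by (simp add: r_def)
  then have "real q * r \<le> (1 - S) / 2" using q by (simp add: field_simps)
  moreover have "(\<Sum>j=1..q. beta p th j + r) = S + real q * r" by (simp add: sum.distrib S_def)
  moreover have "S + x < 1" if "x \<le> (1 - S) / 2" for x using that S by simp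
  ultimately have "(\<Sum>j=1..q. beta p th j + r) < 1" by simp
  moreover have "r \<le> alpha0 th / 2" by (simp add: r_def)
  then have "r < alpha0 th" using a by simp
  ultimately have "garch_param p q th r" using th q r by unfold_locales (auto simp: r_def)
  then show ?thesis using r by blast
qed

lemma garch_param_mono: "garch_param p q th r \<Longrightarrow> 0 \<le> s \<Longrightarrow> s \<le> r \<Longrightarrow> garch_param p q th s"
proof (unfold garch_param_def, elim conjE, intro conjI)
  assume "0 \<le> s" "s \<le> r" "(\<Sum>j=1..q. beta p th j + r) < 1"
  then show "(\<Sum>j=1..q. beta p th j + s) < 1"
    by (meson add_left_mono le_less_trans sum_mono)
qed auto

lemma tendsto_funI:
  fixes f :: "'a \<Rightarrow> 'b \<Rightarrow> 'c::topological_space"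
  assumes "\<And>i. ((\<lambda>n. f n i) \<longlongrightarrow> l i) F"
  shows "(f \<longlongrightarrow> l) F"
proof -
  have "limitin (product_topology (\<lambda>_. euclidean) UNIV) f l F"
    unfolding limitin_componentwise using assms by auto
  then show ?thesis by (simp add: euclidean_product_topology)
qed

context agarch_model
begin

text \<open>A lower bound, up to the summable effect of the initial values, for twice the
  contribution of one observation to the likelihood deficit, simultaneously for all parameters
  within distance s of th. For \<open>s = 0\<close> it is the stationary deficit of th
  itself.\<close>

definition gap :: "(nat \<Rightarrow> real) \<Rightarrow> real \<Rightarrow> (int \<Rightarrow> real) \<Rightarrow> real" where
  "gap th s z = (ret z 0)\<^sup>2 / env p q th s (ret z) 0 + ln (env p q th (- s) (ret z) 0)
     - (ret z 0)\<^sup>2 / env p q th0 0 (ret z) 0 - ln (env p q th0 0 (ret z) 0)"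

lemma measurable_gap [measurable]: "gap th s \<in> borel_measurable P"
  unfolding gap_def by measurable

lemma vol2_pos: "regular z \<Longrightarrow> 0 < vol2 z t"
  using vol2_ge[of z t] P0.alpha0_pos unfolding regular_def by linarith

lemma gap_eq:
  assumes "regular z"
  shows "gap th s z = (ret z 0)\<^sup>2 / env p q th s (ret z) 0 + ln (env p q th (- s) (ret z) 0) - (z 0)\<^sup>2 - ln (vol2 z 0)"
proof -
  have "(ret z 0)\<^sup>2 / vol2 z 0 = (z 0)\<^sup>2"
    using vol2_pos[OF assms, of 0] by (simp add: ret_def power_mult_distrib)
  then show ?thesis unfolding gap_def vol2_eq_env[OF assms, symmetric] by simp
qed

lemma integrable_sq_D: "integrable D (\<lambda>x. x\<^sup>2)" and integral_sq_D: "(\<integral>x. x\<^sup>2 \<partial>D) = 1"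
proof -
  show i: "integrable D (\<lambda>x. x\<^sup>2)"
    by (rule integrableI_nonneg) (auto simp: measurable_D second_moment)
  have "ennreal (\<integral>x. x\<^sup>2 \<partial>D) = 1"
    using nn_integral_eq_integral[OF i] second_moment by simp
  then show "(\<integral>x. x\<^sup>2 \<partial>D) = 1" by (simp add: ennreal_eq_1)
qed

lemma integrable_sq: "integrable P (\<lambda>z. (z t)\<^sup>2)"
proof (rule integrableI_nonneg)
  show "(\<integral>\<^sup>+z. ennreal ((z t)\<^sup>2) \<partial>P) < \<infinity>"
    using nn_integral_coord[of "\<lambda>x. ennreal (x\<^sup>2)" t] second_moment by simp
qed auto

text \<open>From below the volatility is bounded by its constant term; from above
  \<open>ln v <= v powr s / s\<close>, which the fractional moment controls.\<close>

lemma integrable_ln_vol2: "integrable P (\<lambda>z. ln (vol2 z 0))"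
proof -
  obtain s where s: "0 < s" "s \<le> 1" and fin: "(\<integral>\<^sup>+z. ennreal (((1 + (z 0)\<^sup>2) * vol2 z 0) powr s) \<partial>P) < \<infinity>"
    using vol2_moment by blast
  have i: "integrable P (\<lambda>z. ((1 + (z 0)\<^sup>2) * vol2 z 0) powr s)"
    by (rule integrableI_nonneg) (use fin in auto)
  show ?thesis
  proof (rule Bochner_Integration.integrable_bound)
    show "integrable P (\<lambda>z. \<bar>ln (alpha0 th0)\<bar> + ((1 + (z 0)\<^sup>2) * vol2 z 0) powr s / s)" using i by auto
    show "AE z in P. norm (ln (vol2 z 0)) \<le> norm (\<bar>ln (alpha0 th0)\<bar> + ((1 + (z 0)\<^sup>2) * vol2 z 0) powr s / s)"
      using AE_regular
    proof eventually_elim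
      case (elim z)
      have v: "0 < vol2 z 0" "alpha0 th0 \<le> vol2 z 0" using vol2_pos[OF elim] vol2_ge[of z 0] elim by (auto simp: regular_def)
      have lo: "- \<bar>ln (alpha0 th0)\<bar> \<le> ln (vol2 z 0)"
        using v P0.alpha0_pos ln_mono[of "alpha0 th0" "vol2 z 0"] by linarith
      have "vol2 z 0 powr s \<le> ((1 + (z 0)\<^sup>2) * vol2 z 0) powr s"
        using v s by (intro powr_mono2) (auto simp: distrib_right)
      then have p: "vol2 z 0 powr s / s \<le> ((1 + (z 0)\<^sup>2) * vol2 z 0) powr s / s" using s by (intro divide_right_mono) auto
      have "ln (vol2 z 0) \<le> vol2 z 0 powr s / s"
      proof (cases "1 \<le> vol2 z 0")
        case True then show ?thesis using s by (intro ln_powr_bound) auto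
      next
        case False
        then have "ln (vol2 z 0) \<le> 0" using v by simp
        also have "0 \<le> vol2 z 0 powr s / s" using s by simp
        finally show ?thesis .
      qed
      moreover have "0 \<le> vol2 z 0 powr s / s" using s by simp
      ultimately have "\<bar>ln (vol2 z 0)\<bar> \<le> \<bar>ln (alpha0 th0)\<bar> + ((1 + (z 0)\<^sup>2) * vol2 z 0) powr s / s"
        using lo p abs_ge_zero[of "ln (alpha0 th0)"] by (intro abs_leI) linarith+
      then show ?case by simp
    qed
  qed measurable
qed

text \<open>An integrable minorant common to all \<open>s\<close> in \<open>[0, r]\<close>. It
  leaves only the upper tail of \<open>gap\<close> to be truncated, and with the truncation level it
  dominates the limit as s tends to 0.\<close>

definition gap_lower :: "(nat \<Rightarrow> real) \<Rightarrow> real \<Rightarrow> (int \<Rightarrow> real) \<Rightarrow> real" where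
  "gap_lower th r z = ln (alpha0 th - r) - (z 0)\<^sup>2 - ln (vol2 z 0)"

lemma integrable_gap_lower: "integrable P (gap_lower th r)"
  unfolding gap_lower_def using integrable_sq integrable_ln_vol2 by auto

lemma gap_lower_le:
  assumes "garch_param p q th r" "0 \<le> s" "s \<le> r" and z: "regular z"
  shows "gap_lower th r z \<le> gap th s z"
proof -
  interpret A: garch_param p q th r by fact
  have T: "tempered (\<lambda>t. (ret z t)\<^sup>2)" using z by (simp add: regular_def)
  have "alpha0 th - r \<le> env p q th (- s) (ret z) 0" using A.env_ge[OF T, of "-s" 0] assms by simp
  then have "ln (alpha0 th - r) \<le> ln (env p q th (- s) (ret z) 0)" using A.r_alpha0 by (intro ln_mono) auto
  moreover have "0 \<le> (ret z 0)\<^sup>2 / env p q th s (ret z) 0" using A.env_nonneg[OF T, of s 0] assms by auto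
  ultimately show ?thesis unfolding gap_eq[OF z] gap_lower_def by linarith
qed

lemma integrable_min_gap:
  assumes "garch_param p q th r" "0 \<le> s" "s \<le> r"
  shows "integrable P (\<lambda>z. min (gap th s z) (real R))"
proof (rule Bochner_Integration.integrable_bound)
  show "integrable P (\<lambda>z. \<bar>gap_lower th r z\<bar> + real R)" using integrable_gap_lower by auto
  show "AE z in P. norm (min (gap th s z) (real R)) \<le> norm (\<bar>gap_lower th r z\<bar> + real R)"
    using AE_regular
  proof eventually_elim
    case (elim z) then show ?case using gap_lower_le[OF assms elim] by (auto simp: min_def abs_if)
  qed
qed measurable

text \<open>If all truncated means were at most 0, monotone convergence would make the gap
  integrable with nonpositive mean. Given the past, averaging over the independent current
  innovation turns the gap into \<open>w - 1 - ln w\<close>, w being the ratio of the true to the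
  filtered volatility. Hence w is 1 almost surely, which identifies the parameter.\<close>

lemma gap_truncated_positive:
  assumes p1: "garch_param p q th 0" and neq: "th \<noteq> th0"
    and pos: "\<exists>i\<in>{1..p}. alpha th0 i > 0"
    and last: "(alpha th0 p, beta p th0 q) \<noteq> (0, 0)"
    and cop: "\<not> (\<exists>z::complex. (\<Sum>i=1..p. of_real (alpha th0 i) * z ^ i) = 0
                     \<and> 1 - (\<Sum>j=1..q. of_real (beta p th0 j) * z ^ j) = 0)"
  shows "\<exists>R. 0 < (\<integral>z. min (gap th 0 z) (real R) \<partial>P)"
proof (rule ccontr)
  assume n: "\<not> ?thesis"
  interpret A: garch_param p q th 0 by fact
  define I where "I R = (\<integral>z. min (gap th 0 z) (real R) \<partial>P)" for R :: nat
  have I0: "I R \<le> 0" for R using n unfolding I_def by (simp add: not_less)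
  have int: "integrable P (\<lambda>z. min (gap th 0 z) (real R))" for R by (rule integrable_min_gap[OF p1]) auto
  have "incseq I" unfolding I_def by (intro incseq_SucI integral_mono int) (auto simp: min_def)
  then obtain L where L: "I \<longlonglongrightarrow> L" using incseq_convergent[of I 0] I0 by blast
  have L0: "L \<le> 0" using L I0 by (intro LIMSEQ_le_const2) auto
  have mono: "AE z in P. mono (\<lambda>R. min (gap th 0 z) (real R))" by (intro AE_I2) (auto simp: mono_def min_def)
  have lim: "AE z in P. (\<lambda>R. min (gap th 0 z) (real R)) \<longlonglongrightarrow> gap th 0 z"
  proof (intro AE_I2)
    fix z
    have "eventually (\<lambda>R. gap th 0 z \<le> real R) sequentially"
      using filterlim_real_sequentially unfolding filterlim_at_top by blast
    then have "eventually (\<lambda>R. gap th 0 z = min (gap th 0 z) (real R)) sequentially" by eventually_elim auto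
    then show "(\<lambda>R. min (gap th 0 z) (real R)) \<longlonglongrightarrow> gap th 0 z" by (rule Lim_transform_eventually[OF tendsto_const])
  qed
  have gi: "integrable P (gap th 0)" and gL: "(\<integral>z. gap th 0 z \<partial>P) = L"
    using integrable_monotone_convergence[OF int mono lim L[unfolded I_def] measurable_gap]
      integral_monotone_convergence[OF int mono lim L[unfolded I_def] measurable_gap] by auto
  define W where "W z = vol2 z 0 / env p q th 0 (ret z) 0" for z
  have [measurable]: "W \<in> borel_measurable P" unfolding W_def by measurable
  have Wd: "depends_on W {..<0}"
    unfolding depends_on_def
  proof (intro allI impI)
    fix z z' :: "int \<Rightarrow> real" assume zz: "\<forall>i\<in>{..<0}. z i = z' i"
    have "vol2 z 0 = vol2 z' 0" using depends_vol2[of 0] zz unfolding depends_on_def by blast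
    moreover have "env p q th 0 (ret z) 0 = env p q th 0 (ret z') 0" using depends_env_ret[of th 0 0] zz unfolding depends_on_def by blast
    ultimately show "W z = W z'" by (simp add: W_def)
  qed
  define \<phi> where "\<phi> = (\<lambda>(w, y). y\<^sup>2 * (w - 1) - ln w :: real)"
  have [measurable]: "\<phi> \<in> borel_measurable (borel \<Otimes>\<^sub>M borel)" unfolding \<phi>_def by measurable
  have envp: "0 < env p q th 0 (ret z) 0" if "regular z" for z
    using A.env_ge[of "ret z" 0 0] A.alpha0_pos that by (simp add: regular_def)
  have gap_phi: "AE z in P. gap th 0 z = \<phi> (W z, z 0)"
    using AE_regular
  proof eventually_elim
    case (elim z)
    have v: "0 < vol2 z 0" "0 < env p q th 0 (ret z) 0" using vol2_pos[OF elim] envp[OF elim] by auto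
    have "(ret z 0)\<^sup>2 = vol2 z 0 * (z 0)\<^sup>2" using v by (simp add: ret_def power_mult_distrib)
    then show ?case unfolding gap_eq[OF elim] \<phi>_def W_def using v by (simp add: ln_div algebra_simps)
  qed
  let ?W = "distr P borel W"
  interpret W: prob_space ?W by (rule P.prob_space_distr) simp
  let ?D = "distr P borel (\<lambda>z. z 0)"
  interpret D0: prob_space ?D by (rule P.prob_space_distr) simp
  interpret WD: pair_prob_space ?W ?D ..
  have "P.indep_var borel W borel (\<lambda>z. z 0)"
    by (rule indep_depends_on[OF _ _ Wd depends_coord[of "\<lambda>x. x" 0]]) auto
  then have d: "?W \<Otimes>\<^sub>M ?D = distr P (borel \<Otimes>\<^sub>M borel) (\<lambda>z. (W z, z 0))"
    unfolding P.indep_var_distribution_eq by blast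
  have "integrable P (\<lambda>z. \<phi> (W z, z 0))"
    by (rule integrable_cong_AE_imp[OF gi]) (use gap_phi in \<open>auto elim: eventually_mono\<close>)
  then have pi: "integrable (?W \<Otimes>\<^sub>M ?D) \<phi>" unfolding d by (subst integrable_distr_eq) auto
  have "(\<integral>w. \<integral>y. \<phi> (w, y) \<partial>?D \<partial>?W) = (\<integral>p. \<phi> p \<partial>(?W \<Otimes>\<^sub>M ?D))" by (rule WD.integral_fst'[OF pi])
  also have "\<dots> = (\<integral>z. \<phi> (W z, z 0) \<partial>P)" unfolding d by (subst integral_distr) auto
  also have "\<dots> = L" unfolding gL[symmetric] by (rule integral_cong_AE) (use gap_phi in \<open>auto elim: eventually_mono\<close>)
  finally have dbl: "(\<integral>w. \<integral>y. \<phi> (w, y) \<partial>?D \<partial>?W) = L" .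
  have inner: "(\<integral>y. \<phi> (w, y) \<partial>?D) = w - 1 - ln w" for w
    unfolding distr_coord \<phi>_def using integrable_sq_D integral_sq_D D.prob_space by simp
  have wi: "integrable ?W (\<lambda>w. w - 1 - ln w)" using WD.integrable_fst'[OF pi] unfolding inner .
  have wpos: "AE w in ?W. 0 < w"
    using AE_regular by (subst AE_distr_iff) (auto elim!: eventually_mono simp: W_def vol2_pos envp)
  then have wn: "AE w in ?W. 0 \<le> w - 1 - ln w"
    by eventually_elim (use ln_le_minus_one in force)
  have "(\<integral>w. w - 1 - ln w \<partial>?W) = 0"
    using dbl L0 integral_nonneg_AE[OF wn] unfolding inner by linarith
  then have "AE w in ?W. w - 1 - ln w = 0" using integral_nonneg_eq_0_iff_AE[OF wi wn] by simp
  with wpos have "AE w in ?W. w = 1" by eventually_elim (rule ln_eq_minus_one, auto)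
  then have "AE z in P. W z = 1" by (subst (asm) AE_distr_iff) auto
  with AE_regular have "AE z in P. env p q th 0 (ret z) 0 = env p q th0 0 (ret z) 0"
  proof eventually_elim
    case (elim z)
    then show ?case using envp[of z] vol2_eq_env[of z 0] by (simp add: W_def)
  qed
  then have "th = th0" by (rule env_identify[OF p1 _ pos last cop])
  with neq show False by simp
qed

text \<open>The truncation level R is fixed first, at \<open>s = 0\<close>; only then can dominated
  convergence bring in a positive s.\<close>

lemma gap_envelope_positive:
  assumes p1: "garch_param p q th r" and r: "0 < r" and neq: "th \<noteq> th0"
    and pos: "\<exists>i\<in>{1..p}. alpha th0 i > 0"
    and last: "(alpha th0 p, beta p th0 q) \<noteq> (0, 0)"
    and cop: "\<not> (\<exists>z::complex. (\<Sum>i=1..p. of_real (alpha th0 i) * z ^ i) = 0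
                     \<and> 1 - (\<Sum>j=1..q. of_real (beta p th0 j) * z ^ j) = 0)"
  shows "\<exists>s R. 0 < s \<and> s \<le> r \<and> 0 < (\<integral>z. min (gap th s z) (real R) \<partial>P)"
proof -
  interpret A: garch_param p q th r by fact
  obtain R :: nat where R: "0 < (\<integral>z. min (gap th 0 z) (real R) \<partial>P)"
    using gap_truncated_positive[OF garch_param_mono[OF p1, of 0] neq pos last cop] r by auto
  define s where "s n = r / real (Suc n)" for n
  have s: "0 < s n" "s n \<le> r" for n using r by (auto simp: s_def field_simps)
  have sa: "\<bar>s n\<bar> \<le> r" "\<bar>- s n\<bar> \<le> r" for n using s[of n] by auto
  have s0: "s \<longlonglongrightarrow> 0" unfolding s_def using LIMSEQ_Suc[OF lim_const_over_n[of r]] by simp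
  have "(\<lambda>n. \<integral>z. min (gap th (s n) z) (real R) \<partial>P) \<longlonglongrightarrow> (\<integral>z. min (gap th 0 z) (real R) \<partial>P)"
  proof (rule integral_dominated_convergence)
    show "integrable P (\<lambda>z. \<bar>gap_lower th r z\<bar> + real R)" using integrable_gap_lower by auto
    show "AE z in P. norm (min (gap th (s n) z) (real R)) \<le> \<bar>gap_lower th r z\<bar> + real R" for n
      using AE_regular
    proof eventually_elim
      case (elim z) then show ?case using gap_lower_le[OF p1 _ _ elim, of "s n"] s[of n] by (auto simp: min_def abs_if)
    qed
    show "AE z in P. (\<lambda>n. min (gap th (s n) z) (real R)) \<longlonglongrightarrow> min (gap th 0 z) (real R)"
      using AE_regular
    proof eventually_elim
      case (elim z)
      have T: "tempered (\<lambda>t. (ret z t)\<^sup>2)" using elim by (simp add: regular_def)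
      have p0: "0 < env p q th 0 (ret z) 0" using A.env_ge[OF T, of 0 0] A.alpha0_pos A.r0 by simp
      have 1: "(\<lambda>n. env p q th (s n) (ret z) 0) \<longlonglongrightarrow> env p q th 0 (ret z) 0"
        by (rule A.tendsto_env[OF T sa(1) s0])
      have 2: "(\<lambda>n. env p q th (- s n) (ret z) 0) \<longlonglongrightarrow> env p q th 0 (ret z) 0"
        using tendsto_minus[OF s0] by (intro A.tendsto_env[OF T sa(2)]) simp
      have "(\<lambda>n. gap th (s n) z) \<longlonglongrightarrow> (ret z 0)\<^sup>2 / env p q th 0 (ret z) 0 + ln (env p q th 0 (ret z) 0) - (z 0)\<^sup>2 - ln (vol2 z 0)"
        unfolding gap_eq[OF elim] using p0 by (intro tendsto_intros 1 2) auto
      then have "(\<lambda>n. gap th (s n) z) \<longlonglongrightarrow> gap th 0 z" unfolding gap_eq[OF elim] by simp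
      then show ?case by (intro tendsto_min tendsto_const)
    qed
  qed measurable
  then have "eventually (\<lambda>n. 0 < (\<integral>z. min (gap th (s n) z) (real R) \<partial>P)) sequentially"
    using R by (rule order_tendstoD(1))
  then obtain n where "0 < (\<integral>z. min (gap th (s n) z) (real R) \<partial>P)" by (auto simp: eventually_sequentially)
  then show ?thesis using s by blast
qed

lemma likelihood_separation:
  assumes th: "th \<in> param_space p q" and neq: "th \<noteq> th0"
    and pos: "\<exists>i\<in>{1..p}. alpha th0 i > 0"
    and last: "(alpha th0 p, beta p th0 q) \<noteq> (0, 0)"
    and cop: "\<not> (\<exists>z::complex. (\<Sum>i=1..p. of_real (alpha th0 i) * z ^ i) = 0
                     \<and> 1 - (\<Sum>j=1..q. of_real (beta p th0 j) * z ^ j) = 0)"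
    and c: "\<And>t. t \<in> {- int q + 1..0} \<Longrightarrow> 0 \<le> c t"
  shows "\<exists>s>0. AE z in P. \<exists>N. \<forall>n\<ge>N. \<forall>th'\<in>param_space p q. (\<forall>k\<le>p+q+1. \<bar>th' k - th k\<bar> \<le> s) \<longrightarrow>
    Lhat p q c (ret z) n th' < Lhat p q c (ret z) n th0"
proof -
  obtain r where r: "0 < r" "garch_param p q th r" using garch_param_exists[OF th q_pos] by blast
  obtain s R where s: "0 < s" "s \<le> r" and R: "0 < (\<integral>z. min (gap th s z) (real R) \<partial>P)"
    using gap_envelope_positive[OF r(2,1) neq pos last cop] by blast
  have ps: "garch_param p q th s" by (rule garch_param_mono[OF r(2)]) (use s in auto)
  define m where "m = (\<integral>z. min (gap th s z) (real R) \<partial>P) / 2"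
  have m: "0 < m" "m < (\<integral>z. min (gap th s z) (real R) \<partial>P)" using R by (auto simp: m_def)
  have "AE z in P. \<exists>C. \<forall>n. real n * m - C \<le> (\<Sum>i<n. min (gap th s (tshift (int i * 1) z)) (real R))"
    by (rule tshift_sums_linear_growth) (use m integrable_min_gap[OF ps] s in auto)
  \<comment> \<open>The ergodic sums start at time 0 but the likelihood at time 1, hence the extra
    shift.\<close>
  then have erg: "AE z in P. \<exists>C. \<forall>n. real n * m - C \<le> (\<Sum>i<n. min (gap th s (tshift (int i * 1) (tshift 1 z))) (real R))"
    by (rule AE_tshift)
  have "AE z in P. \<exists>N. \<forall>n\<ge>N. \<forall>th'\<in>param_space p q. (\<forall>k\<le>p+q+1. \<bar>th' k - th k\<bar> \<le> s) \<longrightarrow>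
    Lhat p q c (ret z) n th' < Lhat p q c (ret z) n th0"
    using erg AE_regular
  proof eventually_elim
    case (elim z)
    obtain C where C: "\<And>n. real n * m - C \<le> (\<Sum>i<n. min (gap th s (tshift (int i * 1) (tshift 1 z))) (real R))" using elim(1) by blast
    have T: "tempered (\<lambda>t. (ret z t)\<^sup>2)" using elim(2) by (simp add: regular_def)
    have fwd: "summable (\<lambda>k. \<rho> ^ k * (ret z (int k))\<^sup>2)" if "0 < \<rho>" "\<rho> < 1" for \<rho> using elim(2) that by (simp add: regular_def)
    define G where "G n = (\<Sum>t=1..n. (ret z (int t))\<^sup>2 / env p q th s (ret z) (int t) + ln (env p q th (-s) (ret z) (int t))
       - (ret z (int t))\<^sup>2 / env p q th0 0 (ret z) (int t) - ln (env p q th0 0 (ret z) (int t)))" for n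
    obtain C' where C': "\<And>th' n. th' \<in> param_space p q \<Longrightarrow> (\<forall>k\<le>p+q+1. \<bar>th' k - th k\<bar> \<le> s) \<Longrightarrow>
      2 * (Lhat p q c (ret z) n th0 - Lhat p q c (ret z) n th') \<ge> G n - C'"
      unfolding G_def using likelihood_gap[where c=c, OF ps P0.garch_param_axioms T fwd c] by blast
    have sum: "G n \<ge> real n * m - C" for n
    proof -
      have g: "gap th s (tshift k z) = (ret z k)\<^sup>2 / env p q th s (ret z) k + ln (env p q th (-s) (ret z) k)
       - (ret z k)\<^sup>2 / env p q th0 0 (ret z) k - ln (env p q th0 0 (ret z) k)" for k
        unfolding gap_def env_ret_tshift ret_tshift by simp
      have "(\<Sum>i<n. min (gap th s (tshift (int i * 1) (tshift 1 z))) (real R)) \<le> (\<Sum>i<n. gap th s (tshift (int (Suc i)) z))"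
        by (intro sum_mono) (simp add: add.commute)
      also have "\<dots> = (\<Sum>t=1..n. gap th s (tshift (int t) z))"
        by (rule sum.reindex_bij_witness[of _ "\<lambda>t. t - 1" Suc]) auto
      finally show ?thesis using C[of n] unfolding g G_def by (rule order_trans[rotated])
    qed
    obtain N :: nat where N: "(C + C') / m < real N" using reals_Archimedean2 by blast
    have "Lhat p q c (ret z) n th' < Lhat p q c (ret z) n th0"
      if "n \<ge> N" "th' \<in> param_space p q" "\<forall>k\<le>p+q+1. \<bar>th' k - th k\<bar> \<le> s" for n th'
    proof -
      have "(C + C') / m < real n" using N that(1) by linarith
      then have "C + C' < real n * m" using m by (simp add: pos_divide_less_eq)
      moreover have "a < b" if "C + C' < x" "x - C \<le> g" "2 * (b - a) \<ge> g - C'" for a b g x using that by simp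
      ultimately show ?thesis using C'[OF that(2,3), of n] sum[of n] by blast
    qed
    then show ?case by blast
  qed
  then show ?thesis using s by blast
qed

text \<open>The quantifier over \<open>ch\<close> stands inside the almost sure statement: one null
  set serves every sequence, so the estimator may select among maximizers in any way that depends on
  the sample point.\<close>

theorem AE_maximizers_consistent:
  assumes K: "compact K" "K \<subseteq> param_space p q"
    and pos: "\<exists>i\<in>{1..p}. alpha th0 i > 0"
    and last: "(alpha th0 p, beta p th0 q) \<noteq> (0, 0)"
    and cop: "\<not> (\<exists>z::complex. (\<Sum>i=1..p. of_real (alpha th0 i) * z ^ i) = 0
                     \<and> 1 - (\<Sum>j=1..q. of_real (beta p th0 j) * z ^ j) = 0)"
    and c: "\<And>t. t \<in> {- int q + 1..0} \<Longrightarrow> 0 \<le> c t"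
  shows "AE z in P. \<forall>ch. (\<forall>n. ch n \<in> K \<and> Lhat p q c (ret z) n th0 \<le> Lhat p q c (ret z) n (ch n)) \<longrightarrow> ch \<longlonglongrightarrow> th0"
proof -
  have sep: "\<forall>th\<in>K - {th0}. \<exists>s>0. AE z in P. \<exists>N. \<forall>n\<ge>N. \<forall>th'\<in>param_space p q. (\<forall>k\<le>p+q+1. \<bar>th' k - th k\<bar> \<le> s) \<longrightarrow>
    Lhat p q c (ret z) n th' < Lhat p q c (ret z) n th0"
    by (intro ballI likelihood_separation pos last cop c) (use K(2) in auto)
  obtain s where s: "\<And>th. th \<in> K - {th0} \<Longrightarrow> 0 < s th"
    and sAE: "\<And>th. th \<in> K - {th0} \<Longrightarrow> AE z in P. \<exists>N. \<forall>n\<ge>N. \<forall>th'\<in>param_space p q. (\<forall>k\<le>p+q+1. \<bar>th' k - th k\<bar> \<le> s th) \<longrightarrow>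
    Lhat p q c (ret z) n th' < Lhat p q c (ret z) n th0"
    using bchoice[OF sep] by blast
  \<comment> \<open>Convergence in the product topology is coordinatewise. So it suffices to
    exclude, for each k and m, the compact set of parameters whose coordinate k is off by at least
    \<open>1 / (m + 1)\<close>; a finite cover does this, and only countably many null sets
    arise.\<close>
  have far: "AE z in P. \<exists>N. \<forall>n\<ge>N. \<forall>th'\<in>K. 1 / real (Suc m) \<le> \<bar>th' k - th0 k\<bar> \<longrightarrow> Lhat p q c (ret z) n th' < Lhat p q c (ret z) n th0"
    for k m :: nat
  proof -
    let ?F = "{th. 1 / real (Suc m) \<le> \<bar>th k - th0 k\<bar>}"
    have coord: "continuous_on UNIV (\<lambda>th :: nat \<Rightarrow> real. th i)" for i by (rule continuous_on_product_coordinates)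
    have "closed ?F" by (intro closed_Collect_le continuous_intros coord)
    then have cpt: "compact (K \<inter> ?F)" using K(1) by (intro compact_Int_closed)
    define U where "U th = {th'. \<forall>i\<in>{..p+q+1}. \<bar>th' i - th i\<bar> < s th}" for th :: "nat \<Rightarrow> real"
    have opn: "open (U th)" for th
      unfolding U_def Collect_ball_eq by (intro open_INT ballI open_Collect_less continuous_intros coord) simp
    have sub: "K \<inter> ?F \<subseteq> K - {th0}" by auto
    have "th \<in> U th" if "th \<in> K - {th0}" for th using s[OF that] by (simp add: U_def)
    then have "K \<inter> ?F \<subseteq> (\<Union>th\<in>K \<inter> ?F. U th)" using sub by blast
    then obtain T where T: "T \<subseteq> K \<inter> ?F" "finite T" "K \<inter> ?F \<subseteq> (\<Union>th\<in>T. U th)"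
      using compactE_image[OF cpt, of "K \<inter> ?F" U] opn by blast
    have "AE z in P. \<forall>th\<in>T. \<exists>N. \<forall>n\<ge>N. \<forall>th'\<in>param_space p q. (\<forall>k\<le>p+q+1. \<bar>th' k - th k\<bar> \<le> s th) \<longrightarrow>
      Lhat p q c (ret z) n th' < Lhat p q c (ret z) n th0"
      using T sub by (intro AE_finite_allI sAE) auto
    then show ?thesis
    proof eventually_elim
      case (elim z)
      then obtain N where N: "\<And>th n th'. th \<in> T \<Longrightarrow> n \<ge> N th \<Longrightarrow> th' \<in> param_space p q \<Longrightarrow> (\<forall>k\<le>p+q+1. \<bar>th' k - th k\<bar> \<le> s th) \<Longrightarrow>
        Lhat p q c (ret z) n th' < Lhat p q c (ret z) n th0" by metis
      have "Lhat p q c (ret z) n th' < Lhat p q c (ret z) n th0"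
        if n: "n \<ge> Max (insert 0 (N ` T))" and th': "th' \<in> K" "1 / real (Suc m) \<le> \<bar>th' k - th0 k\<bar>" for n th'
      proof -
        obtain th where th: "th \<in> T" "th' \<in> U th" using T(3) th' by blast
        have "N th \<le> Max (insert 0 (N ` T))" using th T(2) by (intro Max_ge) auto
        then show ?thesis using th n th' K(2) by (intro N[OF th(1)]) (auto simp: U_def intro: less_imp_le)
      qed
      then show ?case by blast
    qed
  qed
  have "AE z in P. \<forall>k m. \<exists>N. \<forall>n\<ge>N. \<forall>th'\<in>K. 1 / real (Suc m) \<le> \<bar>th' k - th0 k\<bar> \<longrightarrow> Lhat p q c (ret z) n th' < Lhat p q c (ret z) n th0"
    unfolding AE_all_countable using far by blast
  then show ?thesis
  proof eventually_elim
    case (elim z)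
    show ?case
    proof (intro allI impI tendsto_funI LIMSEQ_I)
      fix ch :: "nat \<Rightarrow> nat \<Rightarrow> real" and k and e :: real
      assume ch: "\<forall>n. ch n \<in> K \<and> Lhat p q c (ret z) n th0 \<le> Lhat p q c (ret z) n (ch n)" and e: "0 < e"
      obtain m where m: "1 / real (Suc m) < e" using reals_Archimedean[OF e] by (auto simp: inverse_eq_divide)
      obtain N where N: "\<And>n th'. n \<ge> N \<Longrightarrow> th' \<in> K \<Longrightarrow> 1 / real (Suc m) \<le> \<bar>th' k - th0 k\<bar> \<Longrightarrow> Lhat p q c (ret z) n th' < Lhat p q c (ret z) n th0"
        using elim by blast
      have "norm (ch n k - th0 k) < e" if "n \<ge> N" for n
      proof (rule ccontr)
        assume "\<not> norm (ch n k - th0 k) < e"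
        then have "Lhat p q c (ret z) n (ch n) < Lhat p q c (ret z) n th0" using m ch by (intro N[OF that]) auto
        then show False using ch by (meson not_less)
      qed
      then show "\<exists>no. \<forall>n\<ge>no. norm (ch n k - th0 k) < e" by blast
    qed
  qed
qed

end

section \<open>Transfer to the given stationary solution\<close>

text \<open>Every tail union has probability at least \<open>p K\<close>, and so does the limit
  superior of the events. No independence is involved; letting K grow brings the probability to
  1.\<close>

lemma (in prob_space) AE_infinitely_often:
  fixes A :: "nat \<Rightarrow> nat \<Rightarrow> 'a set" and p :: "nat \<Rightarrow> real"
  assumes A: "\<And>K m. A K m \<in> events" and p: "\<And>K m. p K \<le> prob (A K m)" and lim: "p \<longlonglongrightarrow> 1"
  shows "AE \<omega> in M. \<exists>K. infinite {m. \<omega> \<in> A K m}"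
proof -
  define B where "B K = (\<Inter>n. \<Union>m\<in>{n..}. A K m)" for K
  have B: "B K \<in> events" for K unfolding B_def using A by auto
  have pB: "p K \<le> prob (B K)" for K
  proof (rule LIMSEQ_le_const)
    show "(\<lambda>n. prob (\<Union>m\<in>{n..}. A K m)) \<longlonglongrightarrow> prob (B K)"
      unfolding B_def using A by (intro finite_Lim_measure_decseq) (auto simp: decseq_def, meson atLeast_iff order_trans)
    show "\<exists>N. \<forall>n\<ge>N. p K \<le> prob (\<Union>m\<in>{n..}. A K m)"
    proof (intro exI allI impI)
      fix n :: nat
      have "prob (A K n) \<le> prob (\<Union>m\<in>{n..}. A K m)" using A by (intro finite_measure_mono) auto
      then show "p K \<le> prob (\<Union>m\<in>{n..}. A K m)" using p[of K n] by linarith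
    qed
  qed
  have U: "(\<Union>K. B K) \<in> events" using B by auto
  have "1 \<le> prob (\<Union>K. B K)"
  proof (rule LIMSEQ_le_const2[OF lim], intro exI allI impI)
    fix K :: nat
    have "prob (B K) \<le> prob (\<Union>K. B K)" using B by (intro finite_measure_mono) auto
    then show "p K \<le> prob (\<Union>K. B K)" using pB[of K] by linarith
  qed
  then have "prob (\<Union>K. B K) = 1" using prob_le_1[of "\<Union>K. B K"] by linarith
  then have "AE \<omega> in M. \<omega> \<in> (\<Union>K. B K)" using prob_eq_1[OF U] by simp
  then show ?thesis
  proof eventually_elim
    case (elim \<omega>)
    then obtain K where "\<omega> \<in> B K" by blast
    then have "\<forall>n. \<exists>m\<ge>n. m \<in> {m. \<omega> \<in> A K m}" unfolding B_def by auto
    then have "infinite {m. \<omega> \<in> A K m}" unfolding infinite_nat_iff_unbounded_le by blast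
    then show ?case by blast
  qed
qed

lemma (in prob_space) stationary_block_prob:
  fixes Y :: "int \<Rightarrow> 'a \<Rightarrow> real \<times> real"
  assumes Y[measurable]: "\<And>t. Y t \<in> borel_measurable M" and st: "strictly_stationary M Y"
  shows "prob {\<omega> \<in> space M. \<forall>i<d. (snd (Y (t + int i + h) \<omega>))\<^sup>2 \<le> K} = prob {\<omega> \<in> space M. \<forall>i<d. (snd (Y (t + int i) \<omega>))\<^sup>2 \<le> K}"
proof -
  let ?N = "PiM UNIV (\<lambda>_::int. borel :: (real \<times> real) measure)"
  let ?S = "{y \<in> space ?N. \<forall>i<d. (snd (y (t + int i)))\<^sup>2 \<le> K}"
  have [measurable]: "(snd :: real \<times> real \<Rightarrow> real) \<in> borel_measurable borel"
    by (intro borel_measurable_continuous_onI continuous_intros)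
  have [measurable]: "(\<lambda>y. snd (y s)) \<in> borel_measurable ?N" for s
    by (rule measurable_compose[OF measurable_component_singleton]) simp_all
  have S: "?S \<in> sets ?N" by measurable
  have m: "(\<lambda>\<omega> t. Y (t + h) \<omega>) \<in> measurable M ?N" for h by (rule measurable_PiM_single') auto
  have e: "measure (distr M ?N (\<lambda>\<omega> t. Y (t + h) \<omega>)) ?S = prob {\<omega> \<in> space M. \<forall>i<d. (snd (Y (t + int i + h) \<omega>))\<^sup>2 \<le> K}" for h
    by (subst measure_distr[OF m S]) (auto intro!: arg_cong[of _ _ prob] simp: space_PiM)
  have "distr M ?N (\<lambda>\<omega> t. Y (t + h) \<omega>) = distr M ?N (\<lambda>\<omega> t. Y (t + 0) \<omega>)"
    using st unfolding strictly_stationary_def by simp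
  then have "measure (distr M ?N (\<lambda>\<omega> t. Y (t + h) \<omega>)) ?S = measure (distr M ?N (\<lambda>\<omega> t. Y (t + 0) \<omega>)) ?S"
    by (rule arg_cong[of _ _ "\<lambda>N. measure N ?S"])
  then show ?thesis unfolding e by simp
qed

text \<open>Stationarity enters only through tightness: some bound on the volatility recurs on blocks
  arbitrarily far in the past, so the solution forgets its remote past.\<close>
lemma (in prob_space) stationary_solution_eq_vol2:
  fixes X Z sig :: "int \<Rightarrow> 'a \<Rightarrow> real"
  assumes ag: "agarch_rec d a0 g A B"
    and X: "\<And>t. X t \<in> borel_measurable M" and sig [measurable]: "\<And>t. sig t \<in> borel_measurable M"
    and st: "strictly_stationary M (\<lambda>t \<omega>. (X t \<omega>, sig t \<omega>))"
    and rec: "\<And>t \<omega>. \<omega> \<in> space M \<Longrightarrow> (sig t \<omega>)\<^sup>2 = a0 + (\<Sum>j=1..d. agarch_rec.cf g A B (\<lambda>t. Z t \<omega>) j (t - int j) * (sig (t - int j) \<omega>)\<^sup>2)"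
  shows "AE \<omega> in M. \<forall>t. agarch_rec.vstep d a0 g A B (\<lambda>t. Z t \<omega>) t \<longlonglongrightarrow> (sig t \<omega>)\<^sup>2"
proof -
  interpret agarch_rec d a0 g A B by (rule ag)
  have Y: "(\<lambda>\<omega>. (X t \<omega>, sig t \<omega>)) \<in> borel_measurable M" for t
    by (rule borel_measurable_Pair[OF X sig])
  have "AE \<omega> in M. vstep (\<lambda>t. Z t \<omega>) t \<longlonglongrightarrow> (sig t \<omega>)\<^sup>2" for t
  proof -
    \<comment> \<open>Blocks receding into the past in steps of d. By stationarity their probability
      does not depend on m, and it tends to 1 with K.\<close>
    define E where "E K m = {\<omega> \<in> space M. \<forall>i<d. (sig (t + int i + - (int m * int d)) \<omega>)\<^sup>2 \<le> real K}" for K m :: nat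
    have E: "E K m \<in> events" for K m unfolding E_def by measurable
    have Em: "prob (E K m) = prob (E K 0)" for K m
      unfolding E_def using stationary_block_prob[OF Y st, of d t "- (int m * int d)" "real K"] by simp
    have "(\<lambda>K. prob (E K 0)) \<longlonglongrightarrow> prob (\<Union>K. E K 0)"
      using E by (intro finite_Lim_measure_incseq) (auto simp: incseq_def E_def intro: order_trans)
    moreover have "(\<Union>K. E K 0) = space M"
    proof -
      have "\<exists>K::nat. \<forall>i<d. (sig (t + int i) \<omega>)\<^sup>2 \<le> real K" for \<omega>
      proof -
        obtain K :: nat where K: "(\<Sum>i<d. (sig (t + int i) \<omega>)\<^sup>2) \<le> real K" using real_arch_simple by blast
        have "(sig (t + int i) \<omega>)\<^sup>2 \<le> (\<Sum>i<d. (sig (t + int i) \<omega>)\<^sup>2)" if "i < d" for i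
          using that by (intro member_le_sum[where f="\<lambda>i. (sig (t + int i) \<omega>)\<^sup>2"]) auto
        then show ?thesis using K order_trans by blast
      qed
      then show ?thesis unfolding E_def by auto
    qed
    ultimately have "(\<lambda>K. prob (E K 0)) \<longlonglongrightarrow> 1" using prob_space by simp
    then have "AE \<omega> in M. \<exists>K. infinite {m. \<omega> \<in> E K m}"
      by (intro AE_infinitely_often[OF E, of "\<lambda>K. prob (E K 0)"]) (auto intro: eq_refl[OF Em[symmetric]])
    then show ?thesis using AE_space
    proof eventually_elim
      case (elim \<omega>)
      then obtain K where K: "infinite {m. \<omega> \<in> E K m}" by blast
      define u where "u s = (sig (s + t) \<omega>)\<^sup>2" for s
      have "vstep (tshift t (\<lambda>t. Z t \<omega>)) 0 \<longlonglongrightarrow> u 0"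
      proof (rule solution_eq_vol2)
        show "u s = a0 + (\<Sum>j=1..d. cf (tshift t (\<lambda>t. Z t \<omega>)) j (s - int j) * u (s - int j))" for s
          unfolding u_def cf_tshift using rec[OF elim(2), of "s + t"]
          by (simp only: diff_add_eq)
        show "0 \<le> u s" for s by (simp add: u_def)
        have "{m. \<omega> \<in> E K m} = {m. \<forall>i<d. u (int i - int m * int d) \<le> real K}"
          unfolding E_def u_def using elim(2) by (auto simp: algebra_simps)
        then show "infinite {m. \<forall>i<d. u (int i - int m * int d) \<le> real K}" using K by simp
      qed
      then show ?case by (simp add: vstep_tshift u_def)
    qed
  qed
  then show ?thesis unfolding AE_all_countable by blast
qed

lemma measurable_natfilt:
  assumes "\<And>k. Z k \<in> borel_measurable M" "f \<in> borel_measurable (natfilt M Z t)"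
  shows "f \<in> borel_measurable M"
proof -
  let ?G = "\<Union>k\<in>{..t}. {Z k -` A \<inter> space M |A. A \<in> sets borel}"
  have "?G \<subseteq> sets M" using assms(1) by (auto intro: measurable_sets)
  then have "sets (natfilt M Z t) \<subseteq> sets M"
    unfolding natfilt_def by (subst sets_measure_of) (auto intro!: sets.sigma_sets_subset)
  moreover have "space (natfilt M Z t) = space M" unfolding natfilt_def by (simp add: space_measure_of_conv)
  ultimately show ?thesis using measurable_mono[OF order_refl refl, of "natfilt M Z t" M borel] assms(2) by auto
qed

text \<open>Vanishing news means \<open>|x| = g * x\<close>, so the mean of \<open>|x|\<close> is g
  times 0; then x is 0 almost surely, against variance 1.\<close>

lemma (in prob_space) news_positive:
  fixes x :: "'a \<Rightarrow> real"
  assumes i: "integrable M x" and m: "expectation x = 0" and i2: "integrable M (\<lambda>\<omega>. (x \<omega>)\<^sup>2)" and v: "expectation (\<lambda>\<omega>. (x \<omega>)\<^sup>2) = 1"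
  shows "0 < prob {\<omega> \<in> space M. 0 < (\<bar>x \<omega>\<bar> - g * x \<omega>)\<^sup>2}"
proof (rule ccontr)
  have [measurable]: "x \<in> borel_measurable M" using i by auto
  assume "\<not> ?thesis"
  then have "prob {\<omega> \<in> space M. 0 < (\<bar>x \<omega>\<bar> - g * x \<omega>)\<^sup>2} = 0"
    using measure_nonneg[of M "{\<omega> \<in> space M. 0 < (\<bar>x \<omega>\<bar> - g * x \<omega>)\<^sup>2}"] by linarith
  then have "AE \<omega> in M. \<not> 0 < (\<bar>x \<omega>\<bar> - g * x \<omega>)\<^sup>2" by (subst (asm) prob_eq_0) auto
  then have ae: "AE \<omega> in M. \<bar>x \<omega>\<bar> = g * x \<omega>" by eventually_elim (auto simp: zero_less_power2)
  then have "expectation (\<lambda>\<omega>. \<bar>x \<omega>\<bar>) = expectation (\<lambda>\<omega>. g * x \<omega>)" by (intro integral_cong_AE) auto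
  then have "expectation (\<lambda>\<omega>. \<bar>x \<omega>\<bar>) = 0" using m by simp
  then have "AE \<omega> in M. \<bar>x \<omega>\<bar> = 0"
    using integral_nonneg_eq_0_iff_AE[of M "\<lambda>\<omega>. \<bar>x \<omega>\<bar>"] i by auto
  then have "expectation (\<lambda>\<omega>. (x \<omega>)\<^sup>2) = expectation (\<lambda>\<omega>. 0)" by (intro integral_cong_AE) auto
  then show False using v by simp
qed

theorem theorem5p5:
  fixes M :: "'a measure"
    and p q :: nat
    and Z X sig :: "int \<Rightarrow> 'a \<Rightarrow> real"
    and th0 :: "nat \<Rightarrow> real"
    and K :: "(nat \<Rightarrow> real) set"
    and c :: "int \<Rightarrow> real"
    and thhat :: "nat \<Rightarrow> 'a \<Rightarrow> (nat \<Rightarrow> real)"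
  assumes "prob_space M"
    and "p \<ge> 1" and "q \<ge> 1"
    \<comment> \<open>(Z_t) i.i.d. with mean 0 and variance 1\<close>
    and Z_indep: "prob_space.indep_vars M (\<lambda>_. borel) Z UNIV"
    and Z_ident: "\<And>t. distr M borel (Z t) = distr M borel (Z 0)"
    and Z_int: "integrable M (Z 0)" and Z_mean: "prob_space.expectation M (Z 0) = 0"
    and Z_int2: "integrable M (\<lambda>\<omega>. (Z 0 \<omega>)\<^sup>2)"
    and Z_var: "prob_space.expectation M (\<lambda>\<omega>. (Z 0 \<omega>)\<^sup>2) = 1"
    \<comment> \<open>distribution of Z_0 not concentrated at two points\<close>
    and Z_not2: "\<And>a b. prob_space.prob M {\<omega> \<in> space M. Z 0 \<omega> = a \<or> Z 0 \<omega> = b} < 1"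
    \<comment> \<open>the compact parameter set\<close>
    and K_compact: "compact K" and K_sub: "K \<subseteq> param_space p q" and th0_K: "th0 \<in> K"
    \<comment> \<open>conditions on the true parameter\<close>
    and pos_alpha: "\<exists>i\<in>{1..p}. alpha th0 i > 0"
    and last_nz: "(alpha th0 p, beta p th0 q) \<noteq> (0, 0)"
    and coprime: "\<not> (\<exists>z::complex. (\<Sum>i=1..p. complex_of_real (alpha th0 i) * z ^ i) = 0
                     \<and> 1 - (\<Sum>j=1..q. complex_of_real (beta p th0 j) * z ^ j) = 0)"
    \<comment> \<open>(X, sigma) is the strictly stationary nonanticipative AGARCH(p,q) solution for th0\<close>
    and X_eq: "\<And>t \<omega>. \<omega> \<in> space M \<Longrightarrow> X t \<omega> = sig t \<omega> * Z t \<omega>"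
    and sig_nonneg: "\<And>t \<omega>. \<omega> \<in> space M \<Longrightarrow> sig t \<omega> \<ge> 0"
    and sig_eq: "\<And>t \<omega>. \<omega> \<in> space M \<Longrightarrow> (sig t \<omega>)\<^sup>2 = alpha0 th0
        + (\<Sum>i=1..p. alpha th0 i * (\<bar>X (t - int i) \<omega>\<bar> - gam p q th0 * X (t - int i) \<omega>)\<^sup>2)
        + (\<Sum>j=1..q. beta p th0 j * (sig (t - int j) \<omega>)\<^sup>2)"
    and sig_adapted: "\<And>t. sig t \<in> borel_measurable (natfilt M Z (t - 1))"
    and stationary: "strictly_stationary M (\<lambda>t \<omega>. (X t \<omega>, sig t \<omega>))"
    \<comment> \<open>fixed nonnegative initial values hhat_0, ..., hhat_{-q+1}\<close>
    and c_nonneg: "\<And>s. s \<in> {-int q + 1..0} \<Longrightarrow> c s \<ge> 0"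
    \<comment> \<open>thhat n is a QMLE: a maximiser of Lhat_n over K\<close>
    and thhat_K: "\<And>n \<omega>. \<omega> \<in> space M \<Longrightarrow> thhat n \<omega> \<in> K"
    and thhat_max: "\<And>n \<omega> th. \<omega> \<in> space M \<Longrightarrow> th \<in> K \<Longrightarrow>
        Lhat p q c (\<lambda>t. X t \<omega>) n th \<le> Lhat p q c (\<lambda>t. X t \<omega>) n (thhat n \<omega>)"
  shows "AE \<omega> in M. (\<lambda>n. thhat n \<omega>) \<longlonglongrightarrow> th0"
proof -
  interpret M: prob_space M by fact
  have Zm[measurable]: "Z t \<in> borel_measurable M" for t
    using Z_indep unfolding M.indep_vars_def by auto
  define D where "D = distr M borel (Z 0)"
  interpret D: prob_space D unfolding D_def by (rule M.prob_space_distr) simp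
  interpret I: iid_sequences D by unfold_locales (simp add: D_def)
  let ?Z = "\<lambda>\<omega> t. Z t \<omega>"
  have Zseq[measurable]: "?Z \<in> measurable M I.P"
    unfolding measurable_cong_sets[OF refl I.sets_P] by (rule measurable_PiM_single') auto
  have distr_Z: "distr M I.P ?Z = I.P"
  proof -
    have "distr M (PiM UNIV (\<lambda>_. borel)) (\<lambda>\<omega>. \<lambda>i\<in>UNIV. Z i \<omega>) = PiM UNIV (\<lambda>i. distr M borel (Z i))"
      using Z_indep by (subst (asm) M.indep_vars_iff_distr_eq_PiM) auto
    also have "PiM UNIV (\<lambda>i. distr M borel (Z i)) = I.P"
      unfolding I.P_def unfolding D_def by (intro PiM_cong refl Z_ident)
    finally have "distr M (PiM UNIV (\<lambda>_. borel)) ?Z = I.P" by (simp only: restrict_UNIV)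
    moreover have "distr M I.P ?Z = distr M (PiM UNIV (\<lambda>_. borel)) ?Z" by (rule distr_cong) (auto simp: I.sets_P)
    ultimately show ?thesis by simp
  qed
  have th0: "th0 \<in> param_space p q" using K_sub th0_K by blast
  let ?A = "\<lambda>j. if j \<le> p then alpha th0 j else 0" and ?B = "\<lambda>j. if j \<le> q then beta p th0 j else 0"
  have ps: "0 < alpha0 th0" "\<And>i. i \<in> {1..p} \<Longrightarrow> 0 \<le> alpha th0 i" "\<And>j. j \<in> {1..q} \<Longrightarrow> 0 \<le> beta p th0 j" "\<bar>gam p q th0\<bar> \<le> 1"
    using th0 by (auto simp: param_space_def Bset_def)
  have ag: "agarch_rec (max p q) (alpha0 th0) (gam p q th0) ?A ?B"
  proof
    \<comment> \<open>The locale asks for nonnegativity also at index 0. There the encoding of the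
      parameter yields \<open>alpha0\<close> for alpha and, in the next line, the last alpha
      coefficient for beta; both are nonnegative.\<close>
    show "0 \<le> ?A j" for j using ps(1) ps(2)[of j] by (cases "j = 0") (auto simp: alpha_def alpha0_def)
    show "0 \<le> ?B j" for j using ps(2)[of p] ps(3)[of j] \<open>p \<ge> 1\<close> by (cases "j = 0") (auto simp: alpha_def beta_def)
  qed (use ps \<open>p \<ge> 1\<close> in auto)
  interpret R: agarch_rec "max p q" "alpha0 th0" "gam p q th0" ?A ?B by (rule ag)
  interpret V: agarch_innovations D "max p q" "alpha0 th0" "gam p q th0" ?A ?B ..
  have sigm[measurable]: "sig t \<in> borel_measurable M" for t by (rule measurable_natfilt[OF Zm sig_adapted])
  have Xm[measurable]: "X t \<in> borel_measurable M" for t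
    by (subst measurable_cong[OF X_eq]) auto
  have rec: "(sig t \<omega>)\<^sup>2 = alpha0 th0 + (\<Sum>j=1..max p q. R.cf (?Z \<omega>) j (t - int j) * (sig (t - int j) \<omega>)\<^sup>2)"
    if w: "\<omega> \<in> space M" for t \<omega>
  proof -
    have news: "(\<bar>X s \<omega>\<bar> - gam p q th0 * X s \<omega>)\<^sup>2 = (\<bar>Z s \<omega>\<bar> - gam p q th0 * Z s \<omega>)\<^sup>2 * (sig s \<omega>)\<^sup>2" for s
    proof -
      have "\<bar>X s \<omega>\<bar> - gam p q th0 * X s \<omega> = (\<bar>Z s \<omega>\<bar> - gam p q th0 * Z s \<omega>) * sig s \<omega>"
        unfolding X_eq[OF w] using sig_nonneg[OF w, of s] by (simp add: abs_mult algebra_simps)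
      then show ?thesis by (simp add: power_mult_distrib)
    qed
    have "(\<Sum>j=1..max p q. R.cf (?Z \<omega>) j (t - int j) * (sig (t - int j) \<omega>)\<^sup>2) =
      (\<Sum>j=1..max p q. if j \<le> p then alpha th0 j * (\<bar>X (t - int j) \<omega>\<bar> - gam p q th0 * X (t - int j) \<omega>)\<^sup>2 else 0)
      + (\<Sum>j=1..max p q. if j \<le> q then beta p th0 j * (sig (t - int j) \<omega>)\<^sup>2 else 0)"
      unfolding sum.distrib[symmetric] news R.cf_def by (intro sum.cong refl) (auto simp: distrib_right)
    also have "(\<Sum>j=1..max p q. if j \<le> p then alpha th0 j * (\<bar>X (t - int j) \<omega>\<bar> - gam p q th0 * X (t - int j) \<omega>)\<^sup>2 else 0)
      = (\<Sum>i=1..p. alpha th0 i * (\<bar>X (t - int i) \<omega>\<bar> - gam p q th0 * X (t - int i) \<omega>)\<^sup>2)"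
      by (intro sum.mono_neutral_cong_right) auto
    also have "(\<Sum>j=1..max p q. if j \<le> q then beta p th0 j * (sig (t - int j) \<omega>)\<^sup>2 else 0) = (\<Sum>j=1..q. beta p th0 j * (sig (t - int j) \<omega>)\<^sup>2)"
      by (intro sum.mono_neutral_cong_right) auto
    finally show ?thesis using sig_eq[OF w, of t] by simp
  qed
  have conv: "AE \<omega> in M. \<forall>t. R.vstep (?Z \<omega>) t \<longlonglongrightarrow> (sig t \<omega>)\<^sup>2"
    by (rule M.stationary_solution_eq_vol2[OF ag Xm sigm stationary rec])
  have "AE \<omega> in M. R.stable (?Z \<omega>)"
    using conv by eventually_elim (auto simp: R.stable_def convergent_def)
  \<comment> \<open>Stability is a property of the innovation path alone, so what the given solution
    shows on M moves to the product space. Consistency is proved there and pulled back along the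
    same path map.\<close>
  then have "AE z in distr M I.P ?Z. R.stable z"
    using V.measurable_stable by (subst AE_distr_iff) (auto simp: pred_def)
  then have stab: "AE z in I.P. R.stable z" unfolding distr_Z .
  interpret agarch_model D p q th0
  proof unfold_locales
    have "(\<integral>\<^sup>+x. ennreal (x\<^sup>2) \<partial>D) = (\<integral>\<^sup>+\<omega>. ennreal ((Z 0 \<omega>)\<^sup>2) \<partial>M)" unfolding D_def by (subst nn_integral_distr) auto
    also have "\<dots> = 1" using nn_integral_eq_integral[OF Z_int2] Z_var by simp
    finally show "(\<integral>\<^sup>+x. ennreal (x\<^sup>2) \<partial>D) = 1" .
    have "D.prob {x. 0 < (\<bar>x\<bar> - gam p q th0 * x)\<^sup>2} = M.prob {\<omega> \<in> space M. 0 < (\<bar>Z 0 \<omega>\<bar> - gam p q th0 * Z 0 \<omega>)\<^sup>2}"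
      unfolding D_def by (subst measure_distr) (auto intro!: arg_cong[of _ _ M.prob])
    then show "0 < D.prob {x. 0 < (\<bar>x\<bar> - gam p q th0 * x)\<^sup>2}"
      using M.news_positive[OF Z_int Z_mean Z_int2 Z_var] by simp
    show "AE z in I.P. R.stable z" by (rule stab)
    show "integrable D (\<lambda>x. x)" unfolding D_def by (subst integrable_distr_eq) (use Z_int in auto)
    show "(\<integral>x. x \<partial>D) = 0" unfolding D_def by (subst integral_distr) (use Z_mean in auto)
    show "D.prob {a, b} < 1" for a b
    proof -
      have "D.prob {a, b} = M.prob {\<omega> \<in> space M. Z 0 \<omega> = a \<or> Z 0 \<omega> = b}"
        unfolding D_def by (subst measure_distr) (auto intro!: arg_cong[of _ _ M.prob])
      then show ?thesis using Z_not2[of a b] by simp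
    qed
  qed (use th0 \<open>p \<ge> 1\<close> \<open>q \<ge> 1\<close> in auto)
  have "AE z in I.P. \<forall>ch. (\<forall>n. ch n \<in> K \<and> Lhat p q c (ret z) n th0 \<le> Lhat p q c (ret z) n (ch n)) \<longrightarrow> ch \<longlonglongrightarrow> th0"
    by (rule AE_maximizers_consistent[OF K_compact K_sub pos_alpha last_nz coprime c_nonneg])
  then have "AE z in distr M I.P ?Z. \<forall>ch. (\<forall>n. ch n \<in> K \<and> Lhat p q c (ret z) n th0 \<le> Lhat p q c (ret z) n (ch n)) \<longrightarrow> ch \<longlonglongrightarrow> th0"
    unfolding distr_Z .
  then have "AE \<omega> in M. \<forall>ch. (\<forall>n. ch n \<in> K \<and> Lhat p q c (ret (?Z \<omega>)) n th0 \<le> Lhat p q c (ret (?Z \<omega>)) n (ch n)) \<longrightarrow> ch \<longlonglongrightarrow> th0"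
    by (rule AE_distrD[OF Zseq])
  then show ?thesis using conv AE_space
  proof eventually_elim
    case (elim \<omega>)
    have "R.vol2 (?Z \<omega>) t = (sig t \<omega>)\<^sup>2" for t 
      using limI[OF elim(2)[rule_format, of t]] unfolding R.vol2_def .
    then have "ret (?Z \<omega>) = (\<lambda>t. X t \<omega>)"
      using X_eq[OF elim(3)] sig_nonneg[OF elim(3)] by (simp add: ret_def fun_eq_iff)
    then show ?case using elim(1,3) thhat_K thhat_max th0_K by auto
  qed
qed

end
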